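(* Let $N\geq 1$, let $\Omega\subset\mathbb{R}^N$ be a bounded and regular domain, let $1<p_1<\dots<p_N$ be real exponents, let $q>1$, and for $\lambda\in\mathbb{R}$ consider the problem $$ (P_\lambda)\qquad \begin{cases} -\displaystyle\sum_{i=1}^N\frac{\partial}{\partial x_i}\left(\left|\frac{\partial u}{\partial x_i}\right|^{p_i-2}\frac{\partial u}{\partial x_i}\right)=\lambda u^{q-1} & \text{in } \Omega,\\ u=0 & \text{on } \partial\Omega. \end{cases} $$ Then the following hold. 1. Assume that $1<q<p_1$. Then there exists a positive solution of $(P_\lambda)$ if and only if $\lambda>0$. 2. Assume that $p_1\leq q<p_N$. Then there exists $\Lambda>0$ such that $(P_\lambda)$ does not possess positive solutions for $\lambda<\Lambda$, and $(P_\lambda)$ possesses at least one positive solution for $\lambda>\Lambda$.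
   Context: The anisotropic Sobolev space $W^{1,\mathbf{p}}_0(\Omega)$, with $\mathbf{p}=(p_1,\dots,p_N)$, is the closure of $C_0^\infty(\Omega)$ under the norm $\|u\|_{W^{1,\mathbf{p}}(\Omega)}=\sum_{i=1}^N\left\|\frac{\partial u}{\partial x_i}\right\|_{L^{p_i}(\Omega)}$, where $\frac{\partial u}{\partial x_i}$ is the $i$-th weak partial derivative. A solution of $(P_\lambda)$ is understood in the weak sense: $u\in W^{1,\mathbf{p}}_0(\Omega)$ such that $$ \int_\Omega\left[\sum_{i=1}^N\left|\frac{\partial u}{\partial x_i}\right|^{p_i-2}\frac{\partial u}{\partial x_i}\frac{\partial\phi}{\partial x_i}-\lambda u^{q-1}\phi\right]dx=0\qquad\text{for all }\phi\in W^{1,\mathbf{p}}_0(\Omega). $$ A positive solution means a solution $u$ with $u\geq 0$ a.e. in $\Omega$ and $u\not\equiv 0$ (that is, $u$ is nonnegative and nontrivial). "Regular domain" means a connected open set with smooth boundary. *)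

theory Defs
  imports "HOL-Analysis.Analysis"
begin

section \<open>Smooth functions and regular domains\<close>

definition partial_deriv :: "'n::finite \<Rightarrow> (real^'n \<Rightarrow> real) \<Rightarrow> real^'n \<Rightarrow> real" where
  "partial_deriv i f x = frechet_derivative f (at x) (axis i 1)"

text \<open>\<open>Ck_on k S f\<close> is meant for open \<open>S\<close>, where \<open>at x\<close> only sees values of \<open>f\<close> on \<open>S\<close>.\<close>

fun Ck_on :: "nat \<Rightarrow> (real^'n::finite) set \<Rightarrow> (real^'n \<Rightarrow> real) \<Rightarrow> bool" where
  "Ck_on 0 S f \<longleftrightarrow> continuous_on S f"
| "Ck_on (Suc k) S f \<longleftrightarrow>
     (\<forall>x\<in>S. f differentiable (at x)) \<and> (\<forall>i. Ck_on k S (partial_deriv i f))"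

definition smooth_on :: "(real^'n::finite) set \<Rightarrow> (real^'n \<Rightarrow> real) \<Rightarrow> bool" where
  "smooth_on S f \<longleftrightarrow> (\<forall>k. Ck_on k S f)"

text \<open>Smooth boundary, by local defining functions: near each boundary point the set is a strict
  sublevel set of a smooth function without critical points (so it lies locally on one side of
  its boundary).\<close>

definition smooth_boundary :: "(real^'n::finite) set \<Rightarrow> bool" where
  "smooth_boundary \<Omega> \<longleftrightarrow>
     (\<forall>x\<in>frontier \<Omega>. \<exists>U \<rho>. open U \<and> x \<in> U \<and> smooth_on U \<rho> \<and>
        (\<forall>y\<in>U. \<exists>i. partial_deriv i \<rho> y \<noteq> 0) \<and>
        \<Omega> \<inter> U = {y \<in> U. \<rho> y < 0})"

definition regular_domain :: "(real^'n::finite) set \<Rightarrow> bool" where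
  "regular_domain \<Omega> \<longleftrightarrow> \<Omega> \<noteq> {} \<and> open \<Omega> \<and> connected \<Omega> \<and> smooth_boundary \<Omega>"

definition test_functions :: "(real^'n::finite) set \<Rightarrow> (real^'n \<Rightarrow> real) set" where
  "test_functions \<Omega> =
     {\<phi>. smooth_on UNIV \<phi> \<and> compact (closure {x. \<phi> x \<noteq> 0}) \<and> closure {x. \<phi> x \<noteq> 0} \<subseteq> \<Omega>}"


section \<open>Lebesgue spaces and weak derivatives\<close>

text \<open>Elements of function spaces on \<open>\<Omega>\<close> are represented by functions on the whole space, of which
  only the restriction to \<open>\<Omega>\<close>, up to null sets, matters.\<close>

definition in_Lp :: "real \<Rightarrow> (real^'n::finite) set \<Rightarrow> (real^'n \<Rightarrow> real) \<Rightarrow> bool" where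
  "in_Lp r \<Omega> f \<longleftrightarrow> f \<in> borel_measurable (lebesgue_on \<Omega>) \<and>
     integrable (lebesgue_on \<Omega>) (\<lambda>x. \<bar>f x\<bar> powr r)"

definition Lp_norm :: "real \<Rightarrow> (real^'n::finite) set \<Rightarrow> (real^'n \<Rightarrow> real) \<Rightarrow> real" where
  "Lp_norm r \<Omega> f = (\<integral>x. \<bar>f x\<bar> powr r \<partial>lebesgue_on \<Omega>) powr (1 / r)"

definition locally_integrable :: "(real^'n::finite) set \<Rightarrow> (real^'n \<Rightarrow> real) \<Rightarrow> bool" where
  "locally_integrable \<Omega> f \<longleftrightarrow> (\<forall>K. compact K \<and> K \<subseteq> \<Omega> \<longrightarrow> f absolutely_integrable_on K)"

definition has_weak_partial ::
    "(real^'n::finite) set \<Rightarrow> 'n \<Rightarrow> (real^'n \<Rightarrow> real) \<Rightarrow> (real^'n \<Rightarrow> real) \<Rightarrow> bool" where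
  "has_weak_partial \<Omega> i u g \<longleftrightarrow>
     locally_integrable \<Omega> u \<and> locally_integrable \<Omega> g \<and>
     (\<forall>\<phi>\<in>test_functions \<Omega>.
        (\<integral>x. u x * partial_deriv i \<phi> x \<partial>lebesgue_on \<Omega>) = - (\<integral>x. g x * \<phi> x \<partial>lebesgue_on \<Omega>))"

text \<open>A representative of the weak partial derivative, which is unique up to null sets of \<open>\<Omega>\<close>.\<close>

definition weak_partial ::
    "(real^'n::finite) set \<Rightarrow> 'n \<Rightarrow> (real^'n \<Rightarrow> real) \<Rightarrow> real^'n \<Rightarrow> real" where
  "weak_partial \<Omega> i u = (SOME g. has_weak_partial \<Omega> i u g)"


section \<open>Anisotropic Sobolev spaces\<close>

definition aniso_W1 :: "(real^'n::finite) set \<Rightarrow> ('n \<Rightarrow> real) \<Rightarrow> (real^'n \<Rightarrow> real) set" where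
  "aniso_W1 \<Omega> p = {u. integrable (lebesgue_on \<Omega>) u \<and>
     (\<forall>i. \<exists>g. has_weak_partial \<Omega> i u g \<and> in_Lp (p i) \<Omega> g)}"

definition aniso_norm ::
    "(real^'n::finite) set \<Rightarrow> ('n \<Rightarrow> real) \<Rightarrow> (real^'n \<Rightarrow> real) \<Rightarrow> real" where
  "aniso_norm \<Omega> p u = (\<Sum>i\<in>UNIV. Lp_norm (p i) \<Omega> (weak_partial \<Omega> i u))"

text \<open>\<open>aniso_norm\<close> does not see additive constants, so it is a norm on the test functions but only
  a seminorm on \<open>aniso_W1 \<Omega> p\<close>; taking the closure there with respect to it alone would admit
  nonzero constants. For bounded \<open>\<Omega>\<close>, the Poincare inequality makes every \<open>aniso_norm\<close>-Cauchy
  sequence of test functions converge in \<open>L\<^sup>1(\<Omega>)\<close>; requiring the limit to be this one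
  identifies the closure (completion) with a space of functions.\<close>

definition aniso_W10 :: "(real^'n::finite) set \<Rightarrow> ('n \<Rightarrow> real) \<Rightarrow> (real^'n \<Rightarrow> real) set" where
  "aniso_W10 \<Omega> p = {u \<in> aniso_W1 \<Omega> p. \<exists>\<phi>::nat \<Rightarrow> real^'n \<Rightarrow> real.
     (\<forall>n. \<phi> n \<in> test_functions \<Omega>) \<and>
     (\<lambda>n. aniso_norm \<Omega> p (\<lambda>x. u x - \<phi> n x)) \<longlonglongrightarrow> 0 \<and>
     (\<lambda>n. \<integral>x. \<bar>u x - \<phi> n x\<bar> \<partial>lebesgue_on \<Omega>) \<longlonglongrightarrow> 0}"


section \<open>Weak and positive solutions\<close>

text \<open>\<open>has_bochner_integral\<close> rather than an equation for the integral, because the latter is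
  \<open>0\<close> by convention for non-integrable functions. The power \<open>u\<^sup>q\<^sup>-\<^sup>1\<close> is the intended one
  only where \<open>u \<ge> 0\<close>; the definition is only used for such \<open>u\<close>.\<close>

definition weak_solution ::
    "(real^'n::finite) set \<Rightarrow> ('n \<Rightarrow> real) \<Rightarrow> real \<Rightarrow> real \<Rightarrow> (real^'n \<Rightarrow> real) \<Rightarrow> bool" where
  "weak_solution \<Omega> p q lam u \<longleftrightarrow> u \<in> aniso_W10 \<Omega> p \<and>
     (\<forall>\<phi>\<in>aniso_W10 \<Omega> p. has_bochner_integral (lebesgue_on \<Omega>)
        (\<lambda>x. (\<Sum>i\<in>UNIV. \<bar>weak_partial \<Omega> i u x\<bar> powr (p i - 2) * weak_partial \<Omega> i u x
                          * weak_partial \<Omega> i \<phi> x)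
             - lam * u x powr (q - 1) * \<phi> x) 0)"

definition positive_solution ::
    "(real^'n::finite) set \<Rightarrow> ('n \<Rightarrow> real) \<Rightarrow> real \<Rightarrow> real \<Rightarrow> (real^'n \<Rightarrow> real) \<Rightarrow> bool" where
  "positive_solution \<Omega> p q lam u \<longleftrightarrow> weak_solution \<Omega> p q lam u \<and>
     (AE x in lebesgue_on \<Omega>. u x \<ge> 0) \<and> \<not> (AE x in lebesgue_on \<Omega>. u x = 0)"

end

(*
  The problem is variational.  The subsolution u0 (either 0 or a solution for a smaller parameter)
  is built into the right-hand side max(u, u0)^(q-1), whose energy is minimized over the closure of
  the test functions.  A minimizing sequence of test functions converges in L^1 by a Rellich
  argument, hence in L^q by interpolation with the bound in L^(p_i) coming from the Poincare
  inequality in a direction i with q < p_i; uniform convexity of t^p then upgrades this to strong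
  convergence of the gradients, so that no weak compactness is needed.  Comparing the
  Euler-Lagrange equation with that of u0 gives u >= u0, so the minimizer solves the original
  problem.  It is nontrivial if u0 is, or if the energy is negative somewhere, which holds for
  every positive parameter if q < p_1 and for large parameters in general.  Finally, for
  p_1 <= q < p_N the estimate u^q <= u^(p_1) + u^(p_N) and the Poincare inequality bound from below
  every parameter that admits a positive solution, and the threshold is the infimum of these.
*)
theory Submission
  imports Defs "HOL-Complex_Analysis.Great_Picard" "HOL-Computational_Algebra.Polynomial"
    "HOL-Real_Asymp.Real_Asymp"
begin

section \<open>Smooth functions and test functions\<close>

text \<open>Every estimate is phrased with integrals of powers instead of norms. The inequalities of
  Hoelder, Minkowski and Young are replaced by crude pointwise splittings with a small parameter,
  and a quantity is shown to vanish through bounds \<open>a n \<le> e + C * b n\<close> in which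
  \<open>C\<close> may blow up as \<open>e\<close> shrinks. The exponent q may exceed several of the
  p_i; a single direction can carry the lower order term because the Poincare inequality bounds a
  function by one partial derivative.

  Truncating at u0 has two effects. The right-hand side never falls below u0^(q-1), so the minimizer
  can be compared with u0 before anything is known about its sign; and the primitive is convex on
  the whole line, so its tangent inequality replaces differentiation of the functional.

  The comparison would normally test with the positive part, which does not map test functions to
  test functions. The function exp(-1/t), extended by 0 to t \<le> 0, takes its place: it has the
  same zero set, is nondecreasing and has a bounded derivative.\<close>

lemma frechet_derivative_worksI:
  "f differentiable (at x) \<Longrightarrow> (f has_derivative frechet_derivative f (at x)) (at x)"
  by (simp add: frechet_derivative_works)

lemma partial_deriv_eqI:
  "(f has_derivative f') (at x) \<Longrightarrow> partial_deriv i f x = f' (axis i 1)"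
  unfolding partial_deriv_def using frechet_derivative_at by force

lemma Ck_on_SucD: "Ck_on (Suc k) S f \<Longrightarrow> Ck_on k S f"
proof (induction k arbitrary: f)
  case 0
  then have "f differentiable_on S"
    unfolding differentiable_on_def by (auto intro: differentiable_at_withinI)
  then show ?case by (simp add: differentiable_imp_continuous_on)
next
  case (Suc k)
  have "Ck_on k S (partial_deriv i f)" for i
    by (rule Suc.IH) (use Suc.prems Ck_on.simps(2) in blast)
  moreover have "\<forall>x\<in>S. f differentiable (at x)"
    using Suc.prems Ck_on.simps(2) by blast
  ultimately show ?case by (subst Ck_on.simps) blast
qed

section \<open>Differentiation rules and closure properties of C^k functions\<close>

lemma partial_deriv_const [simp]: "partial_deriv i (\<lambda>x. c) = (\<lambda>x. 0)"
  by (rule ext) (simp add: partial_deriv_eqI[OF has_derivative_const])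

lemma partial_deriv_add:
  "f differentiable (at x) \<Longrightarrow> g differentiable (at x) \<Longrightarrow>
    partial_deriv i (\<lambda>x. f x + g x) x = partial_deriv i f x + partial_deriv i g x"
  using partial_deriv_eqI[OF has_derivative_add[OF frechet_derivative_worksI frechet_derivative_worksI]]
  by (simp add: partial_deriv_def)

lemma partial_deriv_mult:
  "f differentiable (at x) \<Longrightarrow> g differentiable (at x) \<Longrightarrow>
    partial_deriv i (\<lambda>x. f x * g x) x = f x * partial_deriv i g x + partial_deriv i f x * g x"
  using partial_deriv_eqI[OF has_derivative_mult[OF frechet_derivative_worksI frechet_derivative_worksI]]
  by (simp add: partial_deriv_def)

lemma partial_deriv_cmult:
  "f differentiable (at x) \<Longrightarrow> partial_deriv i (\<lambda>x. c * f x) x = c * partial_deriv i f x"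
  using partial_deriv_mult[of "\<lambda>_. c" x f i] by simp

lemma has_derivative_compose_real:
  assumes "(g has_real_derivative g') (at (f x))" "f differentiable (at x)"
  shows "((\<lambda>x. g (f x)) has_derivative (\<lambda>v. g' * frechet_derivative f (at x) v)) (at x)"
  using has_derivative_compose[OF frechet_derivative_worksI[OF assms(2)]
      assms(1)[unfolded has_field_derivative_def]] by (simp add: mult.commute)

lemma partial_deriv_compose:
  "(g has_real_derivative g') (at (f x)) \<Longrightarrow> f differentiable (at x) \<Longrightarrow>
    partial_deriv i (\<lambda>x. g (f x)) x = g' * partial_deriv i f x"
  using partial_deriv_eqI[OF has_derivative_compose_real] by (simp add: partial_deriv_def)

lemma partial_deriv_nth:
  fixes i :: "'n::finite"
  shows "partial_deriv i (\<lambda>x. x $ j) x = (if i = j then 1 else 0)"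
proof -
  have "((\<lambda>x::real^'n. x $ j) has_derivative (\<lambda>v. v $ j)) (at x)"
    by (intro bounded_linear_imp_has_derivative bounded_linear_vec_nth)
  then show ?thesis by (auto simp: partial_deriv_eqI axis_def)
qed

lemma differentiable_nth: "(\<lambda>x::real^'n. x $ j) differentiable (at x)"
  using bounded_linear_imp_differentiable bounded_linear_vec_nth by blast

lemma Ck_on_const: "Ck_on k S (\<lambda>x. c)"
  by (induction k arbitrary: c) auto

lemma Ck_on_add: "Ck_on k UNIV f \<Longrightarrow> Ck_on k UNIV g \<Longrightarrow> Ck_on k UNIV (\<lambda>x. f x + g x)"
proof (induction k arbitrary: f g)
  case (Suc k)
  then have "partial_deriv i (\<lambda>x. f x + g x) = (\<lambda>x. partial_deriv i f x + partial_deriv i g x)" for i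
    by (intro ext partial_deriv_add) auto
  with Suc show ?case by auto
qed (auto intro: continuous_on_add)

lemma Ck_on_mult: "Ck_on k UNIV f \<Longrightarrow> Ck_on k UNIV g \<Longrightarrow> Ck_on k UNIV (\<lambda>x. f x * g x)"
proof (induction k arbitrary: f g)
  case (Suc k)
  then have "partial_deriv i (\<lambda>x. f x * g x) = (\<lambda>x. f x * partial_deriv i g x + partial_deriv i f x * g x)" for i
    by (intro ext partial_deriv_mult) auto
  moreover have "Ck_on k UNIV (\<lambda>x. f x * partial_deriv i g x + partial_deriv i f x * g x)" for i
    using Suc.prems Ck_on_SucD[OF Suc.prems(1)] Ck_on_SucD[OF Suc.prems(2)]
    by (intro Ck_on_add Suc.IH) auto
  ultimately show ?case using Suc.prems by auto
qed (auto intro: continuous_on_mult)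

lemma Ck_on_nth: "Ck_on k UNIV (\<lambda>x::real^'n. x $ j)"
proof (cases k)
  case (Suc m)
  have "partial_deriv i (\<lambda>x::real^'n. x $ j) = (\<lambda>x. if i = j then 1 else 0)" for i
    by (rule ext) (rule partial_deriv_nth)
  with Suc show ?thesis by (auto simp: Ck_on_const differentiable_nth)
qed (auto intro: continuous_intros)

text \<open>The outer function comes as the whole sequence of its derivatives: differentiating the
  composition of \<open>g j\<close> produces that of \<open>g (Suc j)\<close>, so the induction over
  \<open>k\<close> must cover all \<open>j\<close> at once.\<close>

lemma Ck_on_compose:
  assumes "\<And>j t. (g j has_real_derivative g (Suc j) t) (at t)"
  shows "Ck_on k UNIV f \<Longrightarrow> Ck_on k UNIV (\<lambda>x. g j (f x))"
proof (induction k arbitrary: j)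
  case 0
  have "continuous_on UNIV (g j)"
    by (rule DERIV_continuous_on) (auto intro: DERIV_subset assms)
  then show ?case using 0 by (auto intro: continuous_on_compose2)
next
  case (Suc k)
  then have d: "f differentiable (at x)" for x by simp
  have "partial_deriv i (\<lambda>x. g j (f x)) = (\<lambda>x. g (Suc j) (f x) * partial_deriv i f x)" for i
    by (intro ext partial_deriv_compose assms d)
  moreover have "Ck_on k UNIV (\<lambda>x. g (Suc j) (f x) * partial_deriv i f x)" for i
    using Suc.prems Ck_on_SucD[OF Suc.prems] by (intro Ck_on_mult Suc.IH) auto
  moreover have "(\<lambda>x. g j (f x)) differentiable (at x)" for x
    using has_derivative_compose_real[OF assms d] differentiableI by blast
  ultimately show ?case by auto
qed

lemma Ck_on_inverse:
  assumes "\<And>x. f x > 0"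
  shows "Ck_on k UNIV f \<Longrightarrow> Ck_on k UNIV (\<lambda>x. inverse (f x))"
proof (induction k)
  case 0
  then show ?case using assms by (auto intro!: continuous_on_inverse simp: less_imp_neq[THEN not_sym])
next
  case (Suc k)
  then have d: "f differentiable (at x)" for x by simp
  have D: "(inverse has_real_derivative (-1) * (inverse (f x) * inverse (f x))) (at (f x))" for x
    using DERIV_inverse[of "f x" UNIV] assms[of x] by (simp add: power2_eq_square)
  have "partial_deriv i (\<lambda>x. inverse (f x)) = (\<lambda>x. ((-1) * (inverse (f x) * inverse (f x))) * partial_deriv i f x)" for i
    by (intro ext partial_deriv_compose D d)
  moreover have "Ck_on k UNIV (\<lambda>x. ((-1) * (inverse (f x) * inverse (f x))) * partial_deriv i f x)" for i
    using Suc.prems Ck_on_SucD[OF Suc.prems] by (intro Ck_on_mult Ck_on_const Suc.IH) auto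
  moreover have "(\<lambda>x. inverse (f x)) differentiable (at x)" for x
    using has_derivative_compose_real[OF D d] differentiableI by blast
  ultimately show ?case by auto
qed

lemma Ck_on_prod:
  "finite I \<Longrightarrow> (\<And>i. i \<in> I \<Longrightarrow> Ck_on k UNIV (f i)) \<Longrightarrow> Ck_on k UNIV (\<lambda>x. \<Prod>i\<in>I. f i x)"
  by (induction I rule: finite_induct) (auto intro: Ck_on_const Ck_on_mult)

section \<open>A smooth function that is flat at 0\<close>

definition flat_exp :: "real poly \<Rightarrow> real \<Rightarrow> real" where
  "flat_exp P t = (if t > 0 then poly P (1 / t) * exp (- (1 / t)) else 0)"

text \<open>The power \<open>s ^ k\<close> is carried along for the induction on the polynomial: the
  factor \<open>s\<close> that \<open>pCons\<close> brings is absorbed into it.\<close>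

lemma tendsto_power_poly_exp_0: "((\<lambda>s::real. s ^ k * poly P s * exp (- s)) \<longlongrightarrow> 0) at_top"
proof (induction P arbitrary: k)
  case (pCons a P)
  have "((\<lambda>s. a * (s ^ k / exp s) + s ^ Suc k * poly P s * exp (- s)) \<longlongrightarrow> a * 0 + 0) at_top"
    by (intro tendsto_add tendsto_mult tendsto_const tendsto_power_div_exp_0 pCons)
  then show ?case by (simp add: algebra_simps exp_minus divide_inverse)
qed simp

text \<open>The functions P(1/t) exp(-1/t) form a class closed under differentiation, with P
  replaced by X^2 (P - P'). This yields all derivatives at once, including those at 0.\<close>

lemma DERIV_flat_exp:
  "(flat_exp P has_real_derivative flat_exp ([:0, 0, 1:] * (P - pderiv P)) t) (at t)"
proof -
  consider "t > 0" | "t < 0" | "t = 0" by linarith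
  then show ?thesis
  proof cases
    case 1
    have "((\<lambda>t. poly P (1 / t) * exp (- (1 / t))) has_real_derivative
        flat_exp ([:0, 0, 1:] * (P - pderiv P)) t) (at t)"
      using 1 unfolding flat_exp_def
      by (auto intro!: derivative_eq_intros DERIV_chain'[OF _ poly_DERIV] simp: field_simps power2_eq_square)
    then show ?thesis
      by (rule DERIV_cong_ev[THEN iffD1, rotated -1])
        (use 1 eventually_nhds_in_open[of "{0<..}" t] in \<open>auto elim!: eventually_mono simp: flat_exp_def\<close>)
  next
    case 2
    have "((\<lambda>t. 0) has_real_derivative flat_exp ([:0, 0, 1:] * (P - pderiv P)) t) (at t)"
      using 2 by (simp add: flat_exp_def)
    then show ?thesis
      by (rule DERIV_cong_ev[THEN iffD1, rotated -1])
        (use 2 eventually_nhds_in_open[of "{..<0}" t] in \<open>auto elim!: eventually_mono simp: flat_exp_def\<close>)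
  next
    case 3
    \<comment> \<open>With s = 1/t the difference quotient at 0 from the right is s P(s) exp(-s),
      hence the exponent 1; from the left it is identically 0.\<close>
    have "((\<lambda>t. (1/t) ^ 1 * poly P (1/t) * exp (- (1/t))) \<longlongrightarrow> 0) (at_right 0)"
      using filterlim_compose[OF tendsto_power_poly_exp_0[of 1 P] filterlim_inverse_at_top_right]
      by (simp add: inverse_eq_divide)
    then have "((\<lambda>t. flat_exp P t / t) \<longlongrightarrow> 0) (at_right 0)"
      by (rule Lim_transform_eventually)
        (auto simp: eventually_at_right_less flat_exp_def intro!: eventually_mono[OF eventually_at_right_less[of 0]])
    moreover have "((\<lambda>t. flat_exp P t / t) \<longlongrightarrow> 0) (at_left 0)"
      by (rule Lim_transform_eventually[OF tendsto_const])
        (auto simp: flat_exp_def eventually_at_left intro!: exI[of _ "-1"] eventually_at_leftI[of "-1"])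
    ultimately have "((\<lambda>t. flat_exp P t / t) \<longlongrightarrow> 0) (at 0)"
      by (simp add: filterlim_split_at)
    then show ?thesis using 3 by (simp add: has_field_derivative_iff flat_exp_def)
  qed
qed

text \<open>\<open>flat_seq j\<close> is the \<open>j\<close>-th derivative of the smooth function that equals \<open>exp (- (1 / t))\<close> for
  \<open>t > 0\<close> and vanishes elsewhere.\<close>

definition flat_seq :: "nat \<Rightarrow> real \<Rightarrow> real" where
  "flat_seq j = flat_exp (((\<lambda>P. [:0, 0, 1:] * (P - pderiv P)) ^^ j) 1)"

lemma DERIV_flat_seq: "(flat_seq j has_real_derivative flat_seq (Suc j) t) (at t)"
  unfolding flat_seq_def by (simp add: DERIV_flat_exp del: mult_pCons_left)

lemma flat_seq_0: "flat_seq 0 t = (if t > 0 then exp (- (1 / t)) else 0)"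
  by (simp add: flat_seq_def flat_exp_def)

lemma flat_seq_1: "flat_seq (Suc 0) t = (if t > 0 then (1 / t)^2 * exp (- (1 / t)) else 0)"
  by (simp add: flat_seq_def flat_exp_def power2_eq_square)

text \<open>These bounds make \<open>flat_seq 0\<close> nondecreasing and Lipschitz, as the chain
  rule in the closure of the test functions and the comparison argument require.\<close>

lemma flat_seq_1_bounds: "0 \<le> flat_seq (Suc 0) t" "flat_seq (Suc 0) t \<le> 2"
proof -
  show "0 \<le> flat_seq (Suc 0) t" by (simp add: flat_seq_1)
  have "s^2 * exp (- s) \<le> 2" if "s > 0" for s :: real
  proof -
    have "1 + s + s^2 / 2 \<le> exp s" using exp_lower_Taylor_quadratic[of s] that by simp
    then have "s^2 \<le> 2 * exp s" using that by simp
    then show ?thesis by (simp add: exp_minus field_simps)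
  qed
  then show "flat_seq (Suc 0) t \<le> 2" by (simp add: flat_seq_1)
qed

lemma continuous_flat_seq: "continuous_on S (flat_seq j)"
  by (rule DERIV_continuous_on) (rule has_field_derivative_at_within[OF DERIV_flat_seq])

section \<open>The algebra of test functions\<close>

lemma smooth_on_imp_Ck: "smooth_on S f \<Longrightarrow> Ck_on k S f" by (simp add: smooth_on_def)

lemma smooth_on_differentiable: "smooth_on UNIV f \<Longrightarrow> f differentiable (at x)"
  using smooth_on_imp_Ck[of UNIV f "Suc 0"] by simp

lemma smooth_on_continuous: "smooth_on UNIV f \<Longrightarrow> continuous_on UNIV f"
  using smooth_on_imp_Ck[of UNIV f 0] by simp

lemma smooth_on_partial: "smooth_on UNIV f \<Longrightarrow> smooth_on UNIV (partial_deriv i f)"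
  unfolding smooth_on_def using Ck_on.simps(2) by blast

lemma smooth_on_const: "smooth_on S (\<lambda>x. c)" by (simp add: smooth_on_def Ck_on_const)
lemma smooth_on_add: "smooth_on UNIV f \<Longrightarrow> smooth_on UNIV g \<Longrightarrow> smooth_on UNIV (\<lambda>x. f x + g x)"
  by (simp add: smooth_on_def Ck_on_add)
lemma smooth_on_mult: "smooth_on UNIV f \<Longrightarrow> smooth_on UNIV g \<Longrightarrow> smooth_on UNIV (\<lambda>x. f x * g x)"
  by (simp add: smooth_on_def Ck_on_mult)

text \<open>Any compact subset of the domain outside which the function vanishes may stand for the
  support, so closure properties need no computation of supports.\<close>

lemma test_functions_iff:
  "\<phi> \<in> test_functions \<Omega> \<longleftrightarrow> smooth_on UNIV \<phi> \<and> (\<exists>K. compact K \<and> K \<subseteq> \<Omega> \<and> (\<forall>x. x \<notin> K \<longrightarrow> \<phi> x = 0))"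
proof
  assume "\<phi> \<in> test_functions \<Omega>"
  then show "smooth_on UNIV \<phi> \<and> (\<exists>K. compact K \<and> K \<subseteq> \<Omega> \<and> (\<forall>x. x \<notin> K \<longrightarrow> \<phi> x = 0))"
    unfolding test_functions_def using closure_subset[of "{x. \<phi> x \<noteq> 0}"] by blast
next
  assume "smooth_on UNIV \<phi> \<and> (\<exists>K. compact K \<and> K \<subseteq> \<Omega> \<and> (\<forall>x. x \<notin> K \<longrightarrow> \<phi> x = 0))"
  then obtain K where K: "smooth_on UNIV \<phi>" "compact K" "K \<subseteq> \<Omega>" "{x. \<phi> x \<noteq> 0} \<subseteq> K" by blast
  then have "closure {x. \<phi> x \<noteq> 0} \<subseteq> K" by (intro closure_minimal compact_imp_closed)
  moreover have "bounded {x. \<phi> x \<noteq> 0}" using K bounded_subset compact_imp_bounded by blast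
  ultimately show "\<phi> \<in> test_functions \<Omega>"
    using K by (auto simp: test_functions_def compact_closure)
qed

lemma partial_deriv_outside:
  assumes "closed K" "\<And>x. x \<notin> K \<Longrightarrow> f x = 0" "x \<notin> K"
  shows "partial_deriv i f x = 0"
proof -
  have "(f has_derivative (\<lambda>_. 0)) (at x)"
    by (rule has_derivative_transform_within_open[OF has_derivative_const open_Compl[OF assms(1)]])
      (use assms in auto)
  then show ?thesis by (simp add: partial_deriv_eqI)
qed

lemma test_functions_supportE:
  assumes "\<phi> \<in> test_functions \<Omega>"
  obtains K where "compact K" "K \<subseteq> \<Omega>" "\<And>x. x \<notin> K \<Longrightarrow> \<phi> x = 0"
    "\<And>x i. x \<notin> K \<Longrightarrow> partial_deriv i \<phi> x = 0"
proof -
  obtain K where "compact K" "K \<subseteq> \<Omega>" "\<And>x. x \<notin> K \<Longrightarrow> \<phi> x = 0"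
    using assms unfolding test_functions_iff by blast
  with that partial_deriv_outside[OF compact_imp_closed] show thesis by metis
qed

lemma test_functions_partial: "\<phi> \<in> test_functions \<Omega> \<Longrightarrow> partial_deriv i \<phi> \<in> test_functions \<Omega>"
  using smooth_on_partial[of \<phi> i] unfolding test_functions_iff
  by (metis compact_imp_closed partial_deriv_outside)

lemma test_functions_smooth: "\<phi> \<in> test_functions \<Omega> \<Longrightarrow> smooth_on UNIV \<phi>"
  by (simp add: test_functions_def)

lemmas test_functions_differentiable = smooth_on_differentiable[OF test_functions_smooth]
lemmas test_functions_continuous = smooth_on_continuous[OF test_functions_smooth]

lemma test_functions_zero: "(\<lambda>x. 0) \<in> test_functions \<Omega>"
  unfolding test_functions_iff by (auto simp: smooth_on_const)

lemma test_functions_mult_smooth: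
  "smooth_on UNIV f \<Longrightarrow> \<phi> \<in> test_functions \<Omega> \<Longrightarrow> (\<lambda>x. f x * \<phi> x) \<in> test_functions \<Omega>"
  unfolding test_functions_iff by (auto simp: smooth_on_mult)

lemma test_functions_cmult: "\<phi> \<in> test_functions \<Omega> \<Longrightarrow> (\<lambda>x. c * \<phi> x) \<in> test_functions \<Omega>"
  by (rule test_functions_mult_smooth[OF smooth_on_const])

lemma test_functions_add:
  assumes "\<phi> \<in> test_functions \<Omega>" "\<psi> \<in> test_functions \<Omega>"
  shows "(\<lambda>x. \<phi> x + \<psi> x) \<in> test_functions \<Omega>"
proof -
  obtain K L where "compact K" "K \<subseteq> \<Omega>" "\<And>x. x \<notin> K \<Longrightarrow> \<phi> x = 0"
    "compact L" "L \<subseteq> \<Omega>" "\<And>x. x \<notin> L \<Longrightarrow> \<psi> x = 0"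
    using assms unfolding test_functions_iff by metis
  with assms show ?thesis unfolding test_functions_iff
    by (intro conjI smooth_on_add) (auto intro!: exI[of _ "K \<union> L"])
qed

lemma test_functions_diff:
  "\<phi> \<in> test_functions \<Omega> \<Longrightarrow> \<psi> \<in> test_functions \<Omega> \<Longrightarrow> (\<lambda>x. \<phi> x - \<psi> x) \<in> test_functions \<Omega>"
  using test_functions_add[OF _ test_functions_cmult[of \<psi> \<Omega> "-1"]] by simp

lemma partial_deriv_diff:
  "f differentiable (at x) \<Longrightarrow> g differentiable (at x) \<Longrightarrow>
    partial_deriv i (\<lambda>x. f x - g x) x = partial_deriv i f x - partial_deriv i g x"
  using partial_deriv_eqI[OF has_derivative_diff[OF frechet_derivative_worksI frechet_derivative_worksI]]
  by (simp add: partial_deriv_def)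

text \<open>Compact support survives the composition because \<open>flat_seq 0\<close> vanishes at
  0.\<close>

lemma test_functions_flat:
  assumes "\<phi> \<in> test_functions \<Omega>"
  shows "(\<lambda>x. flat_seq 0 (\<phi> x)) \<in> test_functions \<Omega>"
    and "partial_deriv i (\<lambda>x. flat_seq 0 (\<phi> x)) x = flat_seq (Suc 0) (\<phi> x) * partial_deriv i \<phi> x"
proof -
  have "Ck_on k UNIV (\<lambda>x. flat_seq 0 (\<phi> x))" for k
    by (rule Ck_on_compose[of flat_seq, OF DERIV_flat_seq])
      (rule smooth_on_imp_Ck[OF test_functions_smooth[OF assms]])
  then show "(\<lambda>x. flat_seq 0 (\<phi> x)) \<in> test_functions \<Omega>"
    using assms unfolding test_functions_iff by (auto simp: smooth_on_def flat_seq_0)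
  show "partial_deriv i (\<lambda>x. flat_seq 0 (\<phi> x)) x = flat_seq (Suc 0) (\<phi> x) * partial_deriv i \<phi> x"
    by (rule partial_deriv_compose[OF DERIV_flat_seq test_functions_differentiable[OF assms]])
qed

section \<open>Bump functions on boxes\<close>

definition box_bump :: "real^'n::finite \<Rightarrow> real^'n \<Rightarrow> real^'n \<Rightarrow> real" where
  "box_bump a b x = (\<Prod>i\<in>UNIV. flat_seq 0 (x $ i - a $ i) * flat_seq 0 (b $ i - x $ i))"

lemma box_bump_smooth:
  fixes a b :: "real^'n::finite"
  shows "smooth_on UNIV (box_bump a b)"
proof -
  have "Ck_on k UNIV (\<lambda>x::real^'n. flat_seq 0 (x $ i - a $ i))" for k i
    using Ck_on_compose[of flat_seq, OF DERIV_flat_seq Ck_on_add[OF Ck_on_nth Ck_on_const[of _ _ "- a $ i"]]] by simp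
  moreover have "Ck_on k UNIV (\<lambda>x::real^'n. flat_seq 0 (b $ i - x $ i))" for k i
    using Ck_on_compose[of flat_seq, OF DERIV_flat_seq
        Ck_on_add[OF Ck_on_const[of _ _ "b $ i"] Ck_on_mult[OF Ck_on_const[of _ _ "-1"] Ck_on_nth[of _ i]]]] by simp
  ultimately show ?thesis unfolding smooth_on_def box_bump_def
    by (intro allI Ck_on_prod Ck_on_mult) auto
qed

lemma box_bump_nonneg: "0 \<le> box_bump a b x"
  unfolding box_bump_def by (intro prod_nonneg) (auto simp: flat_seq_0)

lemma box_bump_pos_iff: "0 < box_bump a b x \<longleftrightarrow> x \<in> box a b"
proof -
  have "0 < box_bump a b x \<longleftrightarrow> box_bump a b x \<noteq> 0" using box_bump_nonneg[of a b x] by linarith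
  also have "\<dots> \<longleftrightarrow> x \<in> box a b"
    unfolding box_bump_def mem_box_cart by (auto simp: flat_seq_0)
  finally show ?thesis .
qed

lemma box_bump_test: "cbox a b \<subseteq> \<Omega> \<Longrightarrow> box_bump a b \<in> test_functions \<Omega>"
  unfolding test_functions_iff
proof (intro conjI box_bump_smooth exI[of _ "cbox a b"] allI impI)
  show "box_bump a b x = 0" if "x \<notin> cbox a b" for x
    using box_bump_pos_iff[of a b x] box_bump_nonneg[of a b x] that box_subset_cbox[of a b] by force
qed auto

text \<open>A bump b is positive exactly on the open box, so k b / (1 + k b) takes values in [0, 1)
  and tends pointwise to the indicator of that box. This turns testing with smooth functions into
  integration over boxes.\<close>

lemma box_bump_approx:
  assumes "cbox a b \<subseteq> \<Omega>"
  shows "(\<lambda>x. real k * box_bump a b x / (1 + real k * box_bump a b x)) \<in> test_functions \<Omega>"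
proof -
  have "smooth_on UNIV (\<lambda>x. real k * inverse (1 + real k * box_bump a b x))"
    using box_bump_smooth[of a b] unfolding smooth_on_def
    by (intro allI Ck_on_mult Ck_on_inverse Ck_on_add Ck_on_const)
      (auto intro!: add_pos_nonneg mult_nonneg_nonneg box_bump_nonneg)
  from test_functions_mult_smooth[OF this box_bump_test[OF assms]] show ?thesis
    by (simp add: divide_inverse algebra_simps)
qed

lemma box_bump_approx_tendsto:
  "(\<lambda>k. real k * box_bump a b x / (1 + real k * box_bump a b x)) \<longlonglongrightarrow> indicator (box a b) x"
proof (cases "x \<in> box a b")
  case True
  then have "box_bump a b x > 0" by (simp add: box_bump_pos_iff)
  then have "(\<lambda>k. real k * box_bump a b x / (1 + real k * box_bump a b x)) \<longlonglongrightarrow> 1" by real_asymp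
  then show ?thesis using True by simp
next
  case False
  then have "box_bump a b x = 0" using box_bump_pos_iff box_bump_nonneg by (metis antisym_conv2)
  then show ?thesis using False by simp
qed

section \<open>Power functions and Lebesgue spaces\<close>

lemma powr_add_le:
  fixes a b r :: real
  assumes "0 \<le> a" "0 \<le> b" "0 \<le> r"
  shows "(a + b) powr r \<le> 2 powr r * (a powr r + b powr r)"
proof -
  have "(a + b) powr r \<le> (2 * max a b) powr r"
    using assms by (intro powr_mono2) auto
  also have "\<dots> = 2 powr r * max a b powr r" using assms by (simp add: powr_mult)
  also have "\<dots> \<le> 2 powr r * (a powr r + b powr r)"
    by (intro mult_left_mono) (auto simp: max_def)
  finally show ?thesis .
qed

lemma abs_add_powr_le:
  fixes a b r :: real
  shows "0 \<le> r \<Longrightarrow> \<bar>a + b\<bar> powr r \<le> 2 powr r * (\<bar>a\<bar> powr r + \<bar>b\<bar> powr r)"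
  using powr_add_le[of "\<bar>a\<bar>" "\<bar>b\<bar>" r] powr_mono2[of r "\<bar>a + b\<bar>" "\<bar>a\<bar> + \<bar>b\<bar>"] by linarith

lemma powr_minus_1_mult: "0 \<le> a \<Longrightarrow> a powr (r - 1) * a = a powr r" for a r :: real
  using powr_mult_base[of a "r - 1"] by (simp add: mult.commute)

text \<open>Either b \<le> e a, and the first term alone suffices, or a < b / e, and the second
  does. The constants are not sharp; what matters is that the first one can be made small.\<close>

lemma young_eps:
  fixes a b r e :: real
  assumes "0 \<le> a" "0 \<le> b" "1 \<le> r" "0 < e"
  shows "a powr (r - 1) * b \<le> e * a powr r + e powr (1 - r) * b powr r"
proof (cases "b \<le> e * a")
  case True
  then have "a powr (r - 1) * b \<le> a powr (r - 1) * (e * a)" by (intro mult_left_mono) auto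
  also have "\<dots> = e * a powr r" using powr_minus_1_mult[of a r] assms by simp
  finally show ?thesis by (simp add: add_increasing2)
next
  case False
  then have "a \<le> b / e" using assms by (simp add: field_simps)
  then have "a powr (r - 1) * b \<le> (b / e) powr (r - 1) * b"
    using assms by (intro mult_right_mono powr_mono2) auto
  also have "\<dots> = e powr (1 - r) * (b powr (r - 1) * b)"
    using assms powr_minus_divide[of e "r - 1"] by (simp add: powr_divide)
  also have "\<dots> = e powr (1 - r) * b powr r" using assms by (simp add: powr_minus_1_mult)
  finally show ?thesis using assms by (simp add: add_increasing)
qed

lemma powr_interpolate:
  fixes q s e :: real
  assumes "1 \<le> q" "q < s" "0 < e"
  obtains C where "0 \<le> C" "\<And>t. 0 \<le> t \<Longrightarrow> t powr q \<le> e * t powr s + C * t"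
proof -
  \<comment> \<open>The point where t^(q-s) equals \<open>e\<close>: beyond it t^q is at most e t^s,
    below it t^(q-1) is at most K^(q-1).\<close>
  define K where "K = e powr (1 / (q - s))"
  have K: "K > 0" "K powr (q - s) = e" using assms by (auto simp: K_def powr_powr)
  have "t powr q \<le> e * t powr s + K powr (q - 1) * t" if t: "0 \<le> t" for t
  proof (cases "t \<le> K")
    case True
    have "t powr q = t powr (q - 1) * t" using t by (simp add: powr_minus_1_mult)
    also have "\<dots> \<le> K powr (q - 1) * t"
      using True t assms by (intro mult_right_mono powr_mono2) auto
    finally show ?thesis using assms by (simp add: add_increasing)
  next
    case False
    then have "t powr q = t powr (q - s) * t powr s" by (simp flip: powr_add)
    also have "\<dots> \<le> e * t powr s"
      using False K assms powr_mono2'[of "q - s" K t] by (intro mult_right_mono) auto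
    finally show ?thesis using t K by (simp add: add_increasing2)
  qed
  then show thesis using that[of "K powr (q - 1)"] by simp
qed

section \<open>Monotonicity and convexity of power functions\<close>

definition pflux :: "real \<Rightarrow> real \<Rightarrow> real" where
  "pflux r t = \<bar>t\<bar> powr (r - 2) * t"

lemma pflux_pos: "0 \<le> t \<Longrightarrow> pflux r t = t powr (r - 1)"
  using powr_minus_1_mult[of t "r - 1"] by (simp add: pflux_def)

lemma pflux_minus: "pflux r (- t) = - pflux r t"
  by (simp add: pflux_def)

lemma pflux_neg: "t \<le> 0 \<Longrightarrow> pflux r t = - ((- t) powr (r - 1))"
  using pflux_pos[of "- t" r] pflux_minus[of r t] by simp

lemma abs_pflux: "\<bar>pflux r t\<bar> = \<bar>t\<bar> powr (r - 1)"
  by (cases "0 \<le> t") (auto simp: pflux_pos pflux_neg)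

lemma pflux_self: "pflux r t * t = \<bar>t\<bar> powr r"
  using powr_minus_1_mult[of "\<bar>t\<bar>" r] by (cases "0 \<le> t") (auto simp: pflux_pos pflux_neg)

lemma pflux_strict_mono:
  assumes "1 < r" "a < b"
  shows "pflux r a < pflux r b"
proof -
  consider "0 \<le> a" | "b \<le> 0" | "a < 0" "0 < b" by linarith
  then show ?thesis
    by cases (use assms powr_less_mono2[of "r - 1" a b] powr_less_mono2[of "r - 1" "- b" "- a"]
      in \<open>auto simp: pflux_pos pflux_neg intro: less_trans[of _ 0]\<close>)
qed

lemma pflux_monotone: "1 < r \<Longrightarrow> 0 \<le> (pflux r a - pflux r b) * (a - b)"
  using pflux_strict_mono[of r a b] pflux_strict_mono[of r b a]
  by (cases a b rule: linorder_cases) (auto simp: zero_le_mult_iff)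

lemma pflux_monotone_eq_0: "1 < r \<Longrightarrow> (pflux r a - pflux r b) * (a - b) = 0 \<Longrightarrow> a = b"
  using pflux_strict_mono[of r a b] pflux_strict_mono[of r b a]
  by (cases a b rule: linorder_cases) auto

lemma isCont_pflux: "1 < r \<Longrightarrow> isCont (pflux r) t"
proof -
  assume r: "1 < r"
  \<comment> \<open>The factor |t|^(r-2) is singular at 0 when r < 2; in this form only positive
    exponents of nonnegative bases remain.\<close>
  have "pflux r = (\<lambda>t. max t 0 powr (r - 1) - max (- t) 0 powr (r - 1))"
  proof
    show "pflux r t = max t 0 powr (r - 1) - max (- t) 0 powr (r - 1)" for t
      using r by (cases "0 \<le> t") (auto simp: pflux_pos pflux_neg max_def)
  qed
  moreover have "continuous_on UNIV (\<lambda>t::real. max t 0 powr (r - 1) - max (- t) 0 powr (r - 1))"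
    using r by (intro continuous_intros continuous_on_powr') auto
  ultimately show ?thesis by (simp add: continuous_on_eq_continuous_at)
qed

lemma borel_measurable_pflux [measurable]: "pflux r \<in> borel_measurable borel"
  unfolding pflux_def by measurable

lemma DERIV_abs_powr:
  assumes "1 < r"
  shows "((\<lambda>t. \<bar>t\<bar> powr r) has_real_derivative r * pflux r t) (at t)"
proof -
  consider "t > 0" | "t < 0" | "t = 0" by linarith
  then show ?thesis
  proof cases
    case 1
    have "((\<lambda>t. t powr r) has_real_derivative r * pflux r t) (at t)"
      using 1 has_real_derivative_powr[of t r] by (simp add: pflux_pos)
    then show ?thesis
      by (rule DERIV_cong_ev[THEN iffD1, rotated -1])
        (use 1 eventually_nhds_in_open[of "{0<..}" t] in \<open>auto elim!: eventually_mono\<close>)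
  next
    case 2
    have "((\<lambda>t. (- t) powr r) has_real_derivative r * pflux r t) (at t)"
      using 2 DERIV_chain2[OF has_real_derivative_powr[of "- t" r] DERIV_minus[OF DERIV_ident]]
      by (simp add: pflux_neg)
    then show ?thesis
      by (rule DERIV_cong_ev[THEN iffD1, rotated -1])
        (use 2 eventually_nhds_in_open[of "{..<0}" t] in \<open>auto elim!: eventually_mono\<close>)
  next
    case 3
    \<comment> \<open>At 0 the absolute value of the difference quotient is |h|^(r-1), which is that
      of \<open>pflux r h\<close>, so continuity of \<open>pflux\<close> at 0 gives the
      derivative.\<close>
    have "((\<lambda>h. \<bar>pflux r h\<bar>) \<longlongrightarrow> \<bar>pflux r 0\<bar>) (at 0)"
      using isCont_pflux[OF assms, of 0] unfolding isCont_def by (intro tendsto_rabs)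
    then have "((\<lambda>h. \<bar>pflux r h\<bar>) \<longlongrightarrow> 0) (at 0)" by (simp add: pflux_def)
    moreover have "\<forall>\<^sub>F h in at 0. \<bar>\<bar>h\<bar> powr r / h\<bar> \<le> \<bar>pflux r h\<bar>"
      unfolding eventually_at_filter
      by (rule always_eventually) (auto simp: abs_pflux field_simps powr_minus_1_mult[of "\<bar>_\<bar>" r, symmetric])
    ultimately have "((\<lambda>h. \<bar>h\<bar> powr r / h) \<longlongrightarrow> 0) (at 0)"
      using Lim_null_comparison[of "\<lambda>h. \<bar>h\<bar> powr r / h" "\<lambda>h. \<bar>pflux r h\<bar>" "at 0"] by simp
    then show ?thesis using 3 by (simp add: has_field_derivative_iff pflux_def)
  qed
qed

text \<open>Strict convexity from the mean value theorem and the strictly monotone first derivative.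
  The second derivative is avoided because it is singular at 0 for r < 2.\<close>

lemma abs_powr_tangent_less:
  assumes "1 < r" "a \<noteq> b"
  shows "\<bar>a\<bar> powr r + r * pflux r a * (b - a) < \<bar>b\<bar> powr r"
proof (cases "a < b")
  case True
  obtain z where z: "a < z" "z < b" "\<bar>b\<bar> powr r - \<bar>a\<bar> powr r = (b - a) * (r * pflux r z)"
    using MVT2[OF True DERIV_abs_powr[OF assms(1)]] by blast
  then have "(b - a) * (r * pflux r a) < (b - a) * (r * pflux r z)"
    using pflux_strict_mono[OF assms(1)] assms by (intro mult_strict_left_mono) auto
  then show ?thesis using z(3) by (simp add: mult_ac)
next
  case False
  then have "b < a" using assms by simp
  from MVT2[OF this DERIV_abs_powr[OF assms(1)]]
  obtain z where z: "b < z" "z < a" "\<bar>a\<bar> powr r - \<bar>b\<bar> powr r = (a - b) * (r * pflux r z)"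
    by blast
  then have "(a - b) * (r * pflux r z) < (a - b) * (r * pflux r a)"
    using pflux_strict_mono[OF assms(1)] assms by (intro mult_strict_left_mono) auto
  then show ?thesis using z(3) by (simp add: algebra_simps)
qed

lemma abs_powr_tangent: "1 < r \<Longrightarrow> \<bar>a\<bar> powr r + r * pflux r a * (b - a) \<le> \<bar>b\<bar> powr r"
  using abs_powr_tangent_less[of r a b] by (cases "a = b") auto

text \<open>Integrated over the partial derivatives of two functions, this is the amount by which
  their mean energy exceeds the energy of their midpoint. Along a minimizing sequence that amount
  becomes small.\<close>

definition midpoint_gap :: "real \<Rightarrow> real \<Rightarrow> real \<Rightarrow> real" where
  "midpoint_gap r a b = (\<bar>a\<bar> powr r + \<bar>b\<bar> powr r) / 2 - \<bar>(a + b) / 2\<bar> powr r"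

lemma midpoint_gap_pos: "1 < r \<Longrightarrow> a \<noteq> b \<Longrightarrow> 0 < midpoint_gap r a b"
proof -
  assume r: "1 < r" and ab: "a \<noteq> b"
  define m where "m = (a + b) / 2"
  have m: "m \<noteq> a" "m \<noteq> b" using ab by (auto simp: m_def field_simps)
  have "r * pflux r m * (a - m) + r * pflux r m * (b - m) = 0"
    by (simp add: m_def field_simps)
  then show ?thesis
    using abs_powr_tangent_less[OF r m(1)] abs_powr_tangent_less[OF r m(2)]
    by (simp add: midpoint_gap_def m_def)
qed

lemma midpoint_gap_nonneg: "1 < r \<Longrightarrow> 0 \<le> midpoint_gap r a b"
  using midpoint_gap_pos[of r a b] by (cases "a = b") (auto simp: midpoint_gap_def)

lemma midpoint_gap_commute: "midpoint_gap r a b = midpoint_gap r b a"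
  by (simp add: midpoint_gap_def add.commute)

lemma midpoint_gap_scale: "midpoint_gap r (c * a) (c * b) = \<bar>c\<bar> powr r * midpoint_gap r a b"
proof -
  have "\<bar>(c * a + c * b) / 2\<bar> powr r = \<bar>c * ((a + b) / 2)\<bar> powr r"
    by (simp add: distrib_left)
  also have "\<dots> = \<bar>c\<bar> powr r * \<bar>(a + b) / 2\<bar> powr r"
    by (simp only: abs_mult powr_mult)
  finally show ?thesis
    by (simp only: midpoint_gap_def abs_mult powr_mult right_diff_distrib distrib_left times_divide_eq_right)
qed

text \<open>By homogeneity it suffices to take \<open>a = 1\<close> and \<open>\<bar>b\<bar> \<le> 1\<close>, where the gap is bounded
  below by compactness as long as \<open>b\<close> stays away from \<open>1\<close>.\<close>

lemma midpoint_gap_uniform: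
  assumes r: "1 < r" and e: "0 < e"
  obtains C where "0 \<le> C"
    "\<And>a b. \<bar>a - b\<bar> powr r \<le> e * (\<bar>a\<bar> powr r + \<bar>b\<bar> powr r) + C * midpoint_gap r a b"
proof -
  define S where "S = {s\<in>{-1..1}. e \<le> \<bar>1 - s\<bar> powr r}"
  have cS: "compact S"
  proof -
    have "closed {s::real. e \<le> \<bar>1 - s\<bar> powr r}"
      using r by (intro closed_Collect_le continuous_intros continuous_on_powr') auto
    then have "compact ({-1..1} \<inter> {s. e \<le> \<bar>1 - s\<bar> powr r})"
      by (intro compact_Int_closed) auto
    moreover have "S = {-1..1} \<inter> {s. e \<le> \<bar>1 - s\<bar> powr r}" by (auto simp: S_def)
    ultimately show ?thesis by simp
  qed
  have "\<exists>m>0. \<forall>s\<in>S. m \<le> midpoint_gap r 1 s"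
  proof (cases "S = {}")
    case False
    have "continuous_on S (midpoint_gap r 1)"
      unfolding midpoint_gap_def using r by (intro continuous_intros continuous_on_powr') auto
    from continuous_attains_inf[OF cS False this] obtain s0 where
      s0: "s0 \<in> S" "\<forall>s\<in>S. midpoint_gap r 1 s0 \<le> midpoint_gap r 1 s" by blast
    have "s0 \<noteq> 1" using s0 e r by (auto simp: S_def)
    then have "midpoint_gap r 1 s0 > 0" using midpoint_gap_pos[OF r] by metis
    with s0 show ?thesis by blast
  qed (auto intro: exI[of _ 1])
  then obtain m where m: "m > 0" "\<And>s. s \<in> S \<Longrightarrow> m \<le> midpoint_gap r 1 s" by blast
  define C where "C = 2 powr r / m"
  have unit: "\<bar>1 - s\<bar> powr r \<le> e + C * midpoint_gap r 1 s" if s: "\<bar>s\<bar> \<le> 1" for s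
  proof (cases "s \<in> S")
    case True
    have "\<bar>1 - s\<bar> powr r \<le> 2 powr r" using s r by (intro powr_mono2) auto
    also have "\<dots> \<le> C * midpoint_gap r 1 s"
      using m True by (simp add: C_def field_simps)
    finally show ?thesis using e by simp
  next
    case False
    then have "\<bar>1 - s\<bar> powr r < e" using s by (auto simp: S_def)
    moreover have "0 \<le> C * midpoint_gap r 1 s"
      using m midpoint_gap_nonneg[OF r] by (simp add: C_def)
    ultimately show ?thesis by simp
  qed
  have main: "\<bar>a - b\<bar> powr r \<le> e * (\<bar>a\<bar> powr r + \<bar>b\<bar> powr r) + C * midpoint_gap r a b"
    if ab: "\<bar>b\<bar> \<le> \<bar>a\<bar>" for a b
  proof (cases "a = 0")
    case False
    define s where "s = b / a"
    have b: "b = a * s" and s: "\<bar>s\<bar> \<le> 1" using False ab by (auto simp: s_def)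
    have "\<bar>a - b\<bar> powr r = \<bar>a\<bar> powr r * \<bar>1 - s\<bar> powr r"
      by (simp add: b flip: powr_mult abs_mult) (simp add: algebra_simps)
    also have "\<dots> \<le> \<bar>a\<bar> powr r * (e + C * midpoint_gap r 1 s)"
      using unit[OF s] by (intro mult_left_mono) auto
    also have "\<dots> = e * \<bar>a\<bar> powr r + C * midpoint_gap r a b"
      using midpoint_gap_scale[of r a 1 s] by (simp add: b algebra_simps)
    also have "\<dots> \<le> e * (\<bar>a\<bar> powr r + \<bar>b\<bar> powr r) + C * midpoint_gap r a b"
      using e by simp
    finally show ?thesis .
  qed (use ab r midpoint_gap_nonneg[OF r, of a b] m in \<open>simp add: C_def\<close>)
  have "0 \<le> C" using m by (simp add: C_def)
  moreover have "\<bar>a - b\<bar> powr r \<le> e * (\<bar>a\<bar> powr r + \<bar>b\<bar> powr r) + C * midpoint_gap r a b" for a b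
    using main[of b a] main[of a b] midpoint_gap_commute[of r a b]
    by (cases "\<bar>b\<bar> \<le> \<bar>a\<bar>") (auto simp: abs_minus_commute add.commute)
  ultimately show thesis using that by blast
qed

section \<open>Integrals of powers in place of Lebesgue norms\<close>

definition Lp :: "'a measure \<Rightarrow> real \<Rightarrow> ('a \<Rightarrow> real) \<Rightarrow> bool" where
  "Lp M r f \<longleftrightarrow> f \<in> borel_measurable M \<and> integrable M (\<lambda>x. \<bar>f x\<bar> powr r)"

text \<open>The r-th power of the norm, without the root. In place of the triangle inequality there
  is a bound with the factor \<open>2 powr r\<close>, which is harmless where only boundedness and
  convergence to 0 matter.\<close>

definition pint :: "'a measure \<Rightarrow> real \<Rightarrow> ('a \<Rightarrow> real) \<Rightarrow> real" where
  "pint M r f = (\<integral>x. \<bar>f x\<bar> powr r \<partial>M)"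

lemma Lp_measurable [measurable_dest]: "Lp M r f \<Longrightarrow> f \<in> borel_measurable M"
  and Lp_integrable: "Lp M r f \<Longrightarrow> integrable M (\<lambda>x. \<bar>f x\<bar> powr r)"
  by (auto simp: Lp_def)

lemma pint_nonneg: "0 \<le> pint M r f" by (simp add: pint_def)

lemma Lp_1_iff: "Lp M 1 f \<longleftrightarrow> integrable M f"
  unfolding Lp_def using integrable_norm_iff[of f M] borel_measurable_integrable[of M f] by auto

lemma pint_1: "pint M 1 f = (\<integral>x. \<bar>f x\<bar> \<partial>M)" by (simp add: pint_def)

lemma Lp_I_bound:
  assumes "f \<in> borel_measurable M" "integrable M g" "AE x in M. \<bar>f x\<bar> powr r \<le> g x"
  shows "Lp M r f" "pint M r f \<le> integral\<^sup>L M g"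
proof -
  show *: "Lp M r f"
    unfolding Lp_def
  proof
    show "integrable M (\<lambda>x. \<bar>f x\<bar> powr r)"
      by (rule Bochner_Integration.integrable_bound[OF assms(2)]) (use assms in \<open>auto elim!: eventually_mono\<close>)
  qed fact
  show "pint M r f \<le> integral\<^sup>L M g"
    unfolding pint_def by (intro integral_mono_AE Lp_integrable * assms)
qed

lemma Lp_cmult: "Lp M r f \<Longrightarrow> Lp M r (\<lambda>x. c * f x)"
  unfolding Lp_def by (auto simp: abs_mult powr_mult)

lemma pint_cmult: "pint M r (\<lambda>x. c * f x) = \<bar>c\<bar> powr r * pint M r f"
  by (simp add: pint_def abs_mult powr_mult)

lemma Lp_add:
  assumes "0 \<le> r" "Lp M r f" "Lp M r g"
  shows "Lp M r (\<lambda>x. f x + g x)"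
    and "pint M r (\<lambda>x. f x + g x) \<le> 2 powr r * (pint M r f + pint M r g)"
proof -
  note [measurable] = assms(2,3)[THEN Lp_measurable]
  have i: "integrable M (\<lambda>x. 2 powr r * (\<bar>f x\<bar> powr r + \<bar>g x\<bar> powr r))"
    using assms by (auto simp: Lp_def)
  have "AE x in M. \<bar>f x + g x\<bar> powr r \<le> 2 powr r * (\<bar>f x\<bar> powr r + \<bar>g x\<bar> powr r)"
    using abs_add_powr_le[OF assms(1)] by simp
  from Lp_I_bound[OF _ i this] show "Lp M r (\<lambda>x. f x + g x)"
    "pint M r (\<lambda>x. f x + g x) \<le> 2 powr r * (pint M r f + pint M r g)"
    using assms by (auto simp: Lp_def pint_def)
qed

lemma Lp_diff:
  assumes "0 \<le> r" "Lp M r f" "Lp M r g"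
  shows "Lp M r (\<lambda>x. f x - g x)"
    and "pint M r (\<lambda>x. f x - g x) \<le> 2 powr r * (pint M r f + pint M r g)"
  using Lp_add[OF assms(1,2) Lp_cmult[OF assms(3), of "-1"]] pint_cmult[of M r "-1" g] by auto

lemma pint_commute: "pint M r (\<lambda>x. f x - g x) = pint M r (\<lambda>x. g x - f x)"
  by (simp add: pint_def abs_minus_commute)

lemma pint_zero_AE:
  assumes "Lp M r f" "pint M r f \<le> 0"
  shows "AE x in M. f x = 0"
proof -
  have "pint M r f = 0" using assms pint_nonneg[of M r f] by simp
  then have "AE x in M. \<bar>f x\<bar> powr r = 0"
    using integral_nonneg_eq_0_iff_AE[OF Lp_integrable[OF assms(1)]] by (simp add: pint_def)
  then show ?thesis by (auto elim!: eventually_mono simp: powr_def split: if_splits)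
qed

lemma Lp_mono_exponent:
  assumes "finite_measure M" "Lp M s f" "0 \<le> r" "r \<le> s"
  shows "Lp M r f" "pint M r f \<le> measure M (space M) + pint M s f"
proof -
  interpret finite_measure M by fact
  have i: "integrable M (\<lambda>x. 1 + \<bar>f x\<bar> powr s)" using assms by (auto simp: Lp_def)
  have "\<bar>f x\<bar> powr r \<le> 1 + \<bar>f x\<bar> powr s" for x
  proof (cases "\<bar>f x\<bar> \<le> 1")
    case True
    have "\<bar>f x\<bar> powr r \<le> 1 powr r" using True assms by (intro powr_mono2) auto
    then show ?thesis by (simp add: add_increasing2)
  next
    case False
    then have "\<bar>f x\<bar> powr r \<le> \<bar>f x\<bar> powr s" using assms by (intro powr_mono) auto
    then show ?thesis by simp
  qed
  then have "AE x in M. \<bar>f x\<bar> powr r \<le> 1 + \<bar>f x\<bar> powr s" by simp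
  from Lp_I_bound[OF Lp_measurable[OF assms(2)] i this] show "Lp M r f"
    "pint M r f \<le> measure M (space M) + pint M s f"
    using assms by (auto simp: Lp_def pint_def)
qed

text \<open>A substitute for Hoelder's inequality on finite measure spaces.\<close>

lemma pint_1_le_eps:
  assumes "finite_measure M" "Lp M r f" "1 \<le> r" "0 < e"
  shows "integrable M f" "pint M 1 f \<le> e * measure M (space M) + e powr (1 - r) * pint M r f"
proof -
  interpret finite_measure M by fact
  have i: "integrable M (\<lambda>x. e + e powr (1 - r) * \<bar>f x\<bar> powr r)" using assms by (auto simp: Lp_def)
  have "\<bar>f x\<bar> powr 1 \<le> e + e powr (1 - r) * \<bar>f x\<bar> powr r" for x
    using young_eps[of 1 "\<bar>f x\<bar>" r e] assms by simp
  then have "AE x in M. \<bar>f x\<bar> powr 1 \<le> e + e powr (1 - r) * \<bar>f x\<bar> powr r" by simp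
  note * = Lp_I_bound[OF Lp_measurable[OF assms(2)] i this]
  show "integrable M f" using *(1) by (simp add: Lp_1_iff)
  show "pint M 1 f \<le> e * measure M (space M) + e powr (1 - r) * pint M r f"
    using *(2) assms by (simp add: Lp_def pint_def mult.commute)
qed

text \<open>The constant may depend on \<open>e\<close> in any way, because \<open>e\<close> is
  fixed before the limit of \<open>b\<close> is taken. This is how all estimates with a small
  parameter are turned into limits.\<close>

lemma tendsto_0_eps:
  fixes a :: "'b \<Rightarrow> real"
  assumes "\<And>e. 0 < e \<Longrightarrow> \<exists>C\<ge>0. \<forall>n. a n \<le> e + C * b n"
    and "(b \<longlongrightarrow> 0) F" "\<And>n. 0 \<le> a n"
  shows "(a \<longlongrightarrow> 0) F"
proof (rule order_tendstoI)
  fix e :: real assume "0 < e"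
  then obtain C where C: "C \<ge> 0" "\<And>n. a n \<le> e / 2 + C * b n"
    using assms(1)[of "e / 2"] by auto
  have "((\<lambda>n. C * b n) \<longlongrightarrow> C * 0) F" by (intro tendsto_intros assms)
  then have "\<forall>\<^sub>F n in F. C * b n < e / 2" using \<open>0 < e\<close> by (intro order_tendstoD) auto
  then show "\<forall>\<^sub>F n in F. a n < e"
  proof eventually_elim
    case (elim n)
    then show ?case using C(2)[of n] by linarith
  qed
next
  fix e :: real assume "e < 0"
  then have "e < a n" for n using assms(3)[of n] by linarith
  then show "\<forall>\<^sub>F n in F. e < a n" by simp
qed

lemma pint_1_tendsto_0:
  assumes M: "finite_measure M" and f: "\<And>n. Lp M r (f n)" and "1 \<le> r" and lim: "((\<lambda>n. pint M r (f n)) \<longlongrightarrow> 0) F"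
  shows "((\<lambda>n. pint M 1 (f n)) \<longlongrightarrow> 0) F"
proof (rule tendsto_0_eps[OF _ lim pint_nonneg])
  fix e :: real assume e: "0 < e"
  define m where "m = measure M (space M)"
  \<comment> \<open>Chosen so that d times the total mass is at most \<open>e\<close>; the summand 1
    keeps the quotient meaningful for a null measure.\<close>
  define d where "d = e / (m + 1)"
  have "0 \<le> m" by (simp add: m_def)
  then have d: "d > 0" "d * m \<le> e" using e by (auto simp: d_def field_simps)
  have "pint M 1 (f n) \<le> e + d powr (1 - r) * pint M r (f n)" for n
    using pint_1_le_eps(2)[OF M f assms(3) d(1), of n] d(2) by (simp add: m_def)
  then show "\<exists>C\<ge>0. \<forall>n. pint M 1 (f n) \<le> e + C * pint M r (f n)"
    by (intro exI[of _ "d powr (1 - r)"]) auto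
qed

lemma Lp_AE_subseq:
  assumes r: "0 < r" and f: "\<And>n. Lp M r (\<lambda>x. f n x - g x)"
    and lim: "(\<lambda>n. pint M r (\<lambda>x. f n x - g x)) \<longlonglongrightarrow> 0"
  obtains s :: "nat \<Rightarrow> nat" where "strict_mono s" "AE x in M. (\<lambda>n. f (s n) x) \<longlonglongrightarrow> g x"
proof -
  obtain s :: "nat \<Rightarrow> nat" where s: "strict_mono s" "AE x in M. (\<lambda>n. \<bar>f (s n) x - g x\<bar> powr r) \<longlonglongrightarrow> 0"
    using tendsto_L1_AE_subseq[of M "\<lambda>n x. \<bar>f n x - g x\<bar> powr r"] Lp_integrable[OF f] lim
    by (auto simp: pint_def)
  have "AE x in M. (\<lambda>n. f (s n) x) \<longlonglongrightarrow> g x"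
    using s(2)
  proof eventually_elim
    case (elim x)
    have "(\<lambda>n. (\<bar>f (s n) x - g x\<bar> powr r) powr (1 / r)) \<longlonglongrightarrow> 0 powr (1 / r)"
      using r by (intro tendsto_powr' elim) auto
    then have "(\<lambda>n. \<bar>f (s n) x - g x\<bar>) \<longlonglongrightarrow> 0" using r by (simp add: powr_powr)
    then show ?case using tendsto_rabs_zero_iff[of "\<lambda>n. f (s n) x - g x"] LIM_zero_iff by blast
  qed
  with s(1) that show thesis by blast
qed

lemma Lp_Fatou:
  assumes f: "\<And>n. Lp M r (f n)" and [measurable]: "g \<in> borel_measurable M"
    and lim: "AE x in M. (\<lambda>n. f n x) \<longlonglongrightarrow> g x" and r: "0 < r"
    and le: "\<forall>\<^sub>F n in sequentially. pint M r (f n) \<le> e"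
  shows "Lp M r g" "pint M r g \<le> e"
proof -
  note [measurable] = f[THEN Lp_measurable]
  have e: "0 \<le> e" using eventually_happens'[OF sequentially_bot le] pint_nonneg order.trans by blast
  have eq: "(\<integral>\<^sup>+x. ennreal (\<bar>f n x\<bar> powr r) \<partial>M) = ennreal (pint M r (f n))" for n
    unfolding pint_def by (rule nn_integral_eq_integral) (auto simp: Lp_integrable[OF f])
  have "(\<integral>\<^sup>+x. ennreal (\<bar>g x\<bar> powr r) \<partial>M) = (\<integral>\<^sup>+x. liminf (\<lambda>n. ennreal (\<bar>f n x\<bar> powr r)) \<partial>M)"
  proof (rule nn_integral_cong_AE, use lim in eventually_elim)
    case (elim x)
    have "(\<lambda>n. \<bar>f n x\<bar> powr r) \<longlonglongrightarrow> \<bar>g x\<bar> powr r"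
      using r by (intro tendsto_powr' tendsto_intros elim) auto
    then show ?case by (intro lim_imp_Liminf[symmetric]) auto
  qed
  also have "\<dots> \<le> liminf (\<lambda>n. \<integral>\<^sup>+x. ennreal (\<bar>f n x\<bar> powr r) \<partial>M)"
    by (rule nn_integral_liminf) measurable
  also have "\<dots> \<le> liminf (\<lambda>n. ennreal e)"
    by (rule Liminf_mono) (use le in \<open>auto elim!: eventually_mono simp: eq intro: ennreal_leI\<close>)
  also have "\<dots> = ennreal e" by (simp add: Liminf_const)
  finally have *: "(\<integral>\<^sup>+x. ennreal (\<bar>g x\<bar> powr r) \<partial>M) \<le> ennreal e" .
  have "integrable M (\<lambda>x. \<bar>g x\<bar> powr r)"
    by (rule integrableI_bounded) (use * in \<open>auto intro: le_less_trans\<close>)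
  then show "Lp M r g" by (simp add: Lp_def)
  then have "ennreal (pint M r g) \<le> ennreal e"
    using * nn_integral_eq_integral[OF Lp_integrable[of M r g]] by (simp add: pint_def)
  then show "pint M r g \<le> e" using e by simp
qed

lemma Cauchy_index_subseq:
  fixes P :: "nat \<Rightarrow> nat \<Rightarrow> nat \<Rightarrow> bool"
  assumes "\<And>k. \<exists>N. \<forall>m\<ge>N. \<forall>n\<ge>N. P k m n"
  obtains s :: "nat \<Rightarrow> nat" where "strict_mono s" "\<And>k. P k (s (Suc k)) (s k)"
proof -
  obtain N where N: "\<And>k m n. N k \<le> m \<Longrightarrow> N k \<le> n \<Longrightarrow> P k m n" using assms by metis
  \<comment> \<open>Summing the thresholds makes the indices dominate each \<open>N k\<close>; the
    successors make them strictly increasing.\<close>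
  define s where "s k = (\<Sum>j\<le>k. Suc (N j))" for k
  have s: "strict_mono s" by (rule strict_mono_Suc_iff[THEN iffD2]) (simp add: s_def)
  have "N k \<le> s k" for k
    using member_le_sum[of k "{..k}" "\<lambda>j. Suc (N j)"] by (simp add: s_def)
  then have "P k (s (Suc k)) (s k)" for k
    using strict_monoD[OF s, of k "Suc k"] by (intro N) (auto intro: le_trans less_imp_le)
  with s that show thesis by blast
qed

text \<open>The Riesz-Fischer theorem for every r > 0. There is no norm to sum, so the increments of
  a fast subsequence are bounded pointwise: a weighted series of their r-th powers has finite
  integral, which forces geometric decay almost everywhere.\<close>

lemma Lp_complete:
  assumes r: "0 < r" and f: "\<And>n. Lp M r (f n)"
    and Cauchy: "\<And>e. 0 < e \<Longrightarrow> \<exists>N. \<forall>m\<ge>N. \<forall>n\<ge>N. pint M r (\<lambda>x. f m x - f n x) < e"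
  obtains g where "Lp M r g" "(\<lambda>n. pint M r (\<lambda>x. f n x - g x)) \<longlonglongrightarrow> 0"
proof -
  note [measurable] = f[THEN Lp_measurable]
  \<comment> \<open>The rate (1/4)^k leaves the summable (1/2)^k after multiplication by the weight
    2^k.\<close>
  have "\<exists>N. \<forall>m\<ge>N. \<forall>n\<ge>N. pint M r (\<lambda>x. f m x - f n x) < (1/4)^k" for k :: nat
    by (rule Cauchy) simp
  from Cauchy_index_subseq[of "\<lambda>k m n. pint M r (\<lambda>x. f m x - f n x) < (1/4)^k", OF this]
  obtain s :: "nat \<Rightarrow> nat" where s: "strict_mono s"
    "\<And>k. pint M r (\<lambda>x. f (s (Suc k)) x - f (s k) x) < (1/4)^k"
    by blast
  define d where "d k x = f (s (Suc k)) x - f (s k) x" for k x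
  have [measurable]: "d k \<in> borel_measurable M" for k unfolding d_def by measurable
  have dL: "Lp M r (d k)" for k unfolding d_def using r by (intro Lp_diff f) auto
  have "(\<integral>\<^sup>+x. (\<Sum>k. ennreal (2 ^ k * \<bar>d k x\<bar> powr r)) \<partial>M) = (\<Sum>k. \<integral>\<^sup>+x. ennreal (2 ^ k * \<bar>d k x\<bar> powr r) \<partial>M)"
    by (rule nn_integral_suminf) measurable
  also have "\<dots> \<le> (\<Sum>k. ennreal ((1/2) ^ k))"
  proof (rule suminf_le)
    fix k
    have "(\<integral>\<^sup>+x. ennreal (2 ^ k * \<bar>d k x\<bar> powr r) \<partial>M) = ennreal (2 ^ k * pint M r (d k))"
      using nn_integral_eq_integral[of M "\<lambda>x. 2 ^ k * \<bar>d k x\<bar> powr r"] Lp_integrable[OF dL[of k]]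
      by (simp add: pint_def)
    also have "\<dots> \<le> ennreal (2 ^ k * (1/4) ^ k)"
      using s(2)[of k] by (intro ennreal_leI mult_left_mono) (auto simp: d_def[abs_def])
    also have "2 ^ k * (1/4::real) ^ k = (1/2) ^ k" by (simp flip: power_mult_distrib)
    finally show "(\<integral>\<^sup>+x. ennreal (2 ^ k * \<bar>d k x\<bar> powr r) \<partial>M) \<le> ennreal ((1/2) ^ k)" .
  qed auto
  also have "\<dots> = ennreal (\<Sum>k. (1/2) ^ k)"
    by (intro suminf_ennreal2) (auto intro: summable_geometric)
  also have "\<dots> < \<infinity>" by simp
  finally have "(\<integral>\<^sup>+x. (\<Sum>k. ennreal (2 ^ k * \<bar>d k x\<bar> powr r)) \<partial>M) \<noteq> \<infinity>"
    by (rule less_imp_neq)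
  then have "AE x in M. (\<Sum>k. ennreal (2 ^ k * \<bar>d k x\<bar> powr r)) \<noteq> \<infinity>"
    by (intro nn_integral_noteq_infinite) auto
  then have conv: "AE x in M. (\<lambda>k. f (s k) x) \<longlonglongrightarrow> lim (\<lambda>k. f (s k) x)"
  proof eventually_elim
    case (elim x)
    define T where "T = (\<Sum>k. ennreal (2 ^ k * \<bar>d k x\<bar> powr r))"
    have "T \<noteq> \<infinity>" unfolding T_def by (rule elim)
    then obtain S where S: "0 \<le> S" "T = ennreal S" by (cases T) auto
    \<comment> \<open>The ratio of the geometric majorant: the r-th root of |d_k|^r \<le> S
      (1/2)^k.\<close>
    define c where "c = (1/2::real) powr (1 / r)"
    have c: "0 < c" "c < 1" using r powr_less_mono2[of "1/r" "1/2" 1] by (auto simp: c_def)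
    have "\<bar>d k x\<bar> \<le> S powr (1 / r) * c ^ k" for k
    proof -
      have "(\<Sum>j\<in>{k}. ennreal (2 ^ j * \<bar>d j x\<bar> powr r)) \<le> T"
        unfolding T_def by (rule sum_le_suminf) (rule summableI, auto)
      then have "2 ^ k * \<bar>d k x\<bar> powr r \<le> S" using S by simp
      then have "\<bar>d k x\<bar> powr r \<le> S * (1/2) ^ k" by (simp add: field_simps)
      then have "(\<bar>d k x\<bar> powr r) powr (1 / r) \<le> (S * (1/2) ^ k) powr (1 / r)"
        using r by (intro powr_mono2) auto
      also have "\<dots> = S powr (1 / r) * ((1/2) powr real k) powr (1 / r)"
        by (simp add: powr_mult powr_realpow)
      also have "((1/2) powr real k) powr (1 / r) = c powr real k"
        by (simp only: c_def powr_powr mult.commute)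
      also have "c powr real k = c ^ k" using c by (simp add: powr_realpow)
      finally show ?thesis using r by (simp add: powr_powr)
    qed
    then have "norm (d k x) \<le> S powr (1 / r) * c ^ k" for k by (simp only: real_norm_def)
    then have "\<exists>N. \<forall>k\<ge>N. norm (d k x) \<le> S powr (1 / r) * c ^ k" by blast
    moreover have "summable (\<lambda>k. S powr (1 / r) * c ^ k)"
      by (rule summable_mult[OF summable_geometric]) (use c in simp)
    ultimately have "summable (\<lambda>k. d k x)" by (rule summable_comparison_test)
    then have "(\<lambda>n. \<Sum>k<n. d k x) \<longlonglongrightarrow> (\<Sum>k. d k x)" by (rule summable_LIMSEQ)
    moreover have "(\<Sum>k<n. d k x) = f (s n) x - f (s 0) x" for n
      unfolding d_def by (rule sum_lessThan_telescope)
    ultimately have "(\<lambda>n. f (s n) x - f (s 0) x + f (s 0) x) \<longlonglongrightarrow> (\<Sum>k. d k x) + f (s 0) x"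
      by (intro tendsto_add) auto
    then have "(\<lambda>n. f (s n) x) \<longlonglongrightarrow> (\<Sum>k. d k x) + f (s 0) x" by simp
    from limI[OF this] this show ?case by simp
  qed
  define g where "g x = lim (\<lambda>k. f (s k) x)" for x
  have [measurable]: "g \<in> borel_measurable M" unfolding g_def by measurable
  \<comment> \<open>Fatou is applied with \<open>n\<close> fixed and only the subsequence index
    tending to infinity, so the Cauchy bound carries over to the full sequence.\<close>
  have fat: "Lp M r (\<lambda>x. f n x - g x) \<and> pint M r (\<lambda>x. f n x - g x) \<le> e"
    if "\<forall>\<^sub>F k in sequentially. pint M r (\<lambda>x. f n x - f (s k) x) \<le> e" for n e
  proof -
    have "Lp M r (\<lambda>x. f n x - f (s k) x)" for k using r by (intro Lp_diff f) auto
    moreover have "AE x in M. (\<lambda>k. f n x - f (s k) x) \<longlonglongrightarrow> f n x - g x"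
      using conv unfolding g_def by eventually_elim (intro tendsto_intros)
    ultimately show ?thesis
      using Lp_Fatou[of M r "\<lambda>k x. f n x - f (s k) x" "\<lambda>x. f n x - g x" e, OF _ _ _ r that] by simp
  qed
  have small: "\<exists>N. \<forall>n\<ge>N. Lp M r (\<lambda>x. f n x - g x) \<and> pint M r (\<lambda>x. f n x - g x) \<le> e" if e: "0 < e" for e
  proof -
    obtain N where N: "\<And>m n. N \<le> m \<Longrightarrow> N \<le> n \<Longrightarrow> pint M r (\<lambda>x. f m x - f n x) < e" using Cauchy[OF e] by blast
    have "\<forall>\<^sub>F k in sequentially. pint M r (\<lambda>x. f n x - f (s k) x) \<le> e" if "n \<ge> N" for n
      using eventually_ge_at_top[of N]
    proof eventually_elim
      case (elim k)
      then have "N \<le> s k" using seq_suble[OF s(1), of k] by linarith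
      with N that show ?case by (simp add: less_imp_le)
    qed
    then show ?thesis using fat by blast
  qed
  have "Lp M r g"
  proof -
    obtain n where "Lp M r (\<lambda>x. f n x - g x)" using small[of 1] by auto
    from Lp_diff(1)[OF _ f[of n] this] r show ?thesis by simp
  qed
  moreover have "(\<lambda>n. pint M r (\<lambda>x. f n x - g x)) \<longlonglongrightarrow> 0"
  proof (rule LIMSEQ_I)
    fix e :: real assume "0 < e"
    with small[of "e/2"] obtain N where "\<And>n. N \<le> n \<Longrightarrow> pint M r (\<lambda>x. f n x - g x) \<le> e / 2" by auto
    then show "\<exists>no. \<forall>n\<ge>no. norm (pint M r (\<lambda>x. f n x - g x) - 0) < e"
      using \<open>0 < e\<close> by (force simp: pint_nonneg intro!: exI[of _ N])
  qed
  ultimately show thesis using that by blast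
qed

text \<open>Continuity of an integral functional whose integrand grows like a power.
  \<open>young_eps\<close> separates the bounded part, multiplied by \<open>e\<close>, from the
  distance of the two arguments. It serves both the energy and the lower order term.\<close>

lemma growth_diff_bound:
  assumes r: "1 \<le> r" and f: "Lp M r f" and g: "Lp M r g" and c: "Lp M r c"
    and i: "integrable M (\<lambda>x. \<Psi> x (f x))" "integrable M (\<lambda>x. \<Psi> x (g x))"
    and growth: "AE x in M. \<forall>a b. \<bar>\<Psi> x a - \<Psi> x b\<bar> \<le> K * (\<bar>a\<bar> + \<bar>b\<bar> + \<bar>c x\<bar>) powr (r - 1) * \<bar>a - b\<bar>"
    and K: "0 \<le> K" and e: "0 < e"
  shows "\<bar>(\<integral>x. \<Psi> x (f x) \<partial>M) - (\<integral>x. \<Psi> x (g x) \<partial>M)\<bar>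
    \<le> K * (e * (4 powr r * (pint M r f + pint M r g + pint M r c)) + e powr (1 - r) * pint M r (\<lambda>x. f x - g x))"
proof -
  have d: "Lp M r (\<lambda>x. f x - g x)" using r by (intro Lp_diff f g) auto
  have "\<bar>(\<integral>x. \<Psi> x (f x) \<partial>M) - (\<integral>x. \<Psi> x (g x) \<partial>M)\<bar> \<le> (\<integral>x. \<bar>\<Psi> x (f x) - \<Psi> x (g x)\<bar> \<partial>M)"
    using i integral_abs_bound[of M "\<lambda>x. \<Psi> x (f x) - \<Psi> x (g x)"] by simp
  also have "\<dots> \<le> (\<integral>x. K * (e * (4 powr r * (\<bar>f x\<bar> powr r + \<bar>g x\<bar> powr r + \<bar>c x\<bar> powr r)) + e powr (1 - r) * \<bar>f x - g x\<bar> powr r) \<partial>M)"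
  proof (rule integral_mono_AE)
    show "AE x in M. \<bar>\<Psi> x (f x) - \<Psi> x (g x)\<bar> \<le> K * (e * (4 powr r * (\<bar>f x\<bar> powr r + \<bar>g x\<bar> powr r + \<bar>c x\<bar> powr r)) + e powr (1 - r) * \<bar>f x - g x\<bar> powr r)"
      using growth
    proof eventually_elim
      case (elim x)
      define A where "A = \<bar>f x\<bar> + \<bar>g x\<bar> + \<bar>c x\<bar>"
      have "A powr r \<le> (3 * max \<bar>f x\<bar> (max \<bar>g x\<bar> \<bar>c x\<bar>)) powr r"
        using r by (intro powr_mono2) (auto simp: A_def max_def)
      also have "\<dots> \<le> 4 powr r * max \<bar>f x\<bar> (max \<bar>g x\<bar> \<bar>c x\<bar>) powr r"
        using r by (auto simp: powr_mult intro!: mult_right_mono powr_mono2)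
      also have "\<dots> \<le> 4 powr r * (\<bar>f x\<bar> powr r + \<bar>g x\<bar> powr r + \<bar>c x\<bar> powr r)"
        by (intro mult_left_mono) (auto simp: max_def)
      finally have A: "A powr r \<le> 4 powr r * (\<bar>f x\<bar> powr r + \<bar>g x\<bar> powr r + \<bar>c x\<bar> powr r)" .
      have "\<bar>\<Psi> x (f x) - \<Psi> x (g x)\<bar> \<le> K * (A powr (r - 1) * \<bar>f x - g x\<bar>)"
        using elim by (simp add: A_def mult.assoc)
      also have "\<dots> \<le> K * (e * A powr r + e powr (1 - r) * \<bar>f x - g x\<bar> powr r)"
        using K young_eps[of A "\<bar>f x - g x\<bar>" r e] r e by (intro mult_left_mono) (auto simp: A_def)
      also have "\<dots> \<le> K * (e * (4 powr r * (\<bar>f x\<bar> powr r + \<bar>g x\<bar> powr r + \<bar>c x\<bar> powr r)) + e powr (1 - r) * \<bar>f x - g x\<bar> powr r)"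
        using A e K by (intro mult_left_mono add_right_mono) auto
      finally show ?case .
    qed
  qed (use i f g c d in \<open>auto simp: Lp_def\<close>)
  also have "\<dots> = K * (e * (4 powr r * (pint M r f + pint M r g + pint M r c)) + e powr (1 - r) * pint M r (\<lambda>x. f x - g x))"
    using f g c d by (simp add: Lp_def pint_def)
  finally show ?thesis .
qed

lemma growth_tendsto:
  assumes r: "1 \<le> r" and f: "\<And>n. Lp M r (f n)" and g: "Lp M r g" and c: "Lp M r c"
    and i: "\<And>n. integrable M (\<lambda>x. \<Psi> x (f n x))" "integrable M (\<lambda>x. \<Psi> x (g x))"
    and growth: "AE x in M. \<forall>a b. \<bar>\<Psi> x a - \<Psi> x b\<bar> \<le> K * (\<bar>a\<bar> + \<bar>b\<bar> + \<bar>c x\<bar>) powr (r - 1) * \<bar>a - b\<bar>"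
    and K: "0 \<le> K" and lim: "((\<lambda>n. pint M r (\<lambda>x. f n x - g x)) \<longlongrightarrow> 0) F"
  shows "((\<lambda>n. \<integral>x. \<Psi> x (f n x) \<partial>M) \<longlongrightarrow> (\<integral>x. \<Psi> x (g x) \<partial>M)) F"
proof -
  \<comment> \<open>The part of the bound that does not tend to 0: the integrals of
    \<open>f n\<close> are controlled by those of \<open>g\<close> and of the difference, and
    \<open>B\<close> collects everything except the difference.\<close>
  define B where "B = K * (4 powr r * ((2 powr r + 1) * pint M r g + pint M r c))"
  have B: "0 \<le> B" using K by (auto simp: B_def pint_nonneg intro!: mult_nonneg_nonneg add_nonneg_nonneg)
  have "((\<lambda>n. \<bar>(\<integral>x. \<Psi> x (f n x) \<partial>M) - (\<integral>x. \<Psi> x (g x) \<partial>M)\<bar>) \<longlongrightarrow> 0) F"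
  proof (rule tendsto_0_eps[OF _ lim])
    fix e :: real assume e: "0 < e"
    define d where "d = e / (B + 1)"
    have d: "d > 0" "d * B \<le> e" using e B by (auto simp: d_def field_simps)
    have "\<bar>(\<integral>x. \<Psi> x (f n x) \<partial>M) - (\<integral>x. \<Psi> x (g x) \<partial>M)\<bar>
        \<le> e + (K * d * 4 powr r * 2 powr r + K * d powr (1 - r)) * pint M r (\<lambda>x. f n x - g x)" for n
    proof -
      have dn: "Lp M r (\<lambda>x. f n x - g x)" using r by (intro Lp_diff f g) auto
      have fn: "pint M r (f n) \<le> 2 powr r * (pint M r (\<lambda>x. f n x - g x) + pint M r g)"
        using Lp_add(2)[OF _ dn g] r by simp
      have "\<bar>(\<integral>x. \<Psi> x (f n x) \<partial>M) - (\<integral>x. \<Psi> x (g x) \<partial>M)\<bar>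
        \<le> K * (d * (4 powr r * (pint M r (f n) + pint M r g + pint M r c)) + d powr (1 - r) * pint M r (\<lambda>x. f n x - g x))"
        by (rule growth_diff_bound[OF r f g c i growth K d(1)])
      also have "\<dots> \<le> K * (d * (4 powr r * (2 powr r * (pint M r (\<lambda>x. f n x - g x) + pint M r g) + pint M r g + pint M r c)) + d powr (1 - r) * pint M r (\<lambda>x. f n x - g x))"
        using fn K d by (intro mult_left_mono add_right_mono) auto
      also have "\<dots> = d * B + (K * d * 4 powr r * 2 powr r + K * d powr (1 - r)) * pint M r (\<lambda>x. f n x - g x)"
        by (simp add: B_def algebra_simps)
      finally show ?thesis using d by linarith
    qed
    moreover have "0 \<le> K * d * 4 powr r * 2 powr r + K * d powr (1 - r)" using K d by simp
    ultimately show "\<exists>C\<ge>0. \<forall>n. \<bar>(\<integral>x. \<Psi> x (f n x) \<partial>M) - (\<integral>x. \<Psi> x (g x) \<partial>M)\<bar> \<le> e + C * pint M r (\<lambda>x. f n x - g x)"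
      by blast
  qed simp
  then show ?thesis using LIM_zero_cancel tendsto_rabs_zero_iff by blast
qed

text \<open>The tangent inequality at either end point. The additional \<open>c\<close> gives the
  bound the shape that \<open>growth_tendsto\<close> expects.\<close>

lemma abs_powr_growth:
  fixes a b c r :: real
  assumes "1 < r"
  shows "\<bar>\<bar>a\<bar> powr r - \<bar>b\<bar> powr r\<bar> \<le> r * (\<bar>a\<bar> + \<bar>b\<bar> + \<bar>c\<bar>) powr (r - 1) * \<bar>a - b\<bar>"
proof -
  have *: "\<bar>a\<bar> powr r - \<bar>b\<bar> powr r \<le> r * (\<bar>a\<bar> + \<bar>b\<bar> + \<bar>c\<bar>) powr (r - 1) * \<bar>a - b\<bar>" for a b
  proof -
    have "\<bar>a\<bar> powr r - \<bar>b\<bar> powr r \<le> r * pflux r a * (a - b)"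
      using abs_powr_tangent[OF assms, of a b] by (simp add: algebra_simps)
    also have "\<dots> \<le> r * \<bar>pflux r a\<bar> * \<bar>a - b\<bar>"
      using abs_ge_self[of "r * pflux r a * (a - b)"] assms by (simp add: abs_mult)
    also have "\<dots> \<le> r * (\<bar>a\<bar> + \<bar>b\<bar> + \<bar>c\<bar>) powr (r - 1) * \<bar>a - b\<bar>"
      unfolding abs_pflux using assms by (intro mult_right_mono mult_left_mono powr_mono2) auto
    finally show ?thesis .
  qed
  from *[of a b] *[of b a] show ?thesis by (simp add: abs_minus_commute abs_le_iff add.commute)
qed

lemma Lp_zero: "Lp M r (\<lambda>x. 0)" by (simp add: Lp_def)

lemma pint_tendsto:
  assumes r: "1 < r" and f: "\<And>n. Lp M r (f n)" and g: "Lp M r g"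
    and lim: "((\<lambda>n. pint M r (\<lambda>x. f n x - g x)) \<longlongrightarrow> 0) F"
  shows "((\<lambda>n. pint M r (f n)) \<longlongrightarrow> pint M r g) F"
  unfolding pint_def
  by (rule growth_tendsto[of r M f g "\<lambda>_. 0" "\<lambda>_ t. \<bar>t\<bar> powr r" r])
    (use r f g Lp_zero lim abs_powr_growth[OF r, of _ _ 0] in \<open>auto simp: Lp_integrable\<close>)

section \<open>Integral identities and estimates for test functions\<close>

lemma integrable_compact_support:
  fixes f :: "'a::euclidean_space \<Rightarrow> real"
  assumes "continuous_on UNIV f" "compact K" "\<And>x. x \<notin> K \<Longrightarrow> f x = 0"
  shows "integrable lborel f"
proof -
  have "(\<lambda>x. indicator K x *\<^sub>R f x) = f" using assms(3) by (auto simp: indicator_def fun_eq_iff)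
  then show ?thesis
    using borel_integrable_compact[OF assms(2) continuous_on_subset[OF assms(1)]] by simp
qed

lemma lborel_integral_translation:
  fixes f :: "'a::euclidean_space \<Rightarrow> real"
  assumes [measurable]: "f \<in> borel_measurable borel"
  shows "(\<integral>x. f (x + v) \<partial>lborel) = integral\<^sup>L lborel f"
proof -
  have "integral\<^sup>L lborel f = integral\<^sup>L (distr lborel borel ((+) v)) f"
    by (simp add: lborel_distr_plus)
  also have "\<dots> = (\<integral>x. f (v + x) \<partial>lborel)" by (rule integral_distr) auto
  finally show ?thesis by (simp add: add.commute)
qed

lemma lborel_integrable_translation:
  fixes f :: "'a::euclidean_space \<Rightarrow> real"
  assumes "integrable lborel f"
  shows "integrable lborel (\<lambda>x. f (x + v))"
proof -
  have "integrable (distr lborel borel ((+) v)) f" using assms by (simp add: lborel_distr_plus)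
  then have "integrable lborel (\<lambda>x. f (v + x))"
    using assms by (subst (asm) integrable_distr_eq) auto
  then show ?thesis by (simp add: add.commute)
qed

text \<open>By the mean value theorem each quotient is a value of \<open>g\<close>. It vanishes
  outside the ball enlarged by the length of \<open>v\<close>, since there both \<open>x\<close> and
  the shifted point have left \<open>K\<close>; hence a constant on that ball dominates all
  quotients.\<close>

lemma difference_quotient_dominated:
  fixes f g :: "'a::euclidean_space \<Rightarrow> real"
  assumes f0: "\<And>x. x \<notin> K \<Longrightarrow> f x = 0" and K: "compact K"
    and g: "continuous_on UNIV g" "\<And>x. x \<notin> K \<Longrightarrow> g x = 0"
    and D: "\<And>x. ((\<lambda>t. f (x + t *\<^sub>R v)) has_real_derivative g x) (at 0)"
  obtains w where "integrable lborel w"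
    "\<And>n x. \<bar>real (Suc n) * (f (x + (1 / real (Suc n)) *\<^sub>R v) - f x)\<bar> \<le> w x"
    "\<And>x. (\<lambda>n. real (Suc n) * (f (x + (1 / real (Suc n)) *\<^sub>R v) - f x)) \<longlonglongrightarrow> g x"
proof -
  have Dt: "((\<lambda>t. f (x + t *\<^sub>R v)) has_real_derivative g (x + s *\<^sub>R v)) (at s)" for x s
  proof -
    have "((\<lambda>t. f (x + s *\<^sub>R v + t *\<^sub>R v)) has_real_derivative g (x + s *\<^sub>R v)) (at 0)"
      by (rule D)
    then have "((\<lambda>t. f (x + (t + s) *\<^sub>R v)) has_real_derivative g (x + s *\<^sub>R v)) (at 0)"
      by (simp add: algebra_simps)
    then show ?thesis using DERIV_shift[of "\<lambda>t. f (x + t *\<^sub>R v)" _ 0 s] by simp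
  qed
  obtain R where R: "\<And>x. x \<in> K \<Longrightarrow> norm x \<le> R" using compact_imp_bounded[OF K] by (auto simp: bounded_iff)
  have "bounded (g ` K)"
    by (intro compact_imp_bounded compact_continuous_image K continuous_on_subset[OF g(1)]) auto
  then obtain B0 where B0: "\<And>x. x \<in> K \<Longrightarrow> \<bar>g x\<bar> \<le> B0" by (auto simp: bounded_iff)
  define B where "B = max B0 0"
  have B: "\<bar>g x\<bar> \<le> B" for x
    using B0[of x] g(2)[of x] by (cases "x \<in> K") (auto simp: B_def)
  define h where "h n x = real (Suc n) * (f (x + (1 / real (Suc n)) *\<^sub>R v) - f x)" for n x
  define w where "w x = B * indicator (cball 0 (R + norm v)) x" for x :: 'a
  have bound: "\<bar>h n x\<bar> \<le> w x" for n x
  proof (cases "x \<in> cball 0 (R + norm v)")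
    case True
    define t where "t = 1 / real (Suc n)"
    have t: "0 < t" by (simp add: t_def)
    obtain z where "f (x + t *\<^sub>R v) - f (x + 0 *\<^sub>R v) = (t - 0) * g (x + z *\<^sub>R v)"
      using MVT2[OF t Dt[of x]] by blast
    then have "h n x = g (x + z *\<^sub>R v)" by (simp add: h_def t_def)
    then show ?thesis using True B by (simp add: w_def)
  next
    case False
    have n: "norm x > R + norm v" using False by simp
    moreover have "norm ((1 / real (Suc n)) *\<^sub>R v) \<le> norm v"
      by (simp add: divide_le_eq mult_left_le_one_le mult_le_cancel_left1)
    ultimately have "norm (x + (1 / real (Suc n)) *\<^sub>R v) > R"
      using norm_triangle_ineq2[of x "- ((1 / real (Suc n)) *\<^sub>R v)"] by simp
    moreover have "norm x > R" using n norm_ge_zero[of v] by linarith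
    ultimately have "x \<notin> K" "x + (1 / real (Suc n)) *\<^sub>R v \<notin> K"
      using R[of x] R[of "x + (1 / real (Suc n)) *\<^sub>R v"] by auto
    then have "h n x = 0" using f0[of x] f0[of "x + (1 / real (Suc n)) *\<^sub>R v"] by (simp add: h_def)
    then show ?thesis by (simp add: w_def B_def)
  qed
  have lim: "(\<lambda>n. h n x) \<longlonglongrightarrow> g x" for x
  proof -
    have "((\<lambda>t. (f (x + t *\<^sub>R v) - f x) / t) \<longlongrightarrow> g x) (at 0)"
      using D[of x] by (simp add: has_field_derivative_iff)
    moreover have "filterlim (\<lambda>n. 1 / real (Suc n)) (at 0) sequentially"
      by (intro filterlim_atI) (use LIMSEQ_inverse_real_of_nat in \<open>auto simp: inverse_eq_divide\<close>)
    ultimately have "(\<lambda>n. (f (x + (1 / real (Suc n)) *\<^sub>R v) - f x) / (1 / real (Suc n))) \<longlonglongrightarrow> g x"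
      by (rule filterlim_compose)
    then show ?thesis by (simp add: h_def mult.commute)
  qed
  have "integrable lborel w"
    unfolding w_def by (intro integrable_mult_right integrable_real_indicator) (auto simp: less_top[symmetric] intro!: less_imp_neq[OF emeasure_bounded_finite[OF bounded_cball, unfolded infinity_ennreal_def]])
  with bound lim that[of w] show thesis by (simp add: h_def)
qed

text \<open>Each difference quotient integrates to 0 by translation invariance, and dominated
  convergence gives the derivative. Only a derivative along \<open>v\<close> is asked for, which
  suits products such as \<open>x $ i * \<bar>\<phi> x\<bar> powr r\<close>.\<close>

lemma integral_directional_derivative_0:
  fixes f g :: "'a::euclidean_space \<Rightarrow> real"
  assumes f: "continuous_on UNIV f" "\<And>x. x \<notin> K \<Longrightarrow> f x = 0" and K: "compact K"
    and g: "continuous_on UNIV g" "\<And>x. x \<notin> K \<Longrightarrow> g x = 0"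
    and D: "\<And>x. ((\<lambda>t. f (x + t *\<^sub>R v)) has_real_derivative g x) (at 0)"
  shows "integral\<^sup>L lborel g = 0"
proof -
  obtain w where w: "integrable lborel w"
    "\<And>n x. \<bar>real (Suc n) * (f (x + (1 / real (Suc n)) *\<^sub>R v) - f x)\<bar> \<le> w x"
    "\<And>x. (\<lambda>n. real (Suc n) * (f (x + (1 / real (Suc n)) *\<^sub>R v) - f x)) \<longlonglongrightarrow> g x"
    using difference_quotient_dominated[OF f(2) K g D] by blast
  have [measurable]: "f \<in> borel_measurable borel" "g \<in> borel_measurable borel"
    using f g by (auto intro: borel_measurable_continuous_onI)
  have fi: "integrable lborel f" by (rule integrable_compact_support[OF f(1) K f(2)])
  have "(\<lambda>n. \<integral>x. real (Suc n) * (f (x + (1 / real (Suc n)) *\<^sub>R v) - f x) \<partial>lborel) \<longlonglongrightarrow> integral\<^sup>L lborel g"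
    by (rule integral_dominated_convergence[where w = w]) (use w in auto)
  moreover have "(\<integral>x. real (Suc n) * (f (x + (1 / real (Suc n)) *\<^sub>R v) - f x) \<partial>lborel) = 0" for n
    using lborel_integrable_translation[OF fi] fi lborel_integral_translation[of f] by simp
  ultimately have "(\<lambda>n. 0) \<longlonglongrightarrow> integral\<^sup>L lborel g" by (simp only:)
  then show ?thesis by (simp add: LIMSEQ_const_iff)
qed

lemma DERIV_directional:
  fixes f :: "'a::real_normed_vector \<Rightarrow> real"
  assumes "f differentiable (at x)"
  shows "((\<lambda>t. f (x + t *\<^sub>R v)) has_real_derivative frechet_derivative f (at x) v) (at 0)"
proof -
  have "((\<lambda>t. x + t *\<^sub>R v) has_derivative (\<lambda>t. t *\<^sub>R v)) (at 0)"
    by (auto intro!: derivative_eq_intros)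
  moreover have "(f has_derivative frechet_derivative f (at x)) (at (x + 0 *\<^sub>R v))"
    using frechet_derivative_worksI[OF assms] by simp
  ultimately have "((\<lambda>t. f (x + t *\<^sub>R v)) has_derivative (\<lambda>t. frechet_derivative f (at x) (t *\<^sub>R v))) (at 0)"
    by (rule has_derivative_compose)
  moreover have "frechet_derivative f (at x) (t *\<^sub>R v) = frechet_derivative f (at x) v * t" for t
    using linear_frechet_derivative[OF assms] by (simp add: linear_cmul mult.commute)
  ultimately show ?thesis by (simp add: has_field_derivative_def)
qed

lemma DERIV_partial:
  "f differentiable (at x) \<Longrightarrow>
    ((\<lambda>t. f (x + t *\<^sub>R axis i 1)) has_real_derivative partial_deriv i f x) (at 0)"
  unfolding partial_deriv_def by (rule DERIV_directional)

lemma frechet_derivative_partial: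
  fixes f :: "real^'n::finite \<Rightarrow> real"
  assumes "f differentiable (at x)"
  shows "frechet_derivative f (at x) v = (\<Sum>i\<in>UNIV. v $ i * partial_deriv i f x)"
proof -
  have "frechet_derivative f (at x) v = frechet_derivative f (at x) (\<Sum>i\<in>UNIV. (v $ i) *\<^sub>R axis i 1)"
    using basis_expansion[of v] by (simp add: scalar_mult_eq_scaleR)
  also have "\<dots> = (\<Sum>i\<in>UNIV. v $ i * partial_deriv i f x)"
    using linear_frechet_derivative[OF assms] by (simp add: linear_sum linear_cmul partial_deriv_def)
  finally show ?thesis .
qed

section \<open>Integration by parts, the Poincare inequality and translations\<close>

lemma test_integrable:
  fixes g :: "real^'n::finite \<Rightarrow> real"
  assumes "\<phi> \<in> test_functions \<Omega>" "continuous_on UNIV g" "\<And>x. \<phi> x = 0 \<Longrightarrow> g x = 0"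
  shows "integrable lborel g"
proof -
  obtain K where "compact K" "\<And>x. x \<notin> K \<Longrightarrow> \<phi> x = 0" using test_functions_supportE[OF assms(1)] by metis
  then show ?thesis using assms integrable_compact_support[of g K] by auto
qed

lemma test_Lp_lborel:
  assumes "\<phi> \<in> test_functions \<Omega>" "0 < r"
  shows "Lp lborel r \<phi>"
proof -
  have c: "continuous_on UNIV \<phi>" by (rule test_functions_continuous[OF assms(1)])
  then have "continuous_on UNIV (\<lambda>x. \<bar>\<phi> x\<bar> powr r)"
    using assms(2) by (intro continuous_on_powr' continuous_intros) auto
  then show ?thesis
    using test_integrable[OF assms(1), of "\<lambda>x. \<bar>\<phi> x\<bar> powr r"] assms c borel_measurable_continuous_onI[OF c]
    by (auto simp: Lp_def)
qed

lemma test_integral_by_parts: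
  assumes \<phi>: "\<phi> \<in> test_functions \<Omega>" and \<psi>: "\<psi> \<in> test_functions \<Omega>"
  shows "(\<integral>x. \<phi> x * partial_deriv i \<psi> x \<partial>lborel) = - (\<integral>x. partial_deriv i \<phi> x * \<psi> x \<partial>lborel)"
proof -
  let ?f = "\<lambda>x. \<phi> x * \<psi> x"
  have f: "?f \<in> test_functions \<Omega>"
    by (rule test_functions_mult_smooth[OF test_functions_smooth[OF \<phi>] \<psi>])
  obtain K where K: "compact K" "\<And>x. x \<notin> K \<Longrightarrow> ?f x = 0" "\<And>x i. x \<notin> K \<Longrightarrow> partial_deriv i ?f x = 0"
    using test_functions_supportE[OF f] by metis
  have eq: "partial_deriv i ?f = (\<lambda>x. \<phi> x * partial_deriv i \<psi> x + partial_deriv i \<phi> x * \<psi> x)"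
    by (intro ext partial_deriv_mult test_functions_differentiable[OF \<phi>] test_functions_differentiable[OF \<psi>])
  note c = test_functions_continuous
  have "integral\<^sup>L lborel (partial_deriv i ?f) = 0"
    by (rule integral_directional_derivative_0[OF c[OF f] K(2,1) c[OF test_functions_partial[OF f]] K(3)
        DERIV_partial[OF test_functions_differentiable[OF f]]])
  moreover have "integrable lborel (\<lambda>x. \<phi> x * partial_deriv i \<psi> x)"
    by (rule test_integrable[OF \<phi>]) (auto intro!: continuous_intros c[OF \<phi>] c[OF test_functions_partial[OF \<psi>]])
  moreover have "integrable lborel (\<lambda>x. partial_deriv i \<phi> x * \<psi> x)"
    by (rule test_integrable[OF \<psi>]) (auto intro!: continuous_intros c[OF \<psi>] c[OF test_functions_partial[OF \<phi>]])
  ultimately show ?thesis by (simp add: eq)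
qed

text \<open>Integrate \<open>\<partial>\<^sub>i (x\<^sub>i \<bar>\<phi>\<bar>\<^sup>r)\<close>.\<close>

lemma test_poincare:
  fixes \<Omega> :: "(real^'n::finite) set"
  assumes "bounded \<Omega>" and r: "1 < r"
  obtains C where "0 < C"
    "\<And>\<phi> i. \<phi> \<in> test_functions \<Omega> \<Longrightarrow> pint lborel r \<phi> \<le> C * pint lborel r (partial_deriv i \<phi>)"
proof -
  obtain R where R: "R > 0" "\<And>x. x \<in> \<Omega> \<Longrightarrow> norm x \<le> R" using assms(1) by (auto simp: bounded_pos)
  \<comment> \<open>With this choice the term in |phi|^r on the right has coefficient 1/2 and is
    absorbed into the left-hand side.\<close>
  define e where "e = 1 / (2 * (R * r))"
  have e: "0 < e" "R * r * e = 1 / 2" using R r by (auto simp: e_def)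
  have main: "pint lborel r \<phi> \<le> (2 * (R * r) * e powr (1 - r)) * pint lborel r (partial_deriv i \<phi>)"
    if \<phi>: "\<phi> \<in> test_functions \<Omega>" for \<phi> i
  proof -
    obtain K where K: "compact K" "K \<subseteq> \<Omega>" "\<And>x. x \<notin> K \<Longrightarrow> \<phi> x = 0"
      "\<And>x i. x \<notin> K \<Longrightarrow> partial_deriv i \<phi> x = 0"
      using test_functions_supportE[OF \<phi>] by metis
    have c: "continuous_on UNIV \<phi>" "continuous_on UNIV (partial_deriv i \<phi>)"
      using test_functions_continuous \<phi> test_functions_partial by blast+
    have pf: "continuous_on UNIV (\<lambda>x. pflux r (\<phi> x))"
      by (rule continuous_on_compose2[of UNIV "pflux r", OF _ c(1)])
        (auto intro!: continuous_at_imp_continuous_on isCont_pflux r)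
    have ab: "continuous_on UNIV (\<lambda>x. \<bar>\<phi> x\<bar> powr r)"
      using r c by (intro continuous_on_powr' continuous_intros) auto
    let ?k = "\<lambda>x. x $ i * (r * pflux r (\<phi> x) * partial_deriv i \<phi> x)"
    have ck: "continuous_on UNIV ?k" by (intro continuous_intros pf c)
    have "integral\<^sup>L lborel (\<lambda>x. \<bar>\<phi> x\<bar> powr r + ?k x) = 0"
    proof (rule integral_directional_derivative_0[where f = "\<lambda>x. x $ i * \<bar>\<phi> x\<bar> powr r" and K = K and v = "axis i 1"])
      fix x
      have "((\<lambda>t. (x + t *\<^sub>R axis i 1) $ i) has_real_derivative 1) (at 0)"
        by (auto intro!: derivative_eq_intros simp: axis_def)
      moreover have "((\<lambda>t. \<bar>\<phi> (x + t *\<^sub>R axis i 1)\<bar> powr r) has_real_derivative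
          r * pflux r (\<phi> (x + 0 *\<^sub>R axis i 1)) * partial_deriv i \<phi> x) (at 0)"
        by (rule DERIV_chain2[OF DERIV_abs_powr[OF r] DERIV_partial[OF test_functions_differentiable[OF \<phi>]]])
      ultimately have "((\<lambda>t. (x + t *\<^sub>R axis i 1) $ i * \<bar>\<phi> (x + t *\<^sub>R axis i 1)\<bar> powr r) has_real_derivative
          1 * \<bar>\<phi> (x + 0 *\<^sub>R axis i 1)\<bar> powr r + r * pflux r (\<phi> (x + 0 *\<^sub>R axis i 1)) * partial_deriv i \<phi> x * (x + 0 *\<^sub>R axis i 1) $ i) (at 0)"
        by (rule DERIV_mult)
      then show "((\<lambda>t. (x + t *\<^sub>R axis i 1) $ i * \<bar>\<phi> (x + t *\<^sub>R axis i 1)\<bar> powr r) has_real_derivative \<bar>\<phi> x\<bar> powr r + ?k x) (at 0)"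
        by (simp add: mult_ac)
    qed (use K ck ab in \<open>auto intro!: continuous_intros\<close>)
    moreover have ia: "integrable lborel (\<lambda>x. \<bar>\<phi> x\<bar> powr r)"
      using test_integrable[OF \<phi> ab] by simp
    moreover have ik: "integrable lborel ?k"
      using test_integrable[OF test_functions_partial[OF \<phi>, of i] ck] by simp
    ultimately have "pint lborel r \<phi> = - integral\<^sup>L lborel ?k" by (simp add: pint_def)
    also have "\<dots> \<le> (\<integral>x. R * r * (e * \<bar>\<phi> x\<bar> powr r + e powr (1 - r) * \<bar>partial_deriv i \<phi> x\<bar> powr r) \<partial>lborel)"
      unfolding integral_minus[symmetric]
    proof (rule integral_mono)
      have Lg: "integrable lborel (\<lambda>x. \<bar>partial_deriv i \<phi> x\<bar> powr r)"
        using Lp_integrable[OF test_Lp_lborel[OF test_functions_partial[OF \<phi>], of r]] r by simp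
      show "integrable lborel (\<lambda>x. R * r * (e * \<bar>\<phi> x\<bar> powr r + e powr (1 - r) * \<bar>partial_deriv i \<phi> x\<bar> powr r))"
        using ia Lg by auto
      show "- ?k x \<le> R * r * (e * \<bar>\<phi> x\<bar> powr r + e powr (1 - r) * \<bar>partial_deriv i \<phi> x\<bar> powr r)" for x
      proof (cases "x \<in> K")
        case True
        have "- ?k x \<le> \<bar>x $ i\<bar> * (r * (\<bar>\<phi> x\<bar> powr (r - 1) * \<bar>partial_deriv i \<phi> x\<bar>))"
          using abs_ge_minus_self[of "?k x"] r by (simp add: abs_mult abs_pflux mult.assoc)
        also have "\<dots> \<le> R * (r * (\<bar>\<phi> x\<bar> powr (r - 1) * \<bar>partial_deriv i \<phi> x\<bar>))"
          using R(2)[of x] True K component_le_norm_cart[of x i] r by (intro mult_right_mono) auto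
        also have "\<dots> \<le> R * (r * (e * \<bar>\<phi> x\<bar> powr r + e powr (1 - r) * \<bar>partial_deriv i \<phi> x\<bar> powr r))"
          using young_eps[of "\<bar>\<phi> x\<bar>" "\<bar>partial_deriv i \<phi> x\<bar>" r e] r e R by (intro mult_left_mono) auto
        finally show ?thesis by (simp add: mult.assoc)
      next
        case False
        then show ?thesis using K(3,4)[of x] r R e by simp
      qed
    qed (use ik in simp)
    also have "\<dots> = R * r * e * pint lborel r \<phi> + R * r * e powr (1 - r) * pint lborel r (partial_deriv i \<phi>)"
      using ia Lp_integrable[OF test_Lp_lborel[OF test_functions_partial[OF \<phi>], of r]] r
      by (simp add: pint_def algebra_simps)
    finally show ?thesis by (simp add: e(2))
  qed
  have "0 < 2 * (R * r) * e powr (1 - r)" using R r e by simp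
  from that[OF this main] show thesis .
qed

text \<open>The translation modulus is subadditive, so it is controlled by its derivative at \<open>0\<close>.\<close>

lemma test_translation:
  fixes \<phi> :: "real^'n::finite \<Rightarrow> real"
  assumes \<phi>: "\<phi> \<in> test_functions \<Omega>"
  shows "(\<integral>x. \<bar>\<phi> (x + v) - \<phi> x\<bar> \<partial>lborel) \<le> (\<Sum>i\<in>UNIV. \<bar>v $ i\<bar> * pint lborel 1 (partial_deriv i \<phi>))"
proof -
  define h where "h w = (\<integral>x. \<bar>\<phi> (x + w) - \<phi> x\<bar> \<partial>lborel)" for w
  have c: "continuous_on UNIV \<phi>" by (rule test_functions_continuous[OF \<phi>])
  have [measurable]: "\<phi> \<in> borel_measurable borel" by (rule borel_measurable_continuous_onI[OF c])
  have i\<phi>: "integrable lborel \<phi>" using test_integrable[OF \<phi> c] by simp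
  note it = lborel_integrable_translation[OF i\<phi>]
  have sub: "h (a + b) \<le> h a + h b" for a b
  proof -
    have "h a = (\<integral>x. \<bar>\<phi> (x + b + a) - \<phi> (x + b)\<bar> \<partial>lborel)"
      unfolding h_def using lborel_integral_translation[of "\<lambda>x. \<bar>\<phi> (x + a) - \<phi> x\<bar>" b] by simp
    moreover have "h (a + b) \<le> (\<integral>x. \<bar>\<phi> (x + b + a) - \<phi> (x + b)\<bar> + \<bar>\<phi> (x + b) - \<phi> x\<bar> \<partial>lborel)"
      unfolding h_def
    proof (rule integral_mono)
      show "integrable lborel (\<lambda>x. \<bar>\<phi> (x + b + a) - \<phi> (x + b)\<bar> + \<bar>\<phi> (x + b) - \<phi> x\<bar>)"
        using it[of "b + a"] it[of b] i\<phi> by (auto simp: add.assoc)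
      show "integrable lborel (\<lambda>x. \<bar>\<phi> (x + (a + b)) - \<phi> x\<bar>)" using it[of "a + b"] i\<phi> by auto
      show "\<bar>\<phi> (x + (a + b)) - \<phi> x\<bar> \<le> \<bar>\<phi> (x + b + a) - \<phi> (x + b)\<bar> + \<bar>\<phi> (x + b) - \<phi> x\<bar>" for x
      proof -
        have eq: "x + (a + b) = x + b + a" by (simp add: add_ac)
        show ?thesis unfolding eq by linarith
      qed
    qed
    moreover have "integrable lborel (\<lambda>x. \<bar>\<phi> (x + b + a) - \<phi> (x + b)\<bar>)" "integrable lborel (\<lambda>x. \<bar>\<phi> (x + b) - \<phi> x\<bar>)"
      using it[of "b + a"] it[of b] i\<phi> by (auto simp: add.assoc)
    ultimately show ?thesis by (simp add: h_def)
  qed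
  have mult: "h (real n *\<^sub>R w) \<le> real n * h w" for n w
  proof (induction n)
    case (Suc n)
    have "h (real (Suc n) *\<^sub>R w) \<le> h (real n *\<^sub>R w) + h w"
      using sub[of "real n *\<^sub>R w" w] by (simp add: algebra_simps)
    with Suc show ?case by (simp add: algebra_simps)
  qed (simp add: h_def)
  define g where "g x = (\<Sum>i\<in>UNIV. v $ i * partial_deriv i \<phi> x)" for x
  obtain K where K: "compact K" "\<And>x. x \<notin> K \<Longrightarrow> \<phi> x = 0" "\<And>x i. x \<notin> K \<Longrightarrow> partial_deriv i \<phi> x = 0"
    using test_functions_supportE[OF \<phi>] by metis
  note cd = test_functions_continuous[OF test_functions_partial[OF \<phi>]]
  have g: "continuous_on UNIV g" "\<And>x. x \<notin> K \<Longrightarrow> g x = 0"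
    unfolding g_def using K by (auto intro!: continuous_intros cd)
  have "((\<lambda>t. \<phi> (x + t *\<^sub>R v)) has_real_derivative g x) (at 0)" for x
    unfolding g_def
    using DERIV_directional[OF test_functions_differentiable[OF \<phi>], of x v]
      frechet_derivative_partial[OF test_functions_differentiable[OF \<phi>], of x v] by simp
  from difference_quotient_dominated[OF K(2,1) g this]
  obtain w where w: "integrable lborel w"
    "\<And>n x. \<bar>real (Suc n) * (\<phi> (x + (1 / real (Suc n)) *\<^sub>R v) - \<phi> x)\<bar> \<le> w x"
    "\<And>x. (\<lambda>n. real (Suc n) * (\<phi> (x + (1 / real (Suc n)) *\<^sub>R v) - \<phi> x)) \<longlonglongrightarrow> g x" by blast
  have [measurable]: "g \<in> borel_measurable borel" by (rule borel_measurable_continuous_onI[OF g(1)])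
  have "(\<lambda>n. \<integral>x. \<bar>real (Suc n) * (\<phi> (x + (1 / real (Suc n)) *\<^sub>R v) - \<phi> x)\<bar> \<partial>lborel) \<longlonglongrightarrow> (\<integral>x. \<bar>g x\<bar> \<partial>lborel)"
    by (rule integral_dominated_convergence[where w = w]) (use w in \<open>auto intro!: tendsto_rabs\<close>)
  moreover have "h v \<le> (\<integral>x. \<bar>real (Suc n) * (\<phi> (x + (1 / real (Suc n)) *\<^sub>R v) - \<phi> x)\<bar> \<partial>lborel)" for n
    using mult[of "Suc n" "(1 / real (Suc n)) *\<^sub>R v"]
    by (simp add: h_def abs_mult del: of_nat_Suc)
  ultimately have "h v \<le> (\<integral>x. \<bar>g x\<bar> \<partial>lborel)" by (intro LIMSEQ_le_const) auto
  also have "\<dots> \<le> (\<integral>x. (\<Sum>i\<in>UNIV. \<bar>v $ i\<bar> * \<bar>partial_deriv i \<phi> x\<bar>) \<partial>lborel)"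
  proof (rule integral_mono)
    show "integrable lborel (\<lambda>x. \<bar>g x\<bar>)" using integrable_compact_support[OF g(1) K(1) g(2)] by auto
    show "integrable lborel (\<lambda>x. \<Sum>i\<in>UNIV. \<bar>v $ i\<bar> * \<bar>partial_deriv i \<phi> x\<bar>)"
      by (intro Bochner_Integration.integrable_sum integrable_mult_right integrable_abs
          test_integrable[OF test_functions_partial[OF \<phi>] cd])
    show "\<bar>g x\<bar> \<le> (\<Sum>i\<in>UNIV. \<bar>v $ i\<bar> * \<bar>partial_deriv i \<phi> x\<bar>)" for x
      unfolding g_def by (rule order.trans[OF sum_abs]) (simp add: abs_mult)
  qed
  also have "\<dots> = (\<Sum>i\<in>UNIV. \<bar>v $ i\<bar> * pint lborel 1 (partial_deriv i \<phi>))"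
    using test_integrable[OF test_functions_partial[OF \<phi>] cd]
    by (subst Bochner_Integration.integral_sum) (auto simp: pint_1)
  finally show ?thesis by (simp add: h_def)
qed

section \<open>A compactness theorem\<close>

text \<open>A kernel for averaging. Being Lipschitz with compact support is enough here; it is not
  normalised, so its integral appears as the factor \<open>I\<close> in the estimates.\<close>

definition tent :: "real \<Rightarrow> 'a::real_normed_vector \<Rightarrow> real" where
  "tent \<rho> z = max 0 (\<rho> - norm z)"

lemma tent_simps: "0 \<le> tent \<rho> z" "0 \<le> \<rho> \<Longrightarrow> tent \<rho> z \<le> \<rho>" "norm z \<ge> \<rho> \<Longrightarrow> tent \<rho> z = 0"
  by (auto simp: tent_def)

lemma tent_lipschitz: "\<bar>tent \<rho> z - tent \<rho> z'\<bar> \<le> norm (z - z')"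
  using norm_triangle_ineq3[of z z'] by (auto simp: tent_def max_def)

lemma continuous_on_tent: "continuous_on S (tent \<rho>)"
  unfolding tent_def by (intro continuous_intros)

lemma borel_measurable_tent [measurable]:
  "(tent \<rho> :: 'a::{real_normed_vector, second_countable_topology} \<Rightarrow> real) \<in> borel_measurable borel"
  by (rule borel_measurable_continuous_onI[OF continuous_on_tent])

lemma integrable_tent: "integrable lborel (tent \<rho> :: 'a::euclidean_space \<Rightarrow> real)"
  by (rule integrable_compact_support[OF continuous_on_tent compact_cball[of 0 \<rho>]])
    (simp add: tent_simps)

lemma integral_tent_pos:
  assumes "0 < \<rho>"
  shows "0 < integral\<^sup>L lborel (tent \<rho> :: 'a::euclidean_space \<Rightarrow> real)"
proof -
  have "0 < \<rho> / 2 * measure lborel (ball (0::'a) (\<rho> / 2))"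
    using assms content_ball_pos[of "\<rho>/2" "0::'a"] by simp
  also have "\<dots> = (\<integral>z. \<rho> / 2 * indicator (ball 0 (\<rho> / 2)) z \<partial>(lborel :: 'a measure))" by simp
  also have "\<dots> \<le> integral\<^sup>L lborel (tent \<rho> :: 'a \<Rightarrow> real)"
  proof (rule integral_mono[OF _ integrable_tent])
    show "integrable lborel (\<lambda>z::'a. \<rho> / 2 * indicator (ball 0 (\<rho> / 2)) z)"
      by (intro integrable_mult_right integrable_real_indicator)
        (auto simp: less_top[symmetric] intro!: less_imp_neq[OF emeasure_bounded_finite[OF bounded_ball, unfolded infinity_ennreal_def]])
    show "\<rho> / 2 * indicator (ball 0 (\<rho> / 2)) z \<le> tent \<rho> z" for z :: 'a
      by (auto simp: indicator_def tent_def max_def)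
  qed
  finally show ?thesis .
qed

definition tent_avg :: "real \<Rightarrow> ('a::euclidean_space \<Rightarrow> real) \<Rightarrow> 'a \<Rightarrow> real" where
  "tent_avg \<rho> \<phi> x = (\<integral>y. tent \<rho> (y - x) * \<phi> y \<partial>lborel)"

lemma integrable_tent_mult:
  fixes \<phi> :: "'a::euclidean_space \<Rightarrow> real"
  assumes "integrable lborel \<phi>"
  shows "integrable lborel (\<lambda>y. tent \<rho> (y - x) * \<phi> y)"
proof (rule Bochner_Integration.integrable_bound[of _ "\<lambda>y. \<bar>\<rho>\<bar> * \<phi> y"])
  note [measurable] = borel_measurable_integrable[OF assms]
  show "(\<lambda>y. tent \<rho> (y - x) * \<phi> y) \<in> borel_measurable lborel" by measurable
  have "\<bar>tent \<rho> z\<bar> \<le> \<bar>\<rho>\<bar>" for z :: 'a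
    by (auto simp: tent_def max_def intro: order.trans[OF _ abs_ge_self])
  then show "AE y in lborel. norm (tent \<rho> (y - x) * \<phi> y) \<le> norm (\<bar>\<rho>\<bar> * \<phi> y)"
    by (auto simp: abs_mult intro!: mult_right_mono)
qed (use assms in auto)

lemma tent_avg_translate:
  fixes \<phi> :: "'a::euclidean_space \<Rightarrow> real"
  assumes [measurable]: "\<phi> \<in> borel_measurable borel"
  shows "tent_avg \<rho> \<phi> x = (\<integral>z. tent \<rho> z * \<phi> (x + z) \<partial>lborel)"
  unfolding tent_avg_def
  using lborel_integral_translation[of "\<lambda>y. tent \<rho> (y - x) * \<phi> y" x] by (simp add: add.commute)

lemma tent_avg_lipschitz:
  fixes \<phi> :: "'a::euclidean_space \<Rightarrow> real"
  assumes i: "integrable lborel \<phi>"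
  shows "\<bar>tent_avg \<rho> \<phi> x - tent_avg \<rho> \<phi> x'\<bar> \<le> norm (x - x') * pint lborel 1 \<phi>"
proof -
  have "\<bar>tent_avg \<rho> \<phi> x - tent_avg \<rho> \<phi> x'\<bar>
      = \<bar>\<integral>y. tent \<rho> (y - x) * \<phi> y - tent \<rho> (y - x') * \<phi> y \<partial>lborel\<bar>"
    unfolding tent_avg_def by (simp add: integrable_tent_mult[OF i])
  also have "\<dots> \<le> (\<integral>y. \<bar>tent \<rho> (y - x) * \<phi> y - tent \<rho> (y - x') * \<phi> y\<bar> \<partial>lborel)"
    by (rule integral_abs_bound)
  also have "\<dots> \<le> (\<integral>y. norm (x - x') * \<bar>\<phi> y\<bar> \<partial>lborel)"
  proof (rule integral_mono)
    fix y
    have "\<bar>tent \<rho> (y - x) * \<phi> y - tent \<rho> (y - x') * \<phi> y\<bar> = \<bar>tent \<rho> (y - x) - tent \<rho> (y - x')\<bar> * \<bar>\<phi> y\<bar>"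
      by (simp add: abs_mult left_diff_distrib flip: abs_mult)
    also have "\<dots> \<le> norm (x - x') * \<bar>\<phi> y\<bar>"
      using tent_lipschitz[of \<rho> "y - x" "y - x'"] by (intro mult_right_mono) (auto simp: norm_minus_commute)
    finally show "\<bar>tent \<rho> (y - x) * \<phi> y - tent \<rho> (y - x') * \<phi> y\<bar> \<le> norm (x - x') * \<bar>\<phi> y\<bar>" .
  qed (use i integrable_tent_mult[OF i] in auto)
  finally show ?thesis by (simp add: pint_1)
qed

lemma tent_avg_bound:
  fixes \<phi> :: "'a::euclidean_space \<Rightarrow> real"
  assumes i: "integrable lborel \<phi>" and "0 \<le> \<rho>"
  shows "\<bar>tent_avg \<rho> \<phi> x\<bar> \<le> \<rho> * pint lborel 1 \<phi>"
proof -
  have "\<bar>tent_avg \<rho> \<phi> x\<bar> \<le> (\<integral>y. \<bar>tent \<rho> (y - x) * \<phi> y\<bar> \<partial>lborel)"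
    unfolding tent_avg_def by (rule integral_abs_bound)
  also have "\<dots> \<le> (\<integral>y. \<rho> * \<bar>\<phi> y\<bar> \<partial>lborel)"
  proof (rule integral_mono)
    show "integrable lborel (\<lambda>y. \<bar>tent \<rho> (y - x) * \<phi> y\<bar>)" by (rule integrable_abs[OF integrable_tent_mult[OF i]])
    show "\<bar>tent \<rho> (y - x) * \<phi> y\<bar> \<le> \<rho> * \<bar>\<phi> y\<bar>" for y
      using tent_simps(1,2)[of \<rho> "y - x"] assms(2) by (simp add: abs_mult mult_right_mono)
  qed (use i in auto)
  finally show ?thesis by (simp add: pint_1)
qed

lemma continuous_on_tent_avg:
  fixes \<phi> :: "'a::euclidean_space \<Rightarrow> real"
  assumes i: "integrable lborel \<phi>"
  shows "continuous_on S (tent_avg \<rho> \<phi>)"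
proof -
  have "(pint lborel 1 \<phi>)-lipschitz_on S (tent_avg \<rho> \<phi>)"
    using tent_avg_lipschitz[OF i] by (intro lipschitz_onI) (auto simp: dist_norm mult.commute pint_nonneg)
  then show ?thesis by (rule lipschitz_on_continuous_on)
qed

text \<open>The error is an average of translation differences over |z| < \<rho>, and each of these
  costs at most \<rho> times the integrals of the partial derivatives. Nonnegative integrals allow
  the order of integration to be exchanged without integrability on the product.\<close>

lemma tent_avg_error:
  fixes \<phi> :: "real^'n::finite \<Rightarrow> real"
  assumes \<phi>: "\<phi> \<in> test_functions \<Omega>" and \<rho>: "0 < \<rho>"
  defines "I \<equiv> integral\<^sup>L lborel (tent \<rho> :: real^'n \<Rightarrow> real)"
  shows "(\<integral>\<^sup>+x. ennreal \<bar>I * \<phi> x - tent_avg \<rho> \<phi> x\<bar> \<partial>lborel)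
    \<le> ennreal (I * (\<rho> * (\<Sum>i\<in>UNIV. pint lborel 1 (partial_deriv i \<phi>))))"
proof -
  define S where "S = (\<Sum>i\<in>UNIV. pint lborel 1 (partial_deriv i \<phi>))"
  have S: "0 \<le> S" unfolding S_def by (intro sum_nonneg) (simp add: pint_nonneg)
  have c: "continuous_on UNIV \<phi>" by (rule test_functions_continuous[OF \<phi>])
  have [measurable]: "\<phi> \<in> borel_measurable borel" by (rule borel_measurable_continuous_onI[OF c])
  have i\<phi>: "integrable lborel \<phi>" using test_integrable[OF \<phi> c] by simp
  have "\<bar>I * \<phi> x - tent_avg \<rho> \<phi> x\<bar> \<le> (\<integral>z. tent \<rho> z * \<bar>\<phi> (x + z) - \<phi> x\<bar> \<partial>lborel)
      \<and> integrable lborel (\<lambda>z. tent \<rho> z * \<bar>\<phi> (x + z) - \<phi> x\<bar>)" for x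
  proof -
    have i1: "integrable lborel (\<lambda>z. tent \<rho> z * \<phi> (x + z))"
      using integrable_tent_mult[of "\<lambda>z. \<phi> (z + x)" \<rho> 0] lborel_integrable_translation[OF i\<phi>, of x]
      by (simp add: add.commute)
    have i2: "integrable lborel (\<lambda>z::real^'n. tent \<rho> z * \<phi> x)" using integrable_tent[where 'a = "real^'n", of \<rho>] by simp
    have d: "integrable lborel (\<lambda>z. tent \<rho> z * \<phi> (x + z) - tent \<rho> z * \<phi> x)" using i1 i2 by simp
    have eq: "\<bar>tent \<rho> z * \<phi> (x + z) - tent \<rho> z * \<phi> x\<bar> = tent \<rho> z * \<bar>\<phi> (x + z) - \<phi> x\<bar>" for z
      using tent_simps(1)[of \<rho> z] by (simp add: abs_mult flip: right_diff_distrib)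
    have "I * \<phi> x - tent_avg \<rho> \<phi> x = - (\<integral>z. tent \<rho> z * \<phi> (x + z) - tent \<rho> z * \<phi> x \<partial>lborel)"
      using i1 i2 by (simp add: I_def tent_avg_translate)
    then have "\<bar>I * \<phi> x - tent_avg \<rho> \<phi> x\<bar> \<le> (\<integral>z. \<bar>tent \<rho> z * \<phi> (x + z) - tent \<rho> z * \<phi> x\<bar> \<partial>lborel)"
      using integral_abs_bound[of lborel "\<lambda>z. tent \<rho> z * \<phi> (x + z) - tent \<rho> z * \<phi> x"] by (simp only: abs_minus_cancel)
    then show ?thesis using integrable_abs[OF d] by (simp only: eq)
  qed
  note pt = this
  have "(\<integral>\<^sup>+x. ennreal \<bar>I * \<phi> x - tent_avg \<rho> \<phi> x\<bar> \<partial>lborel)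
      \<le> (\<integral>\<^sup>+x. (\<integral>\<^sup>+z. ennreal (tent \<rho> z * \<bar>\<phi> (x + z) - \<phi> x\<bar>) \<partial>lborel) \<partial>lborel)"
  proof (rule nn_integral_mono)
    show "ennreal \<bar>I * \<phi> x - tent_avg \<rho> \<phi> x\<bar> \<le> (\<integral>\<^sup>+z. ennreal (tent \<rho> z * \<bar>\<phi> (x + z) - \<phi> x\<bar>) \<partial>lborel)" for x
      using pt[of x] by (subst nn_integral_eq_integral) (auto intro!: ennreal_leI simp: tent_simps(1))
  qed
  also have "\<dots> = (\<integral>\<^sup>+z. (\<integral>\<^sup>+x. ennreal (tent \<rho> z * \<bar>\<phi> (x + z) - \<phi> x\<bar>) \<partial>lborel) \<partial>lborel)"
    by (rule lborel_pair.Fubini') simp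
  also have "\<dots> \<le> (\<integral>\<^sup>+z. ennreal (tent \<rho> z * (\<rho> * S)) \<partial>(lborel :: (real^'n) measure))"
  proof (rule nn_integral_mono)
    fix z :: "real^'n"
    have it: "integrable lborel (\<lambda>x. \<bar>\<phi> (x + z) - \<phi> x\<bar>)"
      using lborel_integrable_translation[OF i\<phi>, of z] i\<phi> by auto
    have "(\<integral>\<^sup>+x. ennreal (tent \<rho> z * \<bar>\<phi> (x + z) - \<phi> x\<bar>) \<partial>lborel)
        = ennreal (tent \<rho> z * (\<integral>x. \<bar>\<phi> (x + z) - \<phi> x\<bar> \<partial>lborel))"
      using it tent_simps(1)[of \<rho> z] by (subst nn_integral_eq_integral) auto
    also have "\<dots> \<le> ennreal (tent \<rho> z * (\<rho> * S))"
    proof (cases "norm z \<ge> \<rho>")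
      case False
      have "(\<integral>x. \<bar>\<phi> (x + z) - \<phi> x\<bar> \<partial>lborel) \<le> (\<Sum>i\<in>UNIV. \<bar>z $ i\<bar> * pint lborel 1 (partial_deriv i \<phi>))"
        by (rule test_translation[OF \<phi>])
      also have "\<dots> \<le> \<rho> * S"
        unfolding S_def sum_distrib_left
      proof (intro sum_mono mult_right_mono pint_nonneg)
        show "\<bar>z $ i\<bar> \<le> \<rho>" for i using False component_le_norm_cart[of z i] by linarith
      qed
      finally show ?thesis by (intro ennreal_leI mult_left_mono tent_simps)
    qed (simp add: tent_simps)
    finally show "(\<integral>\<^sup>+x. ennreal (tent \<rho> z * \<bar>\<phi> (x + z) - \<phi> x\<bar>) \<partial>lborel) \<le> ennreal (tent \<rho> z * (\<rho> * S))" .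
  qed
  also have "\<dots> = ennreal (I * (\<rho> * S))"
    unfolding I_def using S \<rho> integrable_tent[where 'a = "real^'n", of \<rho>]
    by (subst nn_integral_eq_integral) (auto simp: tent_simps(1))
  finally show ?thesis by (simp add: S_def)
qed

lemma tent_avg_L1_close:
  fixes \<phi> \<psi> :: "real^'n::finite \<Rightarrow> real"
  assumes \<phi>: "\<phi> \<in> test_functions \<Omega>" and \<psi>: "\<psi> \<in> test_functions \<Omega>" and \<rho>: "0 < \<rho>"
    and A: "integrable lborel (\<lambda>x. \<bar>tent_avg \<rho> \<phi> x - tent_avg \<rho> \<psi> x\<bar>)"
  defines "I \<equiv> integral\<^sup>L lborel (tent \<rho> :: real^'n \<Rightarrow> real)"
  shows "pint lborel 1 (\<lambda>x. \<phi> x - \<psi> x)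
    \<le> \<rho> * (\<Sum>i\<in>UNIV. pint lborel 1 (partial_deriv i \<phi>)) + \<rho> * (\<Sum>i\<in>UNIV. pint lborel 1 (partial_deriv i \<psi>))
      + (\<integral>x. \<bar>tent_avg \<rho> \<phi> x - tent_avg \<rho> \<psi> x\<bar> \<partial>lborel) / I"
proof -
  define a where "a \<phi> = \<rho> * (\<Sum>i\<in>UNIV. pint lborel 1 (partial_deriv i \<phi>))" for \<phi> :: "real^'n \<Rightarrow> real"
  have a: "0 \<le> a \<phi>" for \<phi> using \<rho> by (auto simp: a_def intro!: mult_nonneg_nonneg sum_nonneg pint_nonneg)
  have I: "0 < I" unfolding I_def by (rule integral_tent_pos[OF \<rho>])
  note c = test_functions_continuous[OF \<phi>] test_functions_continuous[OF \<psi>]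
  have i: "integrable lborel \<phi>" "integrable lborel \<psi>"
    using test_integrable[OF \<phi> c(1)] test_integrable[OF \<psi> c(2)] by auto
  have [measurable]: "\<phi> \<in> borel_measurable borel" "\<psi> \<in> borel_measurable borel"
    "tent_avg \<rho> \<phi> \<in> borel_measurable borel" "tent_avg \<rho> \<psi> \<in> borel_measurable borel"
    by (auto intro!: borel_measurable_continuous_onI c continuous_on_tent_avg i)
  let ?D = "\<integral>x. \<bar>tent_avg \<rho> \<phi> x - tent_avg \<rho> \<psi> x\<bar> \<partial>lborel"
  have "ennreal (I * pint lborel 1 (\<lambda>x. \<phi> x - \<psi> x)) = (\<integral>\<^sup>+x. ennreal (I * \<bar>\<phi> x - \<psi> x\<bar>) \<partial>lborel)"
    using i I by (subst nn_integral_eq_integral) (auto simp: pint_1)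
  also have "\<dots> \<le> (\<integral>\<^sup>+x. (ennreal \<bar>I * \<phi> x - tent_avg \<rho> \<phi> x\<bar> + ennreal \<bar>I * \<psi> x - tent_avg \<rho> \<psi> x\<bar>)
      + ennreal \<bar>tent_avg \<rho> \<phi> x - tent_avg \<rho> \<psi> x\<bar> \<partial>lborel)"
  proof (rule nn_integral_mono)
    fix x
    have "I * \<bar>\<phi> x - \<psi> x\<bar> = \<bar>I * \<phi> x - I * \<psi> x\<bar>"
      using I by (simp add: abs_mult flip: right_diff_distrib)
    also have "\<dots> \<le> (\<bar>I * \<phi> x - tent_avg \<rho> \<phi> x\<bar> + \<bar>I * \<psi> x - tent_avg \<rho> \<psi> x\<bar>) + \<bar>tent_avg \<rho> \<phi> x - tent_avg \<rho> \<psi> x\<bar>"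
      by linarith
    finally show "ennreal (I * \<bar>\<phi> x - \<psi> x\<bar>) \<le> (ennreal \<bar>I * \<phi> x - tent_avg \<rho> \<phi> x\<bar> + ennreal \<bar>I * \<psi> x - tent_avg \<rho> \<psi> x\<bar>)
      + ennreal \<bar>tent_avg \<rho> \<phi> x - tent_avg \<rho> \<psi> x\<bar>"
      by (simp add: ennreal_leI flip: ennreal_plus)
  qed
  also have "\<dots> = (\<integral>\<^sup>+x. ennreal \<bar>I * \<phi> x - tent_avg \<rho> \<phi> x\<bar> \<partial>lborel) + (\<integral>\<^sup>+x. ennreal \<bar>I * \<psi> x - tent_avg \<rho> \<psi> x\<bar> \<partial>lborel)
      + (\<integral>\<^sup>+x. ennreal \<bar>tent_avg \<rho> \<phi> x - tent_avg \<rho> \<psi> x\<bar> \<partial>lborel)"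
    by (simp add: nn_integral_add)
  also have "\<dots> \<le> ennreal (I * a \<phi>) + ennreal (I * a \<psi>) + ennreal ?D"
    using tent_avg_error[OF \<phi> \<rho>] tent_avg_error[OF \<psi> \<rho>] nn_integral_eq_integral[OF A]
    unfolding a_def I_def by (intro add_mono) auto
  also have "\<dots> = ennreal (I * a \<phi> + I * a \<psi> + ?D)"
    using I a by (simp add: ennreal_plus)
  finally have "I * pint lborel 1 (\<lambda>x. \<phi> x - \<psi> x) \<le> I * a \<phi> + I * a \<psi> + ?D"
    using I a by (subst (asm) ennreal_le_iff) (auto intro!: add_nonneg_nonneg)
  then show ?thesis using I by (simp add: a_def[symmetric] field_simps)
qed

text \<open>Along a subsequence all averages at scales \<open>1 / m\<close> converge pointwise, and the
  original functions differ from their averages by \<open>O(1 / m)\<close> uniformly.\<close>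

lemma test_rellich:
  fixes \<Omega> :: "(real^'n::finite) set"
  assumes \<Omega>: "bounded \<Omega>" and \<phi>: "\<And>n. \<phi> n \<in> test_functions \<Omega>"
    and M: "\<And>n. pint lborel 1 (\<phi> n) \<le> M" "\<And>n i. pint lborel 1 (partial_deriv i (\<phi> n)) \<le> M"
  obtains s :: "nat \<Rightarrow> nat" where "strict_mono s"
    "\<And>e. 0 < e \<Longrightarrow> \<exists>N. \<forall>m\<ge>N. \<forall>n\<ge>N. pint lborel 1 (\<lambda>x. \<phi> (s m) x - \<phi> (s n) x) < e"
proof -
  obtain R where R: "\<And>x. x \<in> \<Omega> \<Longrightarrow> norm x \<le> R" using \<Omega> by (auto simp: bounded_iff)
  have M0: "0 \<le> M" using M(1)[of 0] pint_nonneg[of lborel 1 "\<phi> 0"] by linarith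
  have i\<phi>: "integrable lborel (\<phi> n)" for n
    using test_integrable[OF \<phi> test_functions_continuous[OF \<phi>]] by simp
  define \<rho> where "\<rho> m = 1 / real (Suc m)" for m
  have \<rho>: "0 < \<rho> m" "\<rho> m \<le> 1" for m by (auto simp: \<rho>_def)
  obtain D :: "(real^'n) set" where D: "countable D" "\<And>X. open X \<Longrightarrow> X \<noteq> {} \<Longrightarrow> \<exists>d\<in>D. d \<in> X"
    by (rule countable_dense_setE) blast
  \<comment> \<open>Scale and point together form one countable index, so a single diagonal
    subsequence serves all scales.\<close>
  define f where "f n = (\<lambda>(m, x). tent_avg (\<rho> m) (\<phi> n) x)" for n
  have bound: "\<bar>tent_avg (\<rho> m) (\<phi> n) x\<bar> \<le> M" for m n x
  proof -
    have "\<bar>tent_avg (\<rho> m) (\<phi> n) x\<bar> \<le> \<rho> m * pint lborel 1 (\<phi> n)"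
      using \<rho>[of m] by (intro tent_avg_bound i\<phi>) simp
    also have "\<dots> \<le> 1 * M" using \<rho>[of m] M0 M by (intro mult_mono pint_nonneg) auto
    finally show ?thesis by simp
  qed
  have "countable ((UNIV :: nat set) \<times> D)" using D by simp
  then obtain s where s: "strict_mono (s::nat \<Rightarrow> nat)" "\<And>y. y \<in> UNIV \<times> D \<Longrightarrow> \<exists>l. (\<lambda>n. f (s n) y) \<longlonglongrightarrow> l"
    by (rule function_convergent_subsequence[of "UNIV \<times> D" f M]) (auto simp: f_def bound)
  have conv: "convergent (\<lambda>n. tent_avg (\<rho> m) (\<phi> (s n)) x)" for m x
  proof -
    have "Cauchy (\<lambda>n. tent_avg (\<rho> m) (\<phi> (s n)) x)"
      unfolding Cauchy_def
    proof (intro allI impI)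
      fix e :: real assume e: "e > 0"
      \<comment> \<open>All averages are Lipschitz in the point with constant at most
        \<open>M\<close>; moving to a point of \<open>D\<close> closer than \<open>d\<close>
        therefore changes them by at most e/4, uniformly in \<open>n\<close>.\<close>
      define d where "d = e / (4 * (M + 1))"
      have d: "d > 0" using e M0 by (simp add: d_def)
      have "\<exists>y\<in>D. y \<in> ball x d" using d by (intro D) auto
      then obtain y where y: "y \<in> D" "norm (x - y) < d" by (auto simp: dist_norm)
      have "norm (x - y) * M \<le> d * (M + 1)" using y M0 d by (intro mult_mono) auto
      also have "\<dots> = e / 4" using M0 by (simp add: d_def field_simps)
      finally have yM: "norm (x - y) * M \<le> e / 4" .
      have close: "\<bar>tent_avg (\<rho> m) (\<phi> n) x - tent_avg (\<rho> m) (\<phi> n) y\<bar> \<le> e / 4" for n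
        using order.trans[OF tent_avg_lipschitz[OF i\<phi>] order.trans[OF mult_left_mono[OF M(1)] yM]] by simp
      have "Cauchy (\<lambda>n. tent_avg (\<rho> m) (\<phi> (s n)) y)"
        using s(2)[of "(m, y)"] y(1) by (auto simp: f_def intro: LIMSEQ_imp_Cauchy)
      from metric_CauchyD[OF this, of "e / 4"] e
      obtain N where N: "\<And>k l. k \<ge> N \<Longrightarrow> l \<ge> N \<Longrightarrow> \<bar>tent_avg (\<rho> m) (\<phi> (s k)) y - tent_avg (\<rho> m) (\<phi> (s l)) y\<bar> < e / 4"
        unfolding dist_real_def by force
      show "\<exists>N. \<forall>k\<ge>N. \<forall>l\<ge>N. dist (tent_avg (\<rho> m) (\<phi> (s k)) x) (tent_avg (\<rho> m) (\<phi> (s l)) x) < e"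
      proof (intro exI[of _ N] allI impI)
        fix k l assume "k \<ge> N" "l \<ge> N"
        from N[OF this] close[of "s k"] close[of "s l"] e
        show "dist (tent_avg (\<rho> m) (\<phi> (s k)) x) (tent_avg (\<rho> m) (\<phi> (s l)) x) < e"
          unfolding dist_real_def by linarith
      qed
    qed
    then show ?thesis by (rule real_Cauchy_convergent)
  qed
  define L where "L m x = lim (\<lambda>n. tent_avg (\<rho> m) (\<phi> (s n)) x)" for m x
  have lim: "(\<lambda>n. tent_avg (\<rho> m) (\<phi> (s n)) x) \<longlonglongrightarrow> L m x" for m x
    using conv[of m x] by (simp add: L_def convergent_LIMSEQ_iff)
  have supp: "tent_avg (\<rho> m) (\<phi> n) x = 0" if x: "norm x > R + 1" for m n x
  proof -
    have "tent (\<rho> m) (y - x) * \<phi> n y = 0" for y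
    proof (cases "y \<in> \<Omega>")
      case True
      then have "norm (y - x) \<ge> \<rho> m"
        using R[OF True] x \<rho>[of m] norm_triangle_ineq2[of x y] by (simp add: norm_minus_commute)
      then show ?thesis by (simp add: tent_simps)
    next
      case False
      obtain K where "K \<subseteq> \<Omega>" "\<And>x. x \<notin> K \<Longrightarrow> \<phi> n x = 0" using test_functions_supportE[OF \<phi>] by metis
      then show ?thesis using False by auto
    qed
    then show ?thesis unfolding tent_avg_def by (simp only: integral_zero)
  qed
  have [measurable]: "tent_avg (\<rho> m) (\<phi> n) \<in> borel_measurable borel" for m n
    by (intro borel_measurable_continuous_onI continuous_on_tent_avg i\<phi>)
  have [measurable]: "L m \<in> borel_measurable borel" for m unfolding L_def by measurable
  \<comment> \<open>All scales are at most 1, so the averages vanish at distance more than 1 from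
    the ball containing the domain.\<close>
  define w where "w x = 2 * M * indicator (cball 0 (R + 1)) x" for x :: "real^'n"
  have w: "integrable lborel w"
    unfolding w_def by (intro integrable_mult_right integrable_real_indicator)
      (auto simp: less_top[symmetric] intro!: less_imp_neq[OF emeasure_bounded_finite[OF bounded_cball, unfolded infinity_ennreal_def]])
  have Lb: "\<bar>L m x\<bar> \<le> M" for m x
    by (rule LIMSEQ_le_const2[OF tendsto_rabs[OF lim]]) (use bound in auto)
  have L0: "L m x = 0" if "norm x > R + 1" for m x
    using lim[of m x] supp[OF that] by (simp add: LIMSEQ_const_iff)
  have wb: "\<bar>tent_avg (\<rho> m) (\<phi> n) x - L m x\<bar> \<le> w x" for m n x
    using bound[of m n x] Lb[of m x] supp[of x m n] L0[of x m]
    by (cases "norm x > R + 1") (auto simp: w_def indicator_def)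
  have wi: "integrable lborel (\<lambda>x. \<bar>tent_avg (\<rho> m) (\<phi> n) x - L m x\<bar>)" for m n
    by (rule Bochner_Integration.integrable_bound[OF w]) (auto intro!: order.trans[OF wb abs_ge_self])
  have avg0: "(\<lambda>n. \<integral>x. \<bar>tent_avg (\<rho> m) (\<phi> (s n)) x - L m x\<bar> \<partial>lborel) \<longlonglongrightarrow> (\<integral>x. 0 \<partial>(lborel :: (real^'n) measure))" for m
  proof (rule integral_dominated_convergence[where w = w])
    show "AE x in lborel. (\<lambda>n. \<bar>tent_avg (\<rho> m) (\<phi> (s n)) x - L m x\<bar>) \<longlonglongrightarrow> 0"
      using lim by (intro AE_I2 tendsto_rabs_zero LIM_zero) auto
  qed (use w wb in auto)
  have "\<exists>N. \<forall>k\<ge>N. \<forall>l\<ge>N. pint lborel 1 (\<lambda>x. \<phi> (s k) x - \<phi> (s l) x) < e" if e: "0 < e" for e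
  proof -
    define C where "C = real CARD('n) * M"
    have C: "0 \<le> C" using M0 by (simp add: C_def)
    \<comment> \<open>The scale is fixed first, so that each of the two averaging errors is below
      e/4; the convergence of the averages at that scale accounts for the remaining e/2.\<close>
    obtain m where m: "real (Suc m) > 4 * C / e" using reals_Archimedean2 by (meson less_SucI of_nat_less_iff order_less_trans lessI)
    have \<rho>C: "\<rho> m * C < e / 4" using m e by (simp add: \<rho>_def field_simps)
    define I where "I = integral\<^sup>L lborel (tent (\<rho> m) :: real^'n \<Rightarrow> real)"
    have I: "0 < I" unfolding I_def by (rule integral_tent_pos[OF \<rho>(1)])
    have "\<forall>\<^sub>F n in sequentially. (\<integral>x. \<bar>tent_avg (\<rho> m) (\<phi> (s n)) x - L m x\<bar> \<partial>lborel) < I * e / 4"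
      using avg0[of m] I e by (intro order_tendstoD) auto
    then obtain N where N: "\<And>n. n \<ge> N \<Longrightarrow> (\<integral>x. \<bar>tent_avg (\<rho> m) (\<phi> (s n)) x - L m x\<bar> \<partial>lborel) < I * e / 4"
      by (auto simp: eventually_sequentially)
    have "pint lborel 1 (\<lambda>x. \<phi> (s k) x - \<phi> (s l) x) < e" if kl: "k \<ge> N" "l \<ge> N" for k l
    proof -
      let ?a = "\<lambda>x. \<bar>tent_avg (\<rho> m) (\<phi> (s k)) x - tent_avg (\<rho> m) (\<phi> (s l)) x\<bar>"
      have ai: "integrable lborel ?a"
        by (rule Bochner_Integration.integrable_bound[OF Bochner_Integration.integrable_add[OF wi[of m "s k"] wi[of m "s l"]]])
          auto
      have "(\<integral>x. ?a x \<partial>lborel) \<le> (\<integral>x. \<bar>tent_avg (\<rho> m) (\<phi> (s k)) x - L m x\<bar> + \<bar>tent_avg (\<rho> m) (\<phi> (s l)) x - L m x\<bar> \<partial>lborel)"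
        by (rule integral_mono[OF ai Bochner_Integration.integrable_add[OF wi[of m "s k"] wi[of m "s l"]]]) auto
      also have "\<dots> < I * e / 4 + I * e / 4"
        using N[OF kl(1)] N[OF kl(2)] wi[of m "s k"] wi[of m "s l"] by simp
      finally have "(\<integral>x. ?a x \<partial>lborel) < I * (e / 2)" by simp
      then have a: "(\<integral>x. ?a x \<partial>lborel) / I < e / 2" using I by (simp add: pos_divide_less_eq mult.commute)
      have g: "\<rho> m * (\<Sum>i\<in>UNIV. pint lborel 1 (partial_deriv i (\<phi> n))) \<le> \<rho> m * C" for n
        using sum_bounded_above[of "UNIV::'n set" "\<lambda>i. pint lborel 1 (partial_deriv i (\<phi> n))" M] M \<rho>[of m]
        by (intro mult_left_mono) (auto simp: C_def)
      show ?thesis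
        using tent_avg_L1_close[OF \<phi> \<phi> \<rho>(1) ai] a g[of "s k"] g[of "s l"] \<rho>C unfolding I_def by linarith
    qed
    then show ?thesis by blast
  qed
  with s(1) that show thesis by blast
qed

section \<open>Uniqueness of weak derivatives\<close>

text \<open>The positive and the negative part of \<open>f\<close> are densities of measures that
  agree on all boxes, an intersection-stable generator of the Borel sets; hence the two parts agree
  almost everywhere, which leaves only 0.\<close>

lemma box_integral_zero_AE:
  fixes f :: "'a::euclidean_space \<Rightarrow> real"
  assumes f: "integrable lborel f" and z: "\<And>c d. (\<integral>x. indicator (box c d) x * f x \<partial>lborel) = 0"
  shows "AE x in lborel. f x = 0"
proof -
  note [measurable] = borel_measurable_integrable[OF f]
  have em: "emeasure (density lborel (\<lambda>x. ennreal (g x))) (box c d) = ennreal (\<integral>x. indicator (box c d) x * max 0 (g x) \<partial>lborel)"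
    if g: "integrable lborel g" for g and c d :: 'a
  proof -
    note [measurable] = borel_measurable_integrable[OF g]
    have i: "integrable lborel (\<lambda>x. indicator (box c d) x * max 0 (g x))"
      by (rule Bochner_Integration.integrable_bound[OF g]) (auto simp: indicator_def)
    have "emeasure (density lborel (\<lambda>x. ennreal (g x))) (box c d) = (\<integral>\<^sup>+x. ennreal (g x) * indicator (box c d) x \<partial>lborel)"
      by (rule emeasure_density) auto
    also have "\<dots> = (\<integral>\<^sup>+x. ennreal (indicator (box c d) x * max 0 (g x)) \<partial>lborel)"
      by (intro nn_integral_cong) (auto simp: indicator_def max_def ennreal_neg)
    also have "\<dots> = ennreal (\<integral>x. indicator (box c d) x * max 0 (g x) \<partial>lborel)"
      by (rule nn_integral_eq_integral[OF i]) auto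
    finally show ?thesis .
  qed
  have mf: "integrable lborel (\<lambda>x. - f x)" using f by simp
  have eq: "(\<integral>x. indicator (box c d) x * max 0 (f x) \<partial>lborel) = (\<integral>x. indicator (box c d) x * max 0 (- f x) \<partial>lborel)" for c d
  proof -
    have i: "integrable lborel (\<lambda>x. indicator (box c d) x * max 0 (f x))" "integrable lborel (\<lambda>x. indicator (box c d) x * max 0 (- f x))"
      by (rule Bochner_Integration.integrable_bound[OF f]; auto simp: indicator_def)+
    have "(\<integral>x. indicator (box c d) x * f x \<partial>lborel) = (\<integral>x. indicator (box c d) x * max 0 (f x) - indicator (box c d) x * max 0 (- f x) \<partial>lborel)"
      by (intro Bochner_Integration.integral_cong) (auto simp: max_def)
    also have "\<dots> = (\<integral>x. indicator (box c d) x * max 0 (f x) \<partial>lborel) - (\<integral>x. indicator (box c d) x * max 0 (- f x) \<partial>lborel)"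
      using i by simp
    finally show ?thesis by (simp add: z)
  qed
  let ?E = "range (\<lambda>(a, b). box a b::'a set)" and ?A = "\<lambda>n::nat. box (- (real n *\<^sub>R One)) (real n *\<^sub>R One) :: 'a set"
  have "density lborel (\<lambda>x. ennreal (f x)) = density lborel (\<lambda>x. ennreal (- f x))"
  proof (rule measure_eqI_generator_eq[of ?E UNIV _ _ ?A])
    show "Int_stable ?E" by (auto simp: Int_stable_def box_Int_box)
    show "range ?A \<subseteq> ?E" "(\<Union>i. ?A i) = UNIV" unfolding UN_box_eq_UNIV by auto
    show "emeasure (density lborel (\<lambda>x. ennreal (f x))) X = emeasure (density lborel (\<lambda>x. ennreal (- f x))) X" if "X \<in> ?E" for X
      using that em[OF f] em[OF mf] eq by auto
    show "emeasure (density lborel (\<lambda>x. ennreal (f x))) (?A i) \<noteq> \<infinity>" for i by (simp add: em[OF f])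
  qed (auto simp: borel_eq_box)
  \<comment> \<open>Since \<open>ennreal\<close> sends negative numbers to 0, this equality of the
    two parts holds only where \<open>f\<close> vanishes.\<close>
  then have "AE x in lborel. ennreal (f x) = ennreal (- f x)"
    by (intro sigma_finite_measure.density_unique[OF lborel.sigma_finite_measure_axioms]) auto
  then show ?thesis
  proof eventually_elim
    case (elim x)
    then show ?case
      by (cases "f x" "0::real" rule: linorder_cases) (auto simp: ennreal_neg ennreal_eq_0_iff dest: sym)
  qed
qed

lemma borel_measurable_indicator_box_lebesgue:
  "(indicator (box c d) :: 'a::euclidean_space \<Rightarrow> real) \<in> borel_measurable lebesgue"
  by (rule measurable_completion) simp

text \<open>The argument with densities lives on Borel sets, so \<open>f\<close> is replaced by an
  almost everywhere equal Borel function.\<close>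

lemma lebesgue_box_integral_zero_AE:
  fixes f :: "'a::euclidean_space \<Rightarrow> real"
  assumes f: "integrable lebesgue f" and z: "\<And>c d. (\<integral>x. indicator (box c d) x * f x \<partial>lebesgue) = 0"
  shows "AE x in lebesgue. f x = 0"
proof -
  obtain f' where f' [measurable]: "f' \<in> borel_measurable lborel" and ae: "AE x in lborel. f x = f' x"
    using completion_ex_borel_measurable_real[OF borel_measurable_integrable[OF f]] by blast
  have ae': "AE x in lebesgue. f x = f' x" by (rule AE_completion[OF ae])
  note [measurable] = borel_measurable_integrable[OF f]
  have m: "f' \<in> borel_measurable lebesgue" by (rule measurable_completion) simp
  have "integrable lebesgue f'" using integrable_cong_AE[OF _ m ae'] f by auto
  then have i: "integrable lborel f'" by (simp add: integrable_completion)
  have "(\<integral>x. indicator (box c d) x * f' x \<partial>lborel) = 0" for c d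
  proof -
    have "(\<integral>x. indicator (box c d) x * f' x \<partial>lborel) = (\<integral>x. indicator (box c d) x * f' x \<partial>lebesgue)"
      by (rule integral_completion[symmetric]) measurable
    also have "\<dots> = (\<integral>x. indicator (box c d) x * f x \<partial>lebesgue)"
    proof (rule integral_cong_AE)
      show "AE x in lebesgue. indicator (box c d) x * f' x = indicator (box c d) x * f x"
        using ae' by eventually_elim simp
    qed (use m in \<open>auto intro!: borel_measurable_times borel_measurable_indicator_box_lebesgue\<close>)
    finally show ?thesis using z by simp
  qed
  from box_integral_zero_AE[OF i this] have "AE x in lebesgue. f' x = 0" by (rule AE_completion)
  with ae' show ?thesis by eventually_elim simp
qed

lemma locally_integrable_diff:
  "locally_integrable \<Omega> f \<Longrightarrow> locally_integrable \<Omega> g \<Longrightarrow> locally_integrable \<Omega> (\<lambda>x. f x - g x)"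
  by (auto simp: locally_integrable_def set_integral_diff(1))

section \<open>Lebesgue measure on a bounded open set and the fundamental lemma\<close>

locale aniso_domain =
  fixes \<Omega> :: "(real^'n::finite) set" and p :: "'n \<Rightarrow> real"
  assumes bdd: "bounded \<Omega>" and op: "open \<Omega>" and ne: "\<Omega> \<noteq> {}" and p: "\<And>i. 1 < p i"
begin

abbreviation M :: "(real^'n) measure" where "M \<equiv> lebesgue_on \<Omega>"
abbreviation T :: "(real^'n \<Rightarrow> real) set" where "T \<equiv> test_functions \<Omega>"

lemma p0: "0 < p i" "0 \<le> p i" "1 \<le> p i" using p[of i] by auto

lemma sets_lebesgue [measurable]: "\<Omega> \<in> sets lebesgue"
  using op by (simp add: borel_open)

lemma finite_M: "finite_measure M"
  by (rule finite_measure_lebesgue_on) (simp add: bdd op lmeasurable_open)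

sublocale finite_measure M by (rule finite_M)

lemma measurable_M: "f \<in> borel_measurable borel \<Longrightarrow> f \<in> borel_measurable M"
  by (intro measurable_restrict_space1 measurable_completion) simp

text \<open>The calculus of test functions takes place on the whole space with
  \<open>lborel\<close>, the Sobolev space on the domain with the completed measure; this passes
  between the two.\<close>

lemma transfer_M:
  fixes f :: "real^'n \<Rightarrow> real"
  assumes [measurable]: "f \<in> borel_measurable borel" and "\<And>x. x \<notin> \<Omega> \<Longrightarrow> f x = 0"
  shows "integrable M f \<longleftrightarrow> integrable lborel f" and "integral\<^sup>L M f = integral\<^sup>L lborel f"
proof -
  have "(\<lambda>x. indicator \<Omega> x *\<^sub>R f x) = f" using assms(2) by (auto simp: indicator_def fun_eq_iff)
  then show "integrable M f \<longleftrightarrow> integrable lborel f" "integral\<^sup>L M f = integral\<^sup>L lborel f"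
    by (simp_all add: integrable_restrict_space integral_restrict_space integrable_completion integral_completion)
qed

lemma test_measurable_borel: "\<phi> \<in> T \<Longrightarrow> \<phi> \<in> borel_measurable borel"
  by (rule borel_measurable_continuous_onI[OF test_functions_continuous])

lemma test_measurable: "\<phi> \<in> T \<Longrightarrow> \<phi> \<in> borel_measurable M"
  by (rule measurable_M[OF test_measurable_borel])

lemma test_zero_outside: "\<phi> \<in> T \<Longrightarrow> x \<notin> \<Omega> \<Longrightarrow> \<phi> x = 0"
  by (elim test_functions_supportE) auto

lemma test_Lp:
  assumes "\<phi> \<in> T" "0 < r"
  shows "Lp M r \<phi>" "pint M r \<phi> = pint lborel r \<phi>"
proof -
  note [measurable] = test_measurable_borel[OF assms(1)]
  have "(\<lambda>x. \<bar>\<phi> x\<bar> powr r) \<in> borel_measurable borel" by measurable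
  note tr = transfer_M[OF this]
  show "Lp M r \<phi>" "pint M r \<phi> = pint lborel r \<phi>"
    using test_Lp_lborel[OF assms] tr test_zero_outside[OF assms(1)] test_measurable[OF assms(1)] assms(2)
    by (auto simp: Lp_def pint_def)
qed

lemma test_bounded:
  assumes "\<phi> \<in> T"
  obtains B where "0 \<le> B" "\<And>x. \<bar>\<phi> x\<bar> \<le> B"
proof -
  obtain K where K: "compact K" "\<And>x. x \<notin> K \<Longrightarrow> \<phi> x = 0" using test_functions_supportE[OF assms] by metis
  have "bounded (\<phi> ` K)"
    by (intro compact_imp_bounded compact_continuous_image K continuous_on_subset[OF test_functions_continuous[OF assms]]) auto
  then obtain B where B: "\<And>x. x \<in> K \<Longrightarrow> \<bar>\<phi> x\<bar> \<le> B" by (auto simp: bounded_iff)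
  have "\<bar>\<phi> x\<bar> \<le> max B 0" for x using B[of x] K(2)[of x] by (cases "x \<in> K") auto
  with that[of "max B 0"] show thesis by simp
qed

lemma integrable_locally: "integrable M f \<Longrightarrow> locally_integrable \<Omega> f"
proof -
  assume "integrable M f"
  then have "set_integrable lebesgue \<Omega> f" by (simp add: integrable_restrict_space set_integrable_def)
  then show ?thesis unfolding locally_integrable_def
    by (auto intro!: set_integrable_subset[of lebesgue \<Omega>] lmeasurable_compact fmeasurableD)
qed

lemma locally_integrable_mult_test:
  assumes f: "locally_integrable \<Omega> f" and \<phi>: "\<phi> \<in> T"
  shows "integrable M (\<lambda>x. f x * \<phi> x)"
proof -
  obtain K where K: "compact K" "K \<subseteq> \<Omega>" "\<And>x. x \<notin> K \<Longrightarrow> \<phi> x = 0"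
    using test_functions_supportE[OF \<phi>] by metis
  obtain B where B: "\<And>x. \<bar>\<phi> x\<bar> \<le> B" using test_bounded[OF \<phi>] by metis
  have "integrable lebesgue (\<lambda>x. indicator K x *\<^sub>R f x)"
    using f K by (auto simp: locally_integrable_def set_integrable_def)
  then have "integrable lebesgue (\<lambda>x. (indicator K x *\<^sub>R f x) * \<phi> x)"
  proof (rule Bochner_Integration.integrable_bound[OF integrable_mult_right[of B]])
    have "\<phi> \<in> borel_measurable lebesgue"
      by (rule measurable_completion) (simp add: test_measurable_borel[OF \<phi>])
    then show "(\<lambda>x. (indicator K x *\<^sub>R f x) * \<phi> x) \<in> borel_measurable lebesgue"
      using borel_measurable_integrable[OF \<open>integrable lebesgue (\<lambda>x. indicator K x *\<^sub>R f x)\<close>] by simp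
    show "AE x in lebesgue. norm ((indicator K x *\<^sub>R f x) * \<phi> x) \<le> norm (B * (indicator K x *\<^sub>R f x))"
    proof (rule AE_I2)
      fix x
      have "\<bar>\<phi> x\<bar> \<le> \<bar>B\<bar>" using B[of x] by linarith
      then show "norm ((indicator K x *\<^sub>R f x) * \<phi> x) \<le> norm (B * (indicator K x *\<^sub>R f x))"
        unfolding real_norm_def abs_mult mult.commute[of "\<bar>B\<bar>"] by (rule mult_left_mono) simp
    qed
  qed
  moreover have "(\<lambda>x. (indicator K x *\<^sub>R f x) * \<phi> x) = (\<lambda>x. indicator \<Omega> x *\<^sub>R (f x * \<phi> x))"
    using K by (auto simp: fun_eq_iff indicator_def)
  ultimately show ?thesis by (simp add: integrable_restrict_space)
qed

text \<open>The fundamental lemma of the calculus of variations. Smooth approximations of indicators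
  reduce it to vanishing integrals over boxes whose closure lies in the domain, and countably many
  such boxes cover it. Working box by box is necessary because \<open>h\<close> is only locally
  integrable.\<close>

lemma test_orthogonal_AE:
  assumes h: "locally_integrable \<Omega> h" and z: "\<And>\<phi>. \<phi> \<in> T \<Longrightarrow> (\<integral>x. h x * \<phi> x \<partial>M) = 0"
  shows "AE x in M. h x = 0"
proof -
  have box0: "(\<integral>x. indicator (box a b) x * h x \<partial>lebesgue) = 0" if ab: "cbox a b \<subseteq> \<Omega>" for a b
  proof -
    let ?f = "\<lambda>x. indicator (cbox a b) x * h x"
    define kf :: "nat \<Rightarrow> real^'n \<Rightarrow> real"
      where "kf k x = real k * box_bump a b x / (1 + real k * box_bump a b x)" for k x
    have f: "integrable lebesgue ?f"
      using h ab by (auto simp: locally_integrable_def set_integrable_def)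
    have k: "kf k \<in> T" for k using box_bump_approx[OF ab, of k] by (simp add: kf_def[abs_def])
    have k1: "0 \<le> kf k x" "kf k x \<le> 1" for k x
    proof -
      have "0 \<le> real k * box_bump a b x" by (simp add: box_bump_nonneg)
      then show "0 \<le> kf k x" "kf k x \<le> 1" by (auto simp: kf_def divide_le_eq)
    qed
    have k0: "kf k x = 0" if "x \<notin> cbox a b" for k x
      using that box_bump_pos_iff[of a b x] box_bump_nonneg[of a b x] box_subset_cbox[of a b] by (force simp: kf_def)
    have m: "kf k \<in> borel_measurable lebesgue" for k
      by (rule measurable_completion) (simp add: test_measurable_borel[OF k])
    have "(\<lambda>k. \<integral>x. ?f x * kf k x \<partial>lebesgue) \<longlonglongrightarrow> (\<integral>x. ?f x * indicator (box a b) x \<partial>lebesgue)"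
    proof (rule integral_dominated_convergence[where w = "\<lambda>x. \<bar>?f x\<bar>"])
      show "AE x in lebesgue. (\<lambda>k. ?f x * kf k x) \<longlonglongrightarrow> ?f x * indicator (box a b) x"
        unfolding kf_def by (intro AE_I2 tendsto_mult_left box_bump_approx_tendsto)
      show "AE x in lebesgue. norm (?f x * kf k x) \<le> \<bar>?f x\<bar>" for k
      proof (rule AE_I2)
        fix x
        have "norm (?f x * kf k x) = \<bar>?f x\<bar> * kf k x"
          by (simp only: real_norm_def abs_mult abs_of_nonneg[OF k1(1)[of k x]])
        also have "\<dots> \<le> \<bar>?f x\<bar> * 1" by (rule mult_left_mono[OF k1(2)]) simp
        finally show "norm (?f x * kf k x) \<le> \<bar>?f x\<bar>" by (simp only: mult_1_right)
      qed
    qed (use f m in \<open>auto intro!: borel_measurable_times borel_measurable_integrable[OF f] borel_measurable_indicator_box_lebesgue\<close>)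
    moreover have "(\<integral>x. ?f x * kf k x \<partial>lebesgue) = 0" for k
    proof -
      have "(\<integral>x. ?f x * kf k x \<partial>lebesgue) = (\<integral>x. indicator \<Omega> x *\<^sub>R (h x * kf k x) \<partial>lebesgue)"
        using k0 ab by (intro Bochner_Integration.integral_cong) (auto simp: indicator_def)
      then show ?thesis using z[OF k] by (simp add: integral_restrict_space)
    qed
    ultimately have "(\<integral>x. ?f x * indicator (box a b) x \<partial>lebesgue) = 0"
      by (simp add: LIMSEQ_const_iff)
    moreover have "?f x * indicator (box a b) x = indicator (box a b) x * h x" for x
      using box_subset_cbox[of a b] by (auto simp: indicator_def)
    ultimately show ?thesis by simp
  qed
  have AE_cbox: "AE x in lebesgue. x \<in> cbox a b \<longrightarrow> h x = 0" if ab: "cbox a b \<subseteq> \<Omega>" for a b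
  proof -
    let ?f = "\<lambda>x. indicator (cbox a b) x * h x"
    have f: "integrable lebesgue ?f"
      using h ab by (auto simp: locally_integrable_def set_integrable_def)
    have "negligible (cbox a b - box a b)" by (rule negligible_frontier_interval)
    then have fr: "AE x in lebesgue. x \<notin> cbox a b - box a b"
      unfolding negligible_iff_null_sets by (rule AE_not_in)
    \<comment> \<open>An arbitrary box may leave the domain; it is cut down to its intersection with
      the given box, which is again a box. The boundary of the given one is negligible.\<close>
    have "(\<integral>x. indicator (box c d) x * ?f x \<partial>lebesgue) = 0" for c d
    proof -
      define u v where "u = (\<Sum>i\<in>Basis. max (a\<bullet>i) (c\<bullet>i) *\<^sub>R i)" "v = (\<Sum>i\<in>Basis. min (b\<bullet>i) (d\<bullet>i) *\<^sub>R i)"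
      have uv: "box a b \<inter> box c d = box u v" "cbox a b \<inter> cbox c d = cbox u v"
        by (simp_all add: u_v_def box_Int_box Int_interval)
      then have "cbox u v \<subseteq> \<Omega>" using ab by blast
      then have "(\<integral>x. indicator (box u v) x * h x \<partial>lebesgue) = 0" by (rule box0)
      moreover have "(\<integral>x. indicator (box u v) x * h x \<partial>lebesgue) = (\<integral>x. indicator (box c d) x * ?f x \<partial>lebesgue)"
      proof (rule integral_cong_AE)
        have "(\<lambda>x. indicator (box c d) x * ?f x) \<in> borel_measurable lebesgue"
          by (intro borel_measurable_times borel_measurable_integrable[OF f]) (rule borel_measurable_indicator_box_lebesgue)
        then show "(\<lambda>x. indicator (box c d) x * ?f x) \<in> borel_measurable lebesgue" .
        have "(\<lambda>x. indicator (box u v) x * ?f x) \<in> borel_measurable lebesgue"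
          by (intro borel_measurable_times borel_measurable_integrable[OF f]) (rule borel_measurable_indicator_box_lebesgue)
        moreover have "(\<lambda>x. indicator (box u v) x * ?f x) = (\<lambda>x. indicator (box u v) x * h x)"
          using uv(1) box_subset_cbox[of a b] by (auto simp: indicator_def fun_eq_iff)
        ultimately show "(\<lambda>x. indicator (box u v) x * h x) \<in> borel_measurable lebesgue" by simp
        show "AE x in lebesgue. indicator (box u v) x * h x = indicator (box c d) x * ?f x"
          using fr by eventually_elim (use uv(1) box_subset_cbox[of a b] in \<open>auto simp: indicator_def\<close>)
      qed
      ultimately show ?thesis by simp
    qed
    from lebesgue_box_integral_zero_AE[OF f this] show ?thesis
      by eventually_elim (auto simp: indicator_def)
  qed
  obtain \<D> where \<D>: "countable \<D>" "\<And>X. X \<in> \<D> \<Longrightarrow> \<exists>a b. X = cbox a b" "\<Union>\<D> = \<Omega>"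
    using open_countable_Union_open_cbox[OF op] by metis
  have "AE x in lebesgue. \<forall>X\<in>\<D>. x \<in> X \<longrightarrow> h x = 0"
    unfolding AE_ball_countable[OF \<D>(1)]
  proof
    fix X assume X: "X \<in> \<D>"
    then obtain a b where "X = cbox a b" using \<D>(2) by blast
    then show "AE x in lebesgue. x \<in> X \<longrightarrow> h x = 0" using AE_cbox[of a b] X \<D>(3) by blast
  qed
  then have "AE x in lebesgue. x \<in> \<Omega> \<longrightarrow> h x = 0"
    by eventually_elim (use \<D>(3) in blast)
  then show ?thesis by (simp add: AE_restrict_space_iff)
qed

section \<open>Weak derivatives\<close>

lemma has_weak_partial_unique:
  assumes g: "has_weak_partial \<Omega> i u g" and h: "has_weak_partial \<Omega> i u h"
  shows "AE x in M. g x = h x"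
proof -
  have "AE x in M. g x - h x = 0"
  proof (rule test_orthogonal_AE)
    show "locally_integrable \<Omega> (\<lambda>x. g x - h x)"
      using g h by (auto simp: has_weak_partial_def intro!: locally_integrable_diff)
    fix \<phi> assume \<phi>: "\<phi> \<in> T"
    have "integrable M (\<lambda>x. g x * \<phi> x)" "integrable M (\<lambda>x. h x * \<phi> x)"
      using g h \<phi> by (auto simp: has_weak_partial_def intro!: locally_integrable_mult_test)
    moreover have "(\<integral>x. u x * partial_deriv i \<phi> x \<partial>M) = - (\<integral>x. g x * \<phi> x \<partial>M)"
      "(\<integral>x. u x * partial_deriv i \<phi> x \<partial>M) = - (\<integral>x. h x * \<phi> x \<partial>M)"
      using g h \<phi> by (simp_all add: has_weak_partial_def)
    ultimately show "(\<integral>x. (g x - h x) * \<phi> x \<partial>M) = 0" by (simp add: left_diff_distrib)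
  qed
  then show ?thesis by simp
qed

lemma has_weak_partial_AE_eq:
  assumes "has_weak_partial \<Omega> i u g"
  shows "AE x in M. weak_partial \<Omega> i u x = g x"
  unfolding weak_partial_def by (rule has_weak_partial_unique[OF someI[of "has_weak_partial \<Omega> i u"] assms]) (rule assms)

text \<open>Completeness of Lebesgue measure. It is needed because \<open>weak_partial\<close> picks
  an arbitrary representative.\<close>

lemma measurable_AE_M:
  fixes f g :: "real^'n \<Rightarrow> real"
  assumes f: "f \<in> borel_measurable M" and ae: "AE x in M. f x = g x"
  shows "g \<in> borel_measurable M"
proof -
  have "(\<lambda>x. if x \<in> \<Omega> then f x else 0) \<in> borel_measurable lebesgue"
    by (rule borel_measurable_if_I[OF f sets_lebesgue])
  moreover have "AE x in lebesgue. (if x \<in> \<Omega> then f x else 0) = (if x \<in> \<Omega> then g x else 0)"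
    using ae by (simp add: AE_restrict_space_iff)
  ultimately have "(\<lambda>x. if x \<in> \<Omega> then g x else 0) \<in> borel_measurable lebesgue"
    by (rule borel_measurable_AE)
  then show ?thesis by (rule borel_measurable_if_D)
qed

lemma Lp_cong_AE:
  fixes f g :: "real^'n \<Rightarrow> real"
  assumes f: "Lp M r f" and ae: "AE x in M. f x = g x"
  shows "Lp M r g" "pint M r g = pint M r f"
proof -
  have g [measurable]: "g \<in> borel_measurable M" by (rule measurable_AE_M[OF Lp_measurable[OF f] ae])
  note [measurable] = Lp_measurable[OF f]
  have ae': "AE x in M. \<bar>f x\<bar> powr r = \<bar>g x\<bar> powr r" using ae by eventually_elim simp
  show "Lp M r g" using f integrable_cong_AE[OF _ _ ae'] by (auto simp: Lp_def)
  show "pint M r g = pint M r f" unfolding pint_def by (rule integral_cong_AE[symmetric]) (use ae' in auto)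
qed

lemma test_has_weak_partial: "\<phi> \<in> T \<Longrightarrow> has_weak_partial \<Omega> i \<phi> (partial_deriv i \<phi>)"
  unfolding has_weak_partial_def
proof (intro conjI ballI)
  assume \<phi>: "\<phi> \<in> T"
  note d = test_functions_partial[OF \<phi>, of i]
  show "locally_integrable \<Omega> \<phi>" "locally_integrable \<Omega> (partial_deriv i \<phi>)"
    using test_Lp(1)[OF \<phi>, of 1] test_Lp(1)[OF d, of 1] by (auto simp: Lp_1_iff intro!: integrable_locally)
  fix \<psi> assume \<psi>: "\<psi> \<in> T"
  note [measurable] = test_measurable_borel[OF \<phi>] test_measurable_borel[OF d]
    test_measurable_borel[OF \<psi>] test_measurable_borel[OF test_functions_partial[OF \<psi>, of i]]
  show "(\<integral>x. \<phi> x * partial_deriv i \<psi> x \<partial>M) = - (\<integral>x. partial_deriv i \<phi> x * \<psi> x \<partial>M)"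
    using test_integral_by_parts[OF \<phi> \<psi>, of i] test_zero_outside[OF \<phi>] test_zero_outside[OF \<psi>]
    by (subst (1 2) transfer_M(2)) auto
qed

lemma has_weak_partial_diff:
  assumes "has_weak_partial \<Omega> i u g" "has_weak_partial \<Omega> i v h"
  shows "has_weak_partial \<Omega> i (\<lambda>x. u x - v x) (\<lambda>x. g x - h x)"
proof -
  have u: "locally_integrable \<Omega> u" "locally_integrable \<Omega> g" "locally_integrable \<Omega> v" "locally_integrable \<Omega> h"
    using assms by (auto simp: has_weak_partial_def)
  have "(\<integral>x. (u x - v x) * partial_deriv i \<phi> x \<partial>M) = - (\<integral>x. (g x - h x) * \<phi> x \<partial>M)" if \<phi>: "\<phi> \<in> T" for \<phi>
  proof -
    note d = test_functions_partial[OF \<phi>, of i]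
    have "(\<integral>x. u x * partial_deriv i \<phi> x \<partial>M) = - (\<integral>x. g x * \<phi> x \<partial>M)"
      "(\<integral>x. v x * partial_deriv i \<phi> x \<partial>M) = - (\<integral>x. h x * \<phi> x \<partial>M)"
      using assms \<phi> by (auto simp: has_weak_partial_def)
    then show ?thesis
      using u[THEN locally_integrable_mult_test, OF \<phi>] u[THEN locally_integrable_mult_test, OF d]
      by (simp add: left_diff_distrib)
  qed
  then show ?thesis using u by (auto simp: has_weak_partial_def intro!: locally_integrable_diff)
qed

end

section \<open>The anisotropic Sobolev space as a space of limits\<close>

lemma pint_triangle:
  assumes "0 \<le> r" "Lp M r f" "Lp M r g" "Lp M r h"
  shows "pint M r (\<lambda>x. f x - h x) \<le> 2 powr r * (pint M r (\<lambda>x. f x - g x) + pint M r (\<lambda>x. h x - g x))"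
  using Lp_diff(2)[OF assms(1) Lp_diff(1)[OF assms(1,2,3)] Lp_diff(1)[OF assms(1,4,3)]] by simp

lemma Lp_lim_Cauchy:
  assumes r: "0 \<le> r" and f: "\<And>k. Lp M r (f k)" and g: "Lp M r g"
    and lim: "(\<lambda>k. pint M r (\<lambda>x. f k x - g x)) \<longlonglongrightarrow> 0" and e: "0 < e"
  shows "\<exists>N. \<forall>m\<ge>N. \<forall>n\<ge>N. pint M r (\<lambda>x. f m x - f n x) < e"
proof -
  define d where "d = e / (2 * 2 powr r)"
  have d: "0 < d" using e by (simp add: d_def)
  have "\<forall>\<^sub>F k in sequentially. pint M r (\<lambda>x. f k x - g x) < d" using lim d by (rule order_tendstoD)
  then obtain N where N: "\<And>k. k \<ge> N \<Longrightarrow> pint M r (\<lambda>x. f k x - g x) < d" by (auto simp: eventually_sequentially)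
  have "pint M r (\<lambda>x. f m x - f n x) < e" if "m \<ge> N" "n \<ge> N" for m n
  proof -
    have "pint M r (\<lambda>x. f m x - f n x) \<le> 2 powr r * (pint M r (\<lambda>x. f m x - g x) + pint M r (\<lambda>x. f n x - g x))"
      by (rule pint_triangle[OF r f g f])
    also have "\<dots> < 2 powr r * (d + d)" using N[OF that(1)] N[OF that(2)] by (intro mult_strict_left_mono) auto
    also have "\<dots> = e" by (simp add: d_def)
    finally show ?thesis .
  qed
  then show ?thesis by blast
qed

lemma Lp_lim_unique:
  assumes r: "0 \<le> r" and f: "\<And>k. Lp M r (f k)" and g: "Lp M r g" "Lp M r h"
    and lim: "(\<lambda>k. pint M r (\<lambda>x. f k x - g x)) \<longlonglongrightarrow> 0" "(\<lambda>k. pint M r (\<lambda>x. f k x - h x)) \<longlonglongrightarrow> 0"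
  shows "AE x in M. g x = h x"
proof -
  have b: "pint M r (\<lambda>x. g x - h x) \<le> 2 powr r * (pint M r (\<lambda>x. f k x - g x) + pint M r (\<lambda>x. f k x - h x))" for k
    using pint_triangle[OF r g(1) f[of k] g(2)] pint_commute[of M r g "f k"] pint_commute[of M r h "f k"] by simp
  have l: "(\<lambda>k. 2 powr r * (pint M r (\<lambda>x. f k x - g x) + pint M r (\<lambda>x. f k x - h x))) \<longlonglongrightarrow> 2 powr r * (0 + 0)"
    by (intro tendsto_intros lim)
  have "pint M r (\<lambda>x. g x - h x) \<le> 2 powr r * (0 + 0)"
    by (rule LIMSEQ_le_const[OF l]) (use b in blast)
  then have "AE x in M. g x - h x = 0" using r g by (intro pint_zero_AE Lp_diff) auto
  then show ?thesis by simp
qed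

lemma flat_seq_0_bounds: "\<bar>flat_seq 0 a - flat_seq 0 b\<bar> \<le> 2 * \<bar>a - b\<bar>"
proof -
  have *: "\<bar>flat_seq 0 a - flat_seq 0 b\<bar> \<le> 2 * \<bar>a - b\<bar>" if ab: "a < b" for a b
  proof -
    obtain z where "flat_seq 0 b - flat_seq 0 a = (b - a) * flat_seq (Suc 0) z"
      using MVT2[OF ab DERIV_flat_seq] by blast
    then have "\<bar>flat_seq 0 a - flat_seq 0 b\<bar> = \<bar>(b - a) * flat_seq (Suc 0) z\<bar>"
      using abs_minus_commute[of "flat_seq 0 a" "flat_seq 0 b"] by (simp only:)
    also have "\<dots> = (b - a) * flat_seq (Suc 0) z"
      using ab flat_seq_1_bounds(1)[of z] by (simp add: abs_mult)
    also have "\<dots> \<le> (b - a) * 2" using ab flat_seq_1_bounds(2) by (intro mult_left_mono) auto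
    finally show ?thesis using ab by simp
  qed
  show ?thesis using *[of a b] *[of b a] by (cases a b rule: linorder_cases) (auto simp: abs_minus_commute)
qed

lemma borel_measurable_flat_seq [measurable]: "flat_seq j \<in> borel_measurable borel"
  by (rule borel_measurable_continuous_onI[OF continuous_flat_seq])

context aniso_domain
begin

lemma test_partial_Lp: "\<phi> \<in> T \<Longrightarrow> 0 < r \<Longrightarrow> Lp M r (partial_deriv i \<phi>)"
  by (rule test_Lp(1)[OF test_functions_partial])

lemma partial_deriv_test_diff:
  "\<phi> \<in> T \<Longrightarrow> \<psi> \<in> T \<Longrightarrow> partial_deriv i (\<lambda>x. \<phi> x - \<psi> x) = (\<lambda>x. partial_deriv i \<phi> x - partial_deriv i \<psi> x)"
  by (intro ext partial_deriv_diff test_functions_differentiable)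

lemma partial_deriv_test_add:
  "\<phi> \<in> T \<Longrightarrow> \<psi> \<in> T \<Longrightarrow> partial_deriv i (\<lambda>x. \<phi> x + \<psi> x) = (\<lambda>x. partial_deriv i \<phi> x + partial_deriv i \<psi> x)"
  by (intro ext partial_deriv_add test_functions_differentiable)

lemma partial_deriv_test_cmult:
  "\<phi> \<in> T \<Longrightarrow> partial_deriv i (\<lambda>x. c * \<phi> x) = (\<lambda>x. c * partial_deriv i \<phi> x)"
  by (intro ext partial_deriv_cmult test_functions_differentiable)

text \<open>One Poincare constant for all directions, obtained as the sum of the finitely many
  individual ones. The lower bound for admissible parameters is expressed through it.\<close>

definition CP :: real where
  "CP = (SOME C. 0 < C \<and> (\<forall>\<phi>\<in>T. \<forall>i. pint M (p i) \<phi> \<le> C * pint M (p i) (partial_deriv i \<phi>)))"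

lemma CP: "0 < CP" "\<phi> \<in> T \<Longrightarrow> pint M (p i) \<phi> \<le> CP * pint M (p i) (partial_deriv i \<phi>)"
proof -
  have "\<exists>C. 0 < C \<and> (\<forall>\<phi>\<in>T. pint M (p j) \<phi> \<le> C * pint M (p j) (partial_deriv j \<phi>))" for j
  proof -
    obtain C where C: "0 < C" "\<And>\<phi> i. \<phi> \<in> T \<Longrightarrow> pint lborel (p j) \<phi> \<le> C * pint lborel (p j) (partial_deriv i \<phi>)"
      using test_poincare[OF bdd p[of j]] by metis
    then have "\<forall>\<phi>\<in>T. pint M (p j) \<phi> \<le> C * pint M (p j) (partial_deriv j \<phi>)"
      using test_Lp(2)[OF _ p0(1)] test_Lp(2)[OF test_functions_partial p0(1)] by simp
    with C(1) show ?thesis by blast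
  qed
  then obtain C where C: "\<And>j. 0 < C j" "\<And>j \<phi>. \<phi> \<in> T \<Longrightarrow> pint M (p j) \<phi> \<le> C j * pint M (p j) (partial_deriv j \<phi>)"
    by metis
  have "0 < (\<Sum>j\<in>UNIV. C j)" using C(1) by (intro sum_pos) auto
  moreover have "pint M (p j) \<phi> \<le> (\<Sum>j\<in>UNIV. C j) * pint M (p j) (partial_deriv j \<phi>)" if "\<phi> \<in> T" for \<phi> j
  proof -
    have "C j \<le> (\<Sum>j\<in>UNIV. C j)" using C(1) by (intro member_le_sum) (auto intro: less_imp_le)
    then show ?thesis using C(2)[OF that, of j] pint_nonneg
      by (meson mult_right_mono order_trans)
  qed
  ultimately have "\<exists>C. 0 < C \<and> (\<forall>\<phi>\<in>T. \<forall>i. pint M (p i) \<phi> \<le> C * pint M (p i) (partial_deriv i \<phi>))" by blast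
  from someI_ex[OF this] show "0 < CP" "\<phi> \<in> T \<Longrightarrow> pint M (p i) \<phi> \<le> CP * pint M (p i) (partial_deriv i \<phi>)"
    unfolding CP_def by auto
qed

section \<open>Limits of test functions together with their gradients\<close>

definition approx :: "(nat \<Rightarrow> real^'n \<Rightarrow> real) \<Rightarrow> (real^'n \<Rightarrow> real) \<Rightarrow> ('n \<Rightarrow> real^'n \<Rightarrow> real) \<Rightarrow> bool" where
  "approx \<phi> u g \<longleftrightarrow> (\<forall>k. \<phi> k \<in> T) \<and> (\<lambda>k. pint M 1 (\<lambda>x. \<phi> k x - u x)) \<longlonglongrightarrow> 0 \<and>
    (\<forall>i. (\<lambda>k. pint M (p i) (\<lambda>x. partial_deriv i (\<phi> k) x - g i x)) \<longlonglongrightarrow> 0)"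

text \<open>\<open>sob u g\<close> means that \<open>u\<close> lies in the closure of the test functions and has weak gradient
  \<open>g\<close>. The gradient is carried along because \<open>weak_partial\<close> is an arbitrary representative.\<close>

definition sob :: "(real^'n \<Rightarrow> real) \<Rightarrow> ('n \<Rightarrow> real^'n \<Rightarrow> real) \<Rightarrow> bool" where
  "sob u g \<longleftrightarrow> integrable M u \<and> (\<forall>i. Lp M (p i) (g i)) \<and> (\<exists>\<phi>. approx \<phi> u g)"

lemma approxD:
  assumes "approx \<phi> u g"
  shows "\<phi> k \<in> T" "(\<lambda>k. pint M 1 (\<lambda>x. \<phi> k x - u x)) \<longlonglongrightarrow> 0"
    "(\<lambda>k. pint M (p i) (\<lambda>x. partial_deriv i (\<phi> k) x - g i x)) \<longlonglongrightarrow> 0"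
  using assms by (auto simp: approx_def)

lemma approx_subseq: "approx \<phi> u g \<Longrightarrow> strict_mono s \<Longrightarrow> approx (\<lambda>k. \<phi> (s k)) u g"
  unfolding approx_def using LIMSEQ_subseq_LIMSEQ[unfolded o_def] by blast

lemma sobD: "sob u g \<Longrightarrow> integrable M u" "sob u g \<Longrightarrow> Lp M (p i) (g i)"
  by (auto simp: sob_def)

lemma sobE: assumes "sob u g" obtains \<phi> where "approx \<phi> u g" using assms by (auto simp: sob_def)

lemma test_Cauchy_Lp:
  assumes \<phi>: "\<And>k. \<phi> k \<in> T"
    and C: "\<And>e. 0 < e \<Longrightarrow> \<exists>N. \<forall>m\<ge>N. \<forall>n\<ge>N. pint M (p i) (\<lambda>x. partial_deriv i (\<phi> m) x - partial_deriv i (\<phi> n) x) < e"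
    and e: "0 < e"
  shows "\<exists>N. \<forall>m\<ge>N. \<forall>n\<ge>N. pint M (p i) (\<lambda>x. \<phi> m x - \<phi> n x) < e"
proof -
  obtain N where N: "\<And>m n. m \<ge> N \<Longrightarrow> n \<ge> N \<Longrightarrow> pint M (p i) (\<lambda>x. partial_deriv i (\<phi> m) x - partial_deriv i (\<phi> n) x) < e / CP"
    using C[of "e / CP"] e CP(1) by auto
  have "pint M (p i) (\<lambda>x. \<phi> m x - \<phi> n x) < e" if "m \<ge> N" "n \<ge> N" for m n
  proof -
    have "pint M (p i) (\<lambda>x. \<phi> m x - \<phi> n x) \<le> CP * pint M (p i) (\<lambda>x. partial_deriv i (\<phi> m) x - partial_deriv i (\<phi> n) x)"
      using CP(2)[OF test_functions_diff[OF \<phi>[of m] \<phi>[of n]], of i] by (simp only: partial_deriv_test_diff[OF \<phi> \<phi>])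
    also have "\<dots> < CP * (e / CP)" using N[OF that] CP(1) by (intro mult_strict_left_mono)
    finally show ?thesis using CP(1) by simp
  qed
  then show ?thesis by blast
qed

text \<open>The Poincare inequality makes the approximating sequence Cauchy for the exponent
  \<open>p i\<close>. Its limit there is identified with \<open>u\<close> through convergence for
  exponent 1, where limits are unique.\<close>

lemma approx_Lp:
  assumes a: "approx \<phi> u g" and u: "integrable M u" and g: "\<And>i. Lp M (p i) (g i)"
  shows "Lp M (p i) u" "(\<lambda>k. pint M (p i) (\<lambda>x. \<phi> k x - u x)) \<longlonglongrightarrow> 0"
proof -
  note \<phi> = approxD(1)[OF a]
  have "\<exists>N. \<forall>m\<ge>N. \<forall>n\<ge>N. pint M (p i) (\<lambda>x. partial_deriv i (\<phi> m) x - partial_deriv i (\<phi> n) x) < e" if "0 < e" for e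
    by (rule Lp_lim_Cauchy[OF p0(2) test_partial_Lp[OF \<phi> p0(1)] g approxD(3)[OF a] that])
  then have C: "\<exists>N. \<forall>m\<ge>N. \<forall>n\<ge>N. pint M (p i) (\<lambda>x. \<phi> m x - \<phi> n x) < e" if "0 < e" for e
    by (rule test_Cauchy_Lp[OF \<phi> _ that])
  obtain v where v: "Lp M (p i) v" "(\<lambda>k. pint M (p i) (\<lambda>x. \<phi> k x - v x)) \<longlonglongrightarrow> 0"
    by (rule Lp_complete[OF p0(1) test_Lp(1)[OF \<phi> p0(1)] C])
  have "(\<lambda>k. pint M 1 (\<lambda>x. \<phi> k x - v x)) \<longlonglongrightarrow> 0"
    by (rule pint_1_tendsto_0[OF finite_M _ p0(3) v(2)]) (intro Lp_diff(1) p0 test_Lp(1) \<phi> v)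
  moreover have "Lp M 1 v" using Lp_mono_exponent(1)[OF finite_M v(1), of 1] p0(3) by simp
  ultimately have "AE x in M. v x = u x"
    using Lp_lim_unique[of 1 M \<phi> v u] test_Lp(1)[OF \<phi>, of 1] approxD(2)[OF a] u by (simp add: Lp_1_iff)
  note ae = this
  show "Lp M (p i) u" by (rule Lp_cong_AE(1)[OF v(1) ae])
  have "pint M (p i) (\<lambda>x. \<phi> k x - u x) = pint M (p i) (\<lambda>x. \<phi> k x - v x)" for k
  proof (rule Lp_cong_AE(2))
    show "Lp M (p i) (\<lambda>x. \<phi> k x - v x)" by (intro Lp_diff(1) p0 test_Lp(1) \<phi> v)
    show "AE x in M. \<phi> k x - v x = \<phi> k x - u x" using ae by eventually_elim simp
  qed
  then show "(\<lambda>k. pint M (p i) (\<lambda>x. \<phi> k x - u x)) \<longlonglongrightarrow> 0" using v(2) by simp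
qed

lemma sob_Lp: "sob u g \<Longrightarrow> Lp M (p i) u"
  using approx_Lp(1) by (auto simp: sob_def)

lemma sob_poincare:
  assumes "sob u g"
  shows "pint M (p i) u \<le> CP * pint M (p i) (g i)"
proof -
  obtain \<phi> where a: "approx \<phi> u g" using assms by (rule sobE)
  note \<phi> = approxD(1)[OF a] and s = sobD[OF assms]
  have "(\<lambda>k. pint M (p i) (\<phi> k)) \<longlonglongrightarrow> pint M (p i) u"
    by (rule pint_tendsto[OF p test_Lp(1)[OF \<phi> p0(1)] sob_Lp[OF assms] approx_Lp(2)[OF a s]])
  moreover have "(\<lambda>k. CP * pint M (p i) (partial_deriv i (\<phi> k))) \<longlonglongrightarrow> CP * pint M (p i) (g i)"
    by (intro tendsto_intros pint_tendsto[OF p test_partial_Lp[OF \<phi> p0(1)] s(2) approxD(3)[OF a]])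
  ultimately show ?thesis by (rule LIMSEQ_le) (use CP(2)[OF \<phi>] in blast)
qed

lemma test_Cauchy_sob:
  assumes \<phi>: "\<And>k. \<phi> k \<in> T"
    and C: "\<And>i e. 0 < e \<Longrightarrow> \<exists>N. \<forall>m\<ge>N. \<forall>n\<ge>N. pint M (p i) (\<lambda>x. partial_deriv i (\<phi> m) x - partial_deriv i (\<phi> n) x) < e"
  obtains u g where "sob u g" "approx \<phi> u g"
proof -
  have "\<exists>g. Lp M (p i) g \<and> (\<lambda>k. pint M (p i) (\<lambda>x. partial_deriv i (\<phi> k) x - g x)) \<longlonglongrightarrow> 0" for i
  proof -
    obtain h where "Lp M (p i) h" "(\<lambda>k. pint M (p i) (\<lambda>x. partial_deriv i (\<phi> k) x - h x)) \<longlonglongrightarrow> 0"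
      by (rule Lp_complete[OF p0(1) test_partial_Lp[OF \<phi> p0(1)] C])
    then show ?thesis by blast
  qed
  then have "\<exists>g. \<forall>i. Lp M (p i) (g i) \<and> (\<lambda>k. pint M (p i) (\<lambda>x. partial_deriv i (\<phi> k) x - g i x)) \<longlonglongrightarrow> 0"
    by (intro choice allI)
  then obtain g where g: "\<And>i. Lp M (p i) (g i)" "\<And>i. (\<lambda>k. pint M (p i) (\<lambda>x. partial_deriv i (\<phi> k) x - g i x)) \<longlonglongrightarrow> 0"
    by auto
  \<comment> \<open>An arbitrary direction; the limit function may be constructed with any of the
    exponents.\<close>
  obtain j :: 'n where True by blast
  obtain u where u: "Lp M (p j) u" "(\<lambda>k. pint M (p j) (\<lambda>x. \<phi> k x - u x)) \<longlonglongrightarrow> 0"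
    by (rule Lp_complete[OF p0(1) test_Lp(1)[OF \<phi> p0(1)] test_Cauchy_Lp[OF \<phi> C]])
  have "(\<lambda>k. pint M 1 (\<lambda>x. \<phi> k x - u x)) \<longlonglongrightarrow> 0"
    by (rule pint_1_tendsto_0[OF finite_M _ p0(3) u(2)]) (intro Lp_diff(1) p0 test_Lp(1) \<phi> u)
  then have a: "approx \<phi> u g" using \<phi> g by (simp add: approx_def)
  moreover have "integrable M u" using Lp_mono_exponent(1)[OF finite_M u(1), of 1] p0(3) by (simp add: Lp_1_iff)
  ultimately show thesis using that g by (auto simp: sob_def)
qed

lemma pint_1_tendsto_test:
  assumes f: "\<And>k. integrable M (f k)" "integrable M g" and \<phi>: "\<phi> \<in> T"
    and lim: "(\<lambda>k. pint M 1 (\<lambda>x. f k x - g x)) \<longlonglongrightarrow> 0"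
  shows "(\<lambda>k. \<integral>x. f k x * \<phi> x \<partial>M) \<longlonglongrightarrow> (\<integral>x. g x * \<phi> x \<partial>M)"
proof -
  obtain B where B: "0 \<le> B" "\<And>x. \<bar>\<phi> x\<bar> \<le> B" using test_bounded[OF \<phi>] by metis
  have i: "integrable M (\<lambda>x. f k x * \<phi> x)" "integrable M (\<lambda>x. g x * \<phi> x)" for k
    using f by (auto intro!: locally_integrable_mult_test[OF integrable_locally \<phi>])
  have n: "norm ((\<integral>x. f k x * \<phi> x \<partial>M) - (\<integral>x. g x * \<phi> x \<partial>M)) \<le> B * pint M 1 (\<lambda>x. f k x - g x)" for k
  proof -
    have "norm ((\<integral>x. f k x * \<phi> x \<partial>M) - (\<integral>x. g x * \<phi> x \<partial>M)) \<le> (\<integral>x. \<bar>f k x * \<phi> x - g x * \<phi> x\<bar> \<partial>M)"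
      using i integral_abs_bound[of M "\<lambda>x. f k x * \<phi> x - g x * \<phi> x"] by simp
    also have "\<dots> \<le> (\<integral>x. B * \<bar>f k x - g x\<bar> \<partial>M)"
    proof (rule integral_mono)
      show "\<bar>f k x * \<phi> x - g x * \<phi> x\<bar> \<le> B * \<bar>f k x - g x\<bar>" for x
        unfolding left_diff_distrib[symmetric] abs_mult mult.commute[of B] by (rule mult_left_mono[OF B(2)]) simp
    qed (use i f in auto)
    finally show ?thesis by (simp add: pint_1)
  qed
  have l: "(\<lambda>k. B * pint M 1 (\<lambda>x. f k x - g x)) \<longlonglongrightarrow> 0" by (rule tendsto_mult_right_zero[OF lim])
  have "(\<lambda>k. (\<integral>x. f k x * \<phi> x \<partial>M) - (\<integral>x. g x * \<phi> x \<partial>M)) \<longlonglongrightarrow> 0"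
    by (rule Lim_null_comparison[OF always_eventually[OF allI[OF n]] l])
  then show ?thesis by (rule LIM_zero_cancel)
qed

text \<open>Integration by parts holds for the approximating test functions and survives the limit,
  since convergence for exponent 1 suffices against a bounded factor.\<close>

lemma sob_has_weak_partial:
  assumes "sob u g"
  shows "has_weak_partial \<Omega> i u (g i)"
  unfolding has_weak_partial_def
proof (intro conjI ballI)
  obtain \<phi> where a: "approx \<phi> u g" using assms by (rule sobE)
  note \<phi> = approxD(1)[OF a] and s = sobD[OF assms]
  have g1: "integrable M (g i)" by (rule pint_1_le_eps(1)[OF finite_M s(2) p0(3), of 1]) simp
  show "locally_integrable \<Omega> u" "locally_integrable \<Omega> (g i)"
    by (intro integrable_locally s g1)+
  fix \<psi> assume \<psi>: "\<psi> \<in> T"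
  have i1: "integrable M (\<phi> k)" "integrable M (partial_deriv i (\<phi> k))" for k
    using test_Lp(1)[OF \<phi>, of 1] test_partial_Lp[OF \<phi>, of 1] by (auto simp: Lp_1_iff)
  have "(\<lambda>k. \<integral>x. \<phi> k x * partial_deriv i \<psi> x \<partial>M) \<longlonglongrightarrow> (\<integral>x. u x * partial_deriv i \<psi> x \<partial>M)"
    by (rule pint_1_tendsto_test[OF i1(1) s(1) test_functions_partial[OF \<psi>] approxD(2)[OF a]])
  moreover have "(\<lambda>k. - (\<integral>x. partial_deriv i (\<phi> k) x * \<psi> x \<partial>M)) \<longlonglongrightarrow> - (\<integral>x. g i x * \<psi> x \<partial>M)"
  proof (intro tendsto_minus pint_1_tendsto_test[OF i1(2) g1 \<psi>])
    show "(\<lambda>k. pint M 1 (\<lambda>x. partial_deriv i (\<phi> k) x - g i x)) \<longlonglongrightarrow> 0"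
      by (rule pint_1_tendsto_0[OF finite_M _ p0(3) approxD(3)[OF a]]) (intro Lp_diff(1) p0 test_partial_Lp \<phi> s)
  qed
  moreover have "(\<integral>x. \<phi> k x * partial_deriv i \<psi> x \<partial>M) = - (\<integral>x. partial_deriv i (\<phi> k) x * \<psi> x \<partial>M)" for k
    using test_has_weak_partial[OF \<phi>[of k], of i] \<psi> by (simp add: has_weak_partial_def)
  ultimately have "(\<lambda>k. - (\<integral>x. partial_deriv i (\<phi> k) x * \<psi> x \<partial>M)) \<longlonglongrightarrow> (\<integral>x. u x * partial_deriv i \<psi> x \<partial>M)"
    and *: "(\<lambda>k. - (\<integral>x. partial_deriv i (\<phi> k) x * \<psi> x \<partial>M)) \<longlonglongrightarrow> - (\<integral>x. g i x * \<psi> x \<partial>M)"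
    by (simp_all only:)
  then show "(\<integral>x. u x * partial_deriv i \<psi> x \<partial>M) = - (\<integral>x. g i x * \<psi> x \<partial>M)"
    by (rule LIMSEQ_unique)
qed

lemma sob_weak_partial: "sob u g \<Longrightarrow> AE x in M. weak_partial \<Omega> i u x = g i x"
  by (rule has_weak_partial_AE_eq[OF sob_has_weak_partial])

section \<open>Agreement with the space \<open>aniso_W10\<close>\<close>

lemma in_Lp_eq: "in_Lp r \<Omega> f \<longleftrightarrow> Lp M r f"
  by (simp add: in_Lp_def Lp_def)

lemma Lp_norm_eq: "Lp_norm r \<Omega> f = pint M r f powr (1 / r)"
  by (simp add: Lp_norm_def pint_def)

lemma sob_imp_W10:
  assumes s: "sob u g"
  shows "u \<in> aniso_W10 \<Omega> p"
proof -
  obtain \<phi> where a: "approx \<phi> u g" using s by (rule sobE)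
  note \<phi> = approxD(1)[OF a]
  have "u \<in> aniso_W1 \<Omega> p"
    using sobD[OF s] sob_has_weak_partial[OF s] by (auto simp: aniso_W1_def in_Lp_eq)
  moreover have "(\<lambda>k. \<integral>x. \<bar>u x - \<phi> k x\<bar> \<partial>M) \<longlonglongrightarrow> 0"
    using approxD(2)[OF a] by (simp add: pint_1 abs_minus_commute)
  moreover have "(\<lambda>k. aniso_norm \<Omega> p (\<lambda>x. u x - \<phi> k x)) \<longlonglongrightarrow> 0"
  proof -
    have eq: "pint M (p i) (weak_partial \<Omega> i (\<lambda>x. u x - \<phi> k x)) = pint M (p i) (\<lambda>x. partial_deriv i (\<phi> k) x - g i x)" for i k
    proof -
      have "AE x in M. weak_partial \<Omega> i (\<lambda>x. u x - \<phi> k x) x = g i x - partial_deriv i (\<phi> k) x"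
        by (rule has_weak_partial_AE_eq[OF has_weak_partial_diff[OF sob_has_weak_partial[OF s] test_has_weak_partial[OF \<phi>]]])
      then have "AE x in M. g i x - partial_deriv i (\<phi> k) x = weak_partial \<Omega> i (\<lambda>x. u x - \<phi> k x) x"
        by eventually_elim simp
      from Lp_cong_AE(2)[OF Lp_diff(1)[OF p0(2) sobD(2)[OF s] test_partial_Lp[OF \<phi> p0(1)]] this]
      show ?thesis using pint_commute[of M "p i" "g i" "partial_deriv i (\<phi> k)"] by simp
    qed
    have "(\<lambda>k. \<Sum>i\<in>UNIV. pint M (p i) (\<lambda>x. partial_deriv i (\<phi> k) x - g i x) powr (1 / p i)) \<longlonglongrightarrow> (\<Sum>i\<in>(UNIV::'n set). 0 powr (1 / p i))"
      by (intro tendsto_sum tendsto_powr' tendsto_const approxD(3)[OF a]) (use p0 in \<open>auto simp: pint_nonneg\<close>)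
    then show ?thesis by (simp add: aniso_norm_def Lp_norm_eq eq)
  qed
  ultimately show ?thesis using \<phi> by (auto simp: aniso_W10_def)
qed

lemma W10_imp_sob:
  assumes u: "u \<in> aniso_W10 \<Omega> p"
  shows "sob u (\<lambda>i. weak_partial \<Omega> i u)"
proof -
  have u1: "u \<in> aniso_W1 \<Omega> p" using u by (simp add: aniso_W10_def)
  have "\<exists>g. has_weak_partial \<Omega> i u g \<and> Lp M (p i) g" for i
    using u1 by (auto simp: aniso_W1_def in_Lp_eq)
  then obtain g where g: "\<And>i. has_weak_partial \<Omega> i u (g i)" "\<And>i. Lp M (p i) (g i)" by metis
  have w: "has_weak_partial \<Omega> i u (weak_partial \<Omega> i u)" for i
    unfolding weak_partial_def by (rule someI[of "has_weak_partial \<Omega> i u", OF g(1)])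
  have wL: "Lp M (p i) (weak_partial \<Omega> i u)" for i
    by (rule Lp_cong_AE(1)[OF g(2) has_weak_partial_unique[OF g(1) w]])
  obtain \<phi> where \<phi>: "\<And>k. \<phi> k \<in> T" and n: "(\<lambda>k. aniso_norm \<Omega> p (\<lambda>x. u x - \<phi> k x)) \<longlonglongrightarrow> 0"
    and l: "(\<lambda>k. \<integral>x. \<bar>u x - \<phi> k x\<bar> \<partial>M) \<longlonglongrightarrow> 0"
    using u by (auto simp: aniso_W10_def)
  have "(\<lambda>k. pint M (p i) (\<lambda>x. partial_deriv i (\<phi> k) x - weak_partial \<Omega> i u x)) \<longlonglongrightarrow> 0" for i
  proof -
    have eq: "pint M (p i) (weak_partial \<Omega> i (\<lambda>x. u x - \<phi> k x)) = pint M (p i) (\<lambda>x. partial_deriv i (\<phi> k) x - weak_partial \<Omega> i u x)" for k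
    proof -
      have "AE x in M. weak_partial \<Omega> i (\<lambda>x. u x - \<phi> k x) x = weak_partial \<Omega> i u x - partial_deriv i (\<phi> k) x"
        by (rule has_weak_partial_AE_eq[OF has_weak_partial_diff[OF w test_has_weak_partial[OF \<phi>]]])
      then have "AE x in M. weak_partial \<Omega> i u x - partial_deriv i (\<phi> k) x = weak_partial \<Omega> i (\<lambda>x. u x - \<phi> k x) x"
        by eventually_elim simp
      from Lp_cong_AE(2)[OF Lp_diff(1)[OF p0(2) wL test_partial_Lp[OF \<phi> p0(1)]] this]
      show ?thesis using pint_commute[of M "p i" "weak_partial \<Omega> i u" "partial_deriv i (\<phi> k)"] by simp
    qed
    have "Lp_norm (p i) \<Omega> (weak_partial \<Omega> i (\<lambda>x. u x - \<phi> k x)) \<le> aniso_norm \<Omega> p (\<lambda>x. u x - \<phi> k x)" for k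
      unfolding aniso_norm_def by (rule member_le_sum) (auto simp: Lp_norm_eq)
    then have "(\<lambda>k. Lp_norm (p i) \<Omega> (weak_partial \<Omega> i (\<lambda>x. u x - \<phi> k x))) \<longlonglongrightarrow> 0"
      by (intro tendsto_sandwich[OF _ _ tendsto_const n] always_eventually) (auto simp: Lp_norm_eq)
    then have "(\<lambda>k. (pint M (p i) (\<lambda>x. partial_deriv i (\<phi> k) x - weak_partial \<Omega> i u x) powr (1 / p i)) powr p i) \<longlonglongrightarrow> 0 powr p i"
      by (intro tendsto_powr') (use p0 in \<open>auto simp: Lp_norm_eq eq\<close>)
    then show ?thesis using p0(1)[of i] by (simp add: powr_powr pint_nonneg)
  qed
  moreover have "(\<lambda>k. pint M 1 (\<lambda>x. \<phi> k x - u x)) \<longlonglongrightarrow> 0"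
    using l by (simp add: pint_1 abs_minus_commute)
  ultimately have "approx \<phi> u (\<lambda>i. weak_partial \<Omega> i u)" using \<phi> by (simp add: approx_def)
  then show ?thesis using wL u1 by (auto simp: sob_def aniso_W1_def)
qed

section \<open>Stability under linear combinations and composition\<close>

lemma sob_test: "\<phi> \<in> T \<Longrightarrow> sob \<phi> (\<lambda>i. partial_deriv i \<phi>)"
  using test_Lp(1)[of \<phi> 1] test_partial_Lp[OF _ p0(1)]
  by (auto simp: sob_def approx_def Lp_1_iff pint_def intro!: exI[of _ "\<lambda>k. \<phi>"])

lemma sob_cmult:
  assumes "sob u g"
  shows "sob (\<lambda>x. c * u x) (\<lambda>i x. c * g i x)"
proof -
  obtain \<phi> where a: "approx \<phi> u g" using assms by (rule sobE)
  note \<phi> = approxD(1)[OF a]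
  have "(\<lambda>k. \<bar>c\<bar> powr 1 * pint M 1 (\<lambda>x. \<phi> k x - u x)) \<longlonglongrightarrow> \<bar>c\<bar> powr 1 * 0"
    by (intro tendsto_intros approxD(2)[OF a])
  moreover have "(\<lambda>k. \<bar>c\<bar> powr p i * pint M (p i) (\<lambda>x. partial_deriv i (\<phi> k) x - g i x)) \<longlonglongrightarrow> \<bar>c\<bar> powr p i * 0" for i
    by (intro tendsto_intros approxD(3)[OF a])
  ultimately have "approx (\<lambda>k x. c * \<phi> k x) (\<lambda>x. c * u x) (\<lambda>i x. c * g i x)"
    unfolding approx_def
    by (auto simp: partial_deriv_test_cmult[OF \<phi>] pint_cmult test_functions_cmult[OF \<phi>] simp flip: right_diff_distrib)
  then show ?thesis using sobD[OF assms] by (auto simp: sob_def intro!: Lp_cmult)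
qed

lemma sob_add:
  assumes u: "sob u g" and v: "sob v h"
  shows "sob (\<lambda>x. u x + v x) (\<lambda>i x. g i x + h i x)"
proof -
  obtain \<phi> where a: "approx \<phi> u g" using u by (rule sobE)
  obtain \<psi> where b: "approx \<psi> v h" using v by (rule sobE)
  note \<phi> = approxD(1)[OF a] and \<psi> = approxD(1)[OF b]
  have add: "(\<lambda>k. pint M r (\<lambda>x. (f k x + g k x) - (f' x + g' x))) \<longlonglongrightarrow> 0"
    if "0 \<le> r" "\<And>k. Lp M r (\<lambda>x. f k x - f' x)" "\<And>k. Lp M r (\<lambda>x. g k x - g' x)"
      "(\<lambda>k. pint M r (\<lambda>x. f k x - f' x)) \<longlonglongrightarrow> 0" "(\<lambda>k. pint M r (\<lambda>x. g k x - g' x)) \<longlonglongrightarrow> 0" for r f f' g g'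
  proof (rule tendsto_sandwich[OF _ _ tendsto_const])
    show "\<forall>\<^sub>F k in sequentially. pint M r (\<lambda>x. (f k x + g k x) - (f' x + g' x))
        \<le> 2 powr r * (pint M r (\<lambda>x. f k x - f' x) + pint M r (\<lambda>x. g k x - g' x))"
      using Lp_add(2)[OF that(1-3)] by (simp add: add_diff_add)
    have "(\<lambda>k. 2 powr r * (pint M r (\<lambda>x. f k x - f' x) + pint M r (\<lambda>x. g k x - g' x))) \<longlonglongrightarrow> 2 powr r * (0 + 0)"
      by (intro tendsto_intros that)
    then show "(\<lambda>k. 2 powr r * (pint M r (\<lambda>x. f k x - f' x) + pint M r (\<lambda>x. g k x - g' x))) \<longlonglongrightarrow> 0" by simp
  qed (simp add: pint_nonneg)
  have "(\<lambda>k. pint M 1 (\<lambda>x. \<phi> k x + \<psi> k x - (u x + v x))) \<longlonglongrightarrow> 0"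
    by (rule add) (use sobD(1)[OF u] sobD(1)[OF v] test_Lp(1)[OF \<phi>, of 1] test_Lp(1)[OF \<psi>, of 1] approxD(2)[OF a] approxD(2)[OF b]
      in \<open>auto simp: Lp_1_iff\<close>)
  moreover have "(\<lambda>k. pint M (p i) (\<lambda>x. partial_deriv i (\<phi> k) x + partial_deriv i (\<psi> k) x - (g i x + h i x))) \<longlonglongrightarrow> 0" for i
    by (intro add p0 Lp_diff(1) test_partial_Lp \<phi> \<psi> sobD[OF u] sobD[OF v] approxD(3)[OF a] approxD(3)[OF b])
  ultimately have "approx (\<lambda>k x. \<phi> k x + \<psi> k x) (\<lambda>x. u x + v x) (\<lambda>i x. g i x + h i x)"
    unfolding approx_def by (simp add: partial_deriv_test_add[OF \<phi> \<psi>] test_functions_add[OF \<phi> \<psi>])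
  then show ?thesis using sobD[OF u] sobD[OF v] p0 by (auto simp: sob_def intro!: Lp_add)
qed

text \<open>The chain rule for the substitute of the positive part. Composition keeps the
  approximants test functions, and an almost everywhere convergent subsequence is taken so that
  their derivatives can be followed pointwise.\<close>

lemma sob_flat:
  assumes s: "sob u g"
  shows "sob (\<lambda>x. flat_seq 0 (u x)) (\<lambda>i x. flat_seq (Suc 0) (u x) * g i x)"
proof -
  obtain \<phi>0 where a0: "approx \<phi>0 u g" using s by (rule sobE)
  obtain r where r: "strict_mono (r::nat\<Rightarrow>nat)" "AE x in M. (\<lambda>k. \<phi>0 (r k) x) \<longlonglongrightarrow> u x"
  proof (rule Lp_AE_subseq[OF zero_less_one _ approxD(2)[OF a0]])
    show "Lp M 1 (\<lambda>x. \<phi>0 n x - u x)" for n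
      using Lp_diff(1)[OF zero_le_one test_Lp(1)[OF approxD(1)[OF a0] zero_less_one], of u] sobD(1)[OF s]
      by (simp add: Lp_1_iff)
  qed
  define \<phi> where "\<phi> k = \<phi>0 (r k)" for k
  have a: "approx \<phi> u g" unfolding \<phi>_def by (rule approx_subseq[OF a0 r(1)])
  have ae: "AE x in M. (\<lambda>k. \<phi> k x) \<longlonglongrightarrow> u x" using r(2) by (simp add: \<phi>_def)
  note \<phi> = approxD(1)[OF a]
  have [measurable]: "u \<in> borel_measurable M" using sobD(1)[OF s] by (rule borel_measurable_integrable)
  have [measurable]: "\<phi> k \<in> borel_measurable M" "partial_deriv i (\<phi> k) \<in> borel_measurable M" for k i
    by (intro test_measurable \<phi> test_functions_partial)+
  have [measurable]: "g i \<in> borel_measurable M" for i by (rule Lp_measurable[OF sobD(2)[OF s]])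
  have b1: "\<bar>flat_seq (Suc 0) t\<bar> \<le> 2" for t using flat_seq_1_bounds[of t] by simp
  have iu: "integrable M (\<lambda>x. \<phi> k x - u x)" for k
    using test_Lp(1)[OF \<phi>, of 1] sobD(1)[OF s] by (simp add: Lp_1_iff)
  have "(\<lambda>k. pint M 1 (\<lambda>x. flat_seq 0 (\<phi> k x) - flat_seq 0 (u x))) \<longlonglongrightarrow> 0"
  proof (rule tendsto_sandwich[OF _ _ tendsto_const])
    have "pint M 1 (\<lambda>x. flat_seq 0 (\<phi> k x) - flat_seq 0 (u x)) \<le> (\<integral>x. 2 * \<bar>\<phi> k x - u x\<bar> \<partial>M)" for k
    proof (rule Lp_I_bound(2))
      show "AE x in M. \<bar>flat_seq 0 (\<phi> k x) - flat_seq 0 (u x)\<bar> powr 1 \<le> 2 * \<bar>\<phi> k x - u x\<bar>"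
        using flat_seq_0_bounds by simp
    qed (use iu in auto)
    then show "\<forall>\<^sub>F k in sequentially. pint M 1 (\<lambda>x. flat_seq 0 (\<phi> k x) - flat_seq 0 (u x)) \<le> 2 * pint M 1 (\<lambda>x. \<phi> k x - u x)"
      by (simp add: pint_1)
    have "(\<lambda>k. 2 * pint M 1 (\<lambda>x. \<phi> k x - u x)) \<longlonglongrightarrow> 2 * 0" by (intro tendsto_intros approxD(2)[OF a])
    then show "(\<lambda>k. 2 * pint M 1 (\<lambda>x. \<phi> k x - u x)) \<longlonglongrightarrow> 0" by simp
  qed (simp add: pint_nonneg)
  moreover have "(\<lambda>k. pint M (p i) (\<lambda>x. partial_deriv i (\<lambda>x. flat_seq 0 (\<phi> k x)) x - flat_seq (Suc 0) (u x) * g i x)) \<longlonglongrightarrow> 0" for i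
  proof (rule tendsto_sandwich[OF _ _ tendsto_const])
    \<comment> \<open>The difference of the products is \<open>?A k x + ?B k x\<close>: the first
      part is small by strong convergence of the gradients and the bounded factor, the second by
      pointwise convergence of the factor, dominated by a multiple of |g|.\<close>
    let ?A = "\<lambda>k x. flat_seq (Suc 0) (\<phi> k x) * (partial_deriv i (\<phi> k) x - g i x)"
    let ?B = "\<lambda>k x. (flat_seq (Suc 0) (\<phi> k x) - flat_seq (Suc 0) (u x)) * g i x"
    have Lg: "Lp M (p i) (g i)" by (rule sobD(2)[OF s])
    have Ld: "Lp M (p i) (\<lambda>x. partial_deriv i (\<phi> k) x - g i x)" for k
      by (intro Lp_diff(1) p0 test_partial_Lp \<phi> Lg)
    have A: "Lp M (p i) (?A k)" "pint M (p i) (?A k) \<le> (\<integral>x. 2 powr p i * \<bar>partial_deriv i (\<phi> k) x - g i x\<bar> powr p i \<partial>M)" for k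
    proof -
      have "\<bar>?A k x\<bar> powr p i \<le> 2 powr p i * \<bar>partial_deriv i (\<phi> k) x - g i x\<bar> powr p i" for x
        unfolding abs_mult powr_mult using b1 p0 by (intro mult_right_mono powr_mono2) auto
      then show "Lp M (p i) (?A k)" "pint M (p i) (?A k) \<le> (\<integral>x. 2 powr p i * \<bar>partial_deriv i (\<phi> k) x - g i x\<bar> powr p i \<partial>M)"
        by (intro Lp_I_bound[of _ M "\<lambda>x. 2 powr p i * \<bar>partial_deriv i (\<phi> k) x - g i x\<bar> powr p i"]; use Lp_integrable[OF Ld] in simp)+
    qed
    have Bb: "\<bar>?B k x\<bar> powr p i \<le> 4 powr p i * \<bar>g i x\<bar> powr p i" for k x
    proof -
      have "\<bar>flat_seq (Suc 0) (\<phi> k x) - flat_seq (Suc 0) (u x)\<bar> \<le> 4"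
        using b1[of "\<phi> k x"] b1[of "u x"] by linarith
      then show ?thesis unfolding abs_mult powr_mult using p0 by (intro mult_right_mono powr_mono2) auto
    qed
    have B: "Lp M (p i) (?B k)" for k
      by (rule Lp_I_bound(1)[of _ M "\<lambda>x. 4 powr p i * \<bar>g i x\<bar> powr p i"]) (use Bb Lp_integrable[OF Lg] in simp_all)
    have Blim: "(\<lambda>k. pint M (p i) (?B k)) \<longlonglongrightarrow> (\<integral>x. 0 \<partial>M)"
      unfolding pint_def
    proof (rule integral_dominated_convergence[where w = "\<lambda>x. 4 powr p i * \<bar>g i x\<bar> powr p i"])
      show "AE x in M. (\<lambda>k. \<bar>?B k x\<bar> powr p i) \<longlonglongrightarrow> 0"
        using ae
      proof eventually_elim
        case (elim x)
        have "isCont (flat_seq (Suc 0)) (u x)" by (rule DERIV_isCont[OF DERIV_flat_seq])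
        then have "(\<lambda>k. flat_seq (Suc 0) (\<phi> k x)) \<longlonglongrightarrow> flat_seq (Suc 0) (u x)"
          using elim by (rule isCont_tendsto_compose)
        then have "(\<lambda>k. \<bar>?B k x\<bar> powr p i) \<longlonglongrightarrow> \<bar>(flat_seq (Suc 0) (u x) - flat_seq (Suc 0) (u x)) * g i x\<bar> powr p i"
          by (intro tendsto_powr' tendsto_intros) (use p0 in auto)
        then show ?case by simp
      qed
      show "integrable M (\<lambda>x. 4 powr p i * \<bar>g i x\<bar> powr p i)" using Lp_integrable[OF Lg] by simp
      show "AE x in M. norm (\<bar>?B k x\<bar> powr p i) \<le> 4 powr p i * \<bar>g i x\<bar> powr p i" for k
        using Bb by simp
    qed auto
    have "pint M (p i) (\<lambda>x. partial_deriv i (\<lambda>x. flat_seq 0 (\<phi> k x)) x - flat_seq (Suc 0) (u x) * g i x)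
        \<le> 2 powr p i * (2 powr p i * pint M (p i) (\<lambda>x. partial_deriv i (\<phi> k) x - g i x) + pint M (p i) (?B k))" for k
    proof -
      have "(\<lambda>x. partial_deriv i (\<lambda>x. flat_seq 0 (\<phi> k x)) x - flat_seq (Suc 0) (u x) * g i x) = (\<lambda>x. ?A k x + ?B k x)"
        by (auto simp: test_functions_flat(2)[OF \<phi>] algebra_simps)
      then have "pint M (p i) (\<lambda>x. partial_deriv i (\<lambda>x. flat_seq 0 (\<phi> k x)) x - flat_seq (Suc 0) (u x) * g i x)
        \<le> 2 powr p i * (pint M (p i) (?A k) + pint M (p i) (?B k))"
        using Lp_add(2)[OF p0(2) A(1)[of k] B[of k]] by simp
      also have "\<dots> \<le> 2 powr p i * (2 powr p i * pint M (p i) (\<lambda>x. partial_deriv i (\<phi> k) x - g i x) + pint M (p i) (?B k))"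
        using A(2)[of k] by (intro mult_left_mono add_right_mono) (auto simp: pint_def)
      finally show ?thesis .
    qed
    then show "\<forall>\<^sub>F k in sequentially. pint M (p i) (\<lambda>x. partial_deriv i (\<lambda>x. flat_seq 0 (\<phi> k x)) x - flat_seq (Suc 0) (u x) * g i x)
        \<le> 2 powr p i * (2 powr p i * pint M (p i) (\<lambda>x. partial_deriv i (\<phi> k) x - g i x) + pint M (p i) (?B k))" by simp
    have "(\<lambda>k. 2 powr p i * (2 powr p i * pint M (p i) (\<lambda>x. partial_deriv i (\<phi> k) x - g i x) + pint M (p i) (?B k))) \<longlonglongrightarrow> 2 powr p i * (2 powr p i * 0 + (\<integral>x. 0 \<partial>M))"
      by (intro tendsto_add tendsto_mult tendsto_const approxD(3)[OF a] Blim)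
    then show "(\<lambda>k. 2 powr p i * (2 powr p i * pint M (p i) (\<lambda>x. partial_deriv i (\<phi> k) x - g i x) + pint M (p i) (?B k))) \<longlonglongrightarrow> 0" by simp
  qed (simp add: pint_nonneg)
  ultimately have "approx (\<lambda>k x. flat_seq 0 (\<phi> k x)) (\<lambda>x. flat_seq 0 (u x)) (\<lambda>i x. flat_seq (Suc 0) (u x) * g i x)"
    unfolding approx_def by (simp add: test_functions_flat(1)[OF \<phi>])
  moreover have "integrable M (\<lambda>x. flat_seq 0 (u x))"
    by (rule integrable_const_bound[of _ 1]) (auto simp: flat_seq_0)
  moreover have "Lp M (p i) (\<lambda>x. flat_seq (Suc 0) (u x) * g i x)" for i
  proof (rule Lp_I_bound(1)[of _ M "\<lambda>x. 2 powr p i * \<bar>g i x\<bar> powr p i"])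
    show "AE x in M. \<bar>flat_seq (Suc 0) (u x) * g i x\<bar> powr p i \<le> 2 powr p i * \<bar>g i x\<bar> powr p i"
      unfolding abs_mult powr_mult using b1 p0 by (intro AE_I2 mult_right_mono powr_mono2) auto
  qed (use Lp_integrable[OF sobD(2)[OF s, of i]] in auto)
  ultimately show ?thesis by (auto simp: sob_def)
qed

end

section \<open>The truncated energy functional and its minimizer\<close>

text \<open>A variant of \<open>powr_interpolate\<close> with an additive constant, as coercivity on
  a set of finite measure requires.\<close>

lemma powr_absorb:
  fixes q s e :: real
  assumes "1 \<le> q" "q < s" "0 < e"
  obtains K where "0 \<le> K" "\<And>t. 0 \<le> t \<Longrightarrow> t powr q \<le> e * t powr s + K"
proof -
  obtain C where C: "0 \<le> C" "\<And>t. 0 \<le> t \<Longrightarrow> t powr q \<le> (e/2) * t powr s + C * t"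
    using powr_interpolate[OF assms(1,2), of "e/2"] assms by auto
  have s: "1 < s" using assms by simp
  obtain D where D: "0 \<le> D" "\<And>t. 0 \<le> t \<Longrightarrow> t powr 1 \<le> (e / (2 * (C + 1))) * t powr s + D * t"
    using powr_interpolate[of 1 s "e / (2 * (C + 1))"] s C(1) assms by auto
  \<comment> \<open>Chosen so that \<open>young_eps\<close> turns C t into C d plus at most (e/2)
    t^s.\<close>
  define d where "d = (e / (2 * (C + 1))) powr (1 / (1 - s))"
  have dpos: "0 < d" "d powr (1 - s) = e / (2 * (C + 1))"
    using C(1) assms s by (auto simp: d_def powr_powr)
  have "t powr q \<le> e * t powr s + C * d" if t: "0 \<le> t" for t
  proof -
    have "t \<le> d + d powr (1 - s) * t powr s"
      using young_eps[of 1 t s d] t dpos s by simp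
    then have "C * t \<le> C * (d + (e / (2 * (C + 1))) * t powr s)"
      using C(1) unfolding dpos(2) by (rule mult_left_mono)
    also have "\<dots> = C * d + (C / (C + 1)) * (e / 2) * t powr s" by (simp add: algebra_simps)
    also have "\<dots> \<le> C * d + 1 * (e / 2) * t powr s"
      using C(1) assms by (intro add_left_mono mult_right_mono) auto
    finally show ?thesis using C(2)[OF t] by simp
  qed
  with that[of "C * d"] C(1) dpos(1) show thesis by simp
qed

text \<open>A primitive of \<open>t \<mapsto> max t c powr (q - 1)\<close>. It is convex, and only its tangent
  inequality is used.\<close>

definition primF :: "real \<Rightarrow> real \<Rightarrow> real \<Rightarrow> real" where
  "primF q c t = (if t \<le> c then c powr (q - 1) * (t - c) + c powr q / q else t powr q / q)"

lemma borel_measurable_primF [measurable]: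
  assumes [measurable]: "f \<in> borel_measurable M" "g \<in> borel_measurable M"
  shows "(\<lambda>x. primF q (f x) (g x)) \<in> borel_measurable M"
  unfolding primF_def by measurable

lemma primF_tangent:
  assumes q: "1 < q" and c: "0 \<le> c"
  shows "primF q c a + max a c powr (q - 1) * (b - a) \<le> primF q c b"
proof -
  have T: "x powr q / q + x powr (q - 1) * (y - x) \<le> y powr q / q" if "0 \<le> x" "0 \<le> y" for x y
  proof -
    have "(x powr q + q * x powr (q - 1) * (y - x)) / q \<le> y powr q / q"
      using abs_powr_tangent[OF q, of x y] that q by (intro divide_right_mono) (auto simp: pflux_pos)
    then show ?thesis using q by (simp add: add_divide_distrib)
  qed
  consider "a \<le> c" "b \<le> c" | "a \<le> c" "c < b" | "c < a" "b \<le> c" | "c < a" "c < b" by linarith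
  then show ?thesis
  proof cases
    case 1
    then show ?thesis by (simp add: primF_def max_def algebra_simps)
  next
    case 2
    then show ?thesis using T[of c b] c by (simp add: primF_def max_def algebra_simps)
  next
    case 3
    \<comment> \<open>The tangent at \<open>a\<close> is followed down to the kink \<open>c\<close>;
      from there on the graph is a line with the smaller slope c^(q-1), and b - c \<le> 0 reverses
      the comparison of slopes.\<close>
    have "a powr (q - 1) * (b - c) \<le> c powr (q - 1) * (b - c)"
      using 3 q c by (intro mult_right_mono_neg powr_mono2) auto
    then show ?thesis using T[of a c] 3 c by (simp add: primF_def max_def algebra_simps)
  next
    case 4
    then show ?thesis using T[of a b] c by (simp add: primF_def max_def)
  qed
qed

lemma primF_growth:
  assumes q: "1 < q" and c: "0 \<le> c"
  shows "\<bar>primF q c a - primF q c b\<bar> \<le> 1 * (\<bar>a\<bar> + \<bar>b\<bar> + \<bar>c\<bar>) powr (q - 1) * \<bar>a - b\<bar>"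
proof -
  have *: "primF q c a - primF q c b \<le> (\<bar>a\<bar> + \<bar>b\<bar> + \<bar>c\<bar>) powr (q - 1) * \<bar>a - b\<bar>" for a b
  proof -
    have "primF q c a - primF q c b \<le> max a c powr (q - 1) * (a - b)"
      using primF_tangent[OF q c, of a b] by (simp add: algebra_simps)
    also have "\<dots> \<le> max a c powr (q - 1) * \<bar>a - b\<bar>" by (intro mult_left_mono) auto
    also have "\<dots> \<le> (\<bar>a\<bar> + \<bar>b\<bar> + \<bar>c\<bar>) powr (q - 1) * \<bar>a - b\<bar>"
      using q c by (intro mult_right_mono powr_mono2) auto
    finally show ?thesis .
  qed
  from *[of a b] *[of b a] show ?thesis by (simp add: abs_le_iff abs_minus_commute add.commute)
qed

lemma primF_bound:
  assumes q: "1 < q" and c: "0 \<le> c"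
  shows "\<bar>primF q c t\<bar> \<le> (1 + 2 powr q) * \<bar>c\<bar> powr q + 2 powr q * \<bar>t\<bar> powr q"
proof -
  have "c powr (q - 1) * c = c powr q" using c by (rule powr_minus_1_mult)
  then have "primF q c 0 = c powr q * (1 / q - 1)"
    using c by (simp add: primF_def algebra_simps)
  moreover have "\<bar>1 / q - 1\<bar> \<le> 1" using q by (auto simp: abs_if)
  ultimately have 0: "\<bar>primF q c 0\<bar> \<le> \<bar>c\<bar> powr q"
    using c by (simp add: abs_mult mult_left_le)
  have "\<bar>primF q c t - primF q c 0\<bar> \<le> (\<bar>t\<bar> + \<bar>c\<bar>) powr (q - 1) * \<bar>t\<bar>"
    using primF_growth[OF q c, of t 0] by simp
  also have "\<dots> \<le> (\<bar>t\<bar> + \<bar>c\<bar>) powr (q - 1) * (\<bar>t\<bar> + \<bar>c\<bar>)" by (intro mult_left_mono) auto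
  also have "\<dots> = (\<bar>t\<bar> + \<bar>c\<bar>) powr q" by (intro powr_minus_1_mult) simp
  also have "\<dots> \<le> 2 powr q * (\<bar>t\<bar> powr q + \<bar>c\<bar> powr q)" using q by (intro powr_add_le) auto
  finally show ?thesis using 0 by (simp add: algebra_simps)
qed

text \<open>The constant is chosen before the measure and the function, so the bound is uniform
  along sequences: boundedness for the exponent \<open>s\<close> and convergence for exponent 1 give
  convergence for \<open>q\<close>.\<close>

lemma pint_interpolate:
  assumes "1 \<le> q" "q < s" "0 < e"
  obtains C where "0 \<le> C"
    "\<And>(M :: 'a measure) f. Lp M s f \<Longrightarrow> Lp M 1 f \<Longrightarrow> Lp M q f \<and> pint M q f \<le> e * pint M s f + C * pint M 1 f"
proof -
  obtain C where C: "0 \<le> C" "\<And>t. 0 \<le> t \<Longrightarrow> t powr q \<le> e * t powr s + C * t"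
    using powr_interpolate[OF assms] by metis
  have "Lp M q f \<and> pint M q f \<le> e * pint M s f + C * pint M 1 f" if f: "Lp M s f" "Lp M 1 f" for M :: "'a measure" and f
  proof -
    have i: "integrable M (\<lambda>x. e * \<bar>f x\<bar> powr s + C * \<bar>f x\<bar> powr 1)"
      using Lp_integrable[OF f(1)] Lp_integrable[OF f(2)] by auto
    have "AE x in M. \<bar>f x\<bar> powr q \<le> e * \<bar>f x\<bar> powr s + C * \<bar>f x\<bar> powr 1" using C(2) by simp
    from Lp_I_bound[OF Lp_measurable[OF f(1)] i this] show ?thesis
      using Lp_integrable[OF f(1)] Lp_integrable[OF f(2)] by (auto simp: pint_def)
  qed
  with that C(1) show thesis by blast
qed

lemma integrable_pflux_mult:
  assumes r: "1 < r" and g: "Lp M r g" and h: "Lp M r h"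
  shows "integrable M (\<lambda>x. pflux r (g x) * h x)"
proof (rule Bochner_Integration.integrable_bound[of _ "\<lambda>x. \<bar>g x\<bar> powr r + \<bar>h x\<bar> powr r"])
  note [measurable] = Lp_measurable[OF g] Lp_measurable[OF h]
  show "(\<lambda>x. pflux r (g x) * h x) \<in> borel_measurable M" by measurable
  have "\<bar>g x\<bar> powr (r - 1) * \<bar>h x\<bar> \<le> \<bar>g x\<bar> powr r + \<bar>h x\<bar> powr r" for x
    using young_eps[of "\<bar>g x\<bar>" "\<bar>h x\<bar>" r 1] r by simp
  then show "AE x in M. norm (pflux r (g x) * h x) \<le> norm (\<bar>g x\<bar> powr r + \<bar>h x\<bar> powr r)"
    by (simp add: abs_mult abs_pflux)
qed (use Lp_integrable[OF g] Lp_integrable[OF h] in auto)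

lemma Lp_max:
  assumes "0 \<le> r" "Lp M r f" "Lp M r g"
  shows "Lp M r (\<lambda>x. max (f x) (g x))"
proof (rule Lp_I_bound(1)[of _ _ "\<lambda>x. \<bar>f x\<bar> powr r + \<bar>g x\<bar> powr r"])
  show "AE x in M. \<bar>max (f x) (g x)\<bar> powr r \<le> \<bar>f x\<bar> powr r + \<bar>g x\<bar> powr r"
    by (auto simp: max_def)
qed (use assms(2,3)[THEN Lp_measurable] assms(2,3)[THEN Lp_integrable] in auto)

lemma integrable_powr_mult:
  assumes r: "1 < r" and g: "Lp M r g" and h: "Lp M r h"
  shows "integrable M (\<lambda>x. g x powr (r - 1) * h x)"
proof (rule Bochner_Integration.integrable_bound[of _ "\<lambda>x. \<bar>g x\<bar> powr r + \<bar>h x\<bar> powr r"])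
  note [measurable] = Lp_measurable[OF g] Lp_measurable[OF h]
  show "(\<lambda>x. g x powr (r - 1) * h x) \<in> borel_measurable M" by measurable
  have "\<bar>g x powr (r - 1)\<bar> * \<bar>h x\<bar> \<le> \<bar>g x\<bar> powr r + \<bar>h x\<bar> powr r" for x
  proof -
    have "g x powr (r - 1) = \<bar>g x\<bar> powr (r - 1)" by (simp add: abs_if uminus_powr_eq)
    then show ?thesis using young_eps[of "\<bar>g x\<bar>" "\<bar>h x\<bar>" r 1] r by simp
  qed
  then show "AE x in M. norm (g x powr (r - 1) * h x) \<le> norm (\<bar>g x\<bar> powr r + \<bar>h x\<bar> powr r)"
    by (simp add: abs_mult)
qed (use Lp_integrable[OF g] Lp_integrable[OF h] in auto)

lemma pint_midpoint_gap:
  assumes r: "1 < r" and f: "Lp M r f" and g: "Lp M r g"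
  shows "integrable M (\<lambda>x. midpoint_gap r (f x) (g x))"
    "(\<integral>x. midpoint_gap r (f x) (g x) \<partial>M) = (pint M r f + pint M r g) / 2 - pint M r (\<lambda>x. 1 / 2 * (f x + g x))"
proof -
  have m: "Lp M r (\<lambda>x. 1 / 2 * (f x + g x))" using r f g by (intro Lp_cmult Lp_add(1)) auto
  have eq: "midpoint_gap r (f x) (g x) = (\<bar>f x\<bar> powr r + \<bar>g x\<bar> powr r) / 2 - \<bar>1 / 2 * (f x + g x)\<bar> powr r" for x
    by (simp add: midpoint_gap_def)
  show "integrable M (\<lambda>x. midpoint_gap r (f x) (g x))"
    unfolding eq by (intro Bochner_Integration.integrable_diff integrable_divide_zero Bochner_Integration.integrable_add Lp_integrable f g m) 
  show "(\<integral>x. midpoint_gap r (f x) (g x) \<partial>M) = (pint M r f + pint M r g) / 2 - pint M r (\<lambda>x. 1 / 2 * (f x + g x))"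
    unfolding eq pint_def
    using Lp_integrable[OF f] Lp_integrable[OF g] Lp_integrable[OF m]
    by (subst Bochner_Integration.integral_diff) auto
qed

text \<open>\<open>hi\<close> is some direction whose exponent exceeds \<open>q\<close>;
  integrability, coercivity and compactness of the lower order term all pass through it. Nothing
  relates \<open>q\<close> to the other exponents, so both cases of the theorem are
  instances.\<close>

locale aniso_problem = aniso_domain \<Omega> p
  for \<Omega> :: "(real^'n::finite) set" and p :: "'n \<Rightarrow> real" +
  fixes q :: real and hi :: 'n
  assumes q: "1 < q" "q < p hi"
begin

lemma q0: "0 \<le> q" "1 \<le> q" "0 < q" using q by auto

definition energy :: "('n \<Rightarrow> real^'n \<Rightarrow> real) \<Rightarrow> real" where
  "energy g = (\<Sum>i\<in>UNIV. pint M (p i) (g i) / p i)"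

text \<open>\<open>c\<close> is the truncation level: the second term has the derivative
  \<open>max (u x) (c x) powr (q - 1)\<close>. With \<open>c = 0\<close> only the positive part of
  \<open>u\<close> contributes.\<close>

definition J :: "real \<Rightarrow> (real^'n \<Rightarrow> real) \<Rightarrow> (real^'n \<Rightarrow> real) \<Rightarrow> ('n \<Rightarrow> real^'n \<Rightarrow> real) \<Rightarrow> real" where
  "J lam c u g = energy g - lam * (\<integral>x. primF q (c x) (u x) \<partial>M)"

lemma energy_nonneg: "0 \<le> energy g"
  unfolding energy_def by (intro sum_nonneg divide_nonneg_nonneg pint_nonneg p0)

lemma pint_le_energy: "pint M (p i) (g i) \<le> p i * energy g"
proof -
  have "pint M (p i) (g i) / p i \<le> energy g"
    unfolding energy_def by (rule member_le_sum) (auto intro!: divide_nonneg_nonneg pint_nonneg p0)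
  then show ?thesis using p0(1)[of i] by (simp add: field_simps)
qed

lemma sob_Lq: "sob u g \<Longrightarrow> Lp M q u"
  using Lp_mono_exponent(1)[OF finite_M sob_Lp[of u g hi], of q] q by simp

lemma integrable_primF:
  assumes u: "Lp M q u" and c: "Lp M q c" "\<And>x. 0 \<le> c x"
  shows "integrable M (\<lambda>x. primF q (c x) (u x))"
proof (rule Bochner_Integration.integrable_bound[of _ "\<lambda>x. (1 + 2 powr q) * \<bar>c x\<bar> powr q + 2 powr q * \<bar>u x\<bar> powr q"])
  note [measurable] = Lp_measurable[OF u] Lp_measurable[OF c(1)]
  show "(\<lambda>x. primF q (c x) (u x)) \<in> borel_measurable M" by measurable
  show "AE x in M. norm (primF q (c x) (u x)) \<le> norm ((1 + 2 powr q) * \<bar>c x\<bar> powr q + 2 powr q * \<bar>u x\<bar> powr q)"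
    using primF_bound[OF q(1) c(2)] by (intro AE_I2) (auto intro: order.trans[OF _ abs_ge_self])
qed (use Lp_integrable[OF u] Lp_integrable[OF c(1)] in auto)

lemma approx_Lq:
  assumes a: "approx \<phi> u g" and s: "sob u g"
  shows "(\<lambda>k. pint M q (\<lambda>x. \<phi> k x - u x)) \<longlonglongrightarrow> 0"
proof -
  obtain C where C: "0 \<le> C" "\<And>f. Lp M (p hi) f \<Longrightarrow> Lp M 1 f \<Longrightarrow> Lp M q f \<and> pint M q f \<le> 1 * pint M (p hi) f + C * pint M 1 f"
    using pint_interpolate[OF q0(2) q(2), of 1] by (metis zero_less_one)
  note \<phi> = approxD(1)[OF a]
  have 1: "pint M q (\<lambda>x. \<phi> k x - u x) \<le> pint M (p hi) (\<lambda>x. \<phi> k x - u x) + C * pint M 1 (\<lambda>x. \<phi> k x - u x)" for k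
    using C(2)[of "\<lambda>x. \<phi> k x - u x"] Lp_diff(1)[OF p0(2) test_Lp(1)[OF \<phi>[of k] p0(1)] sob_Lp[OF s, of hi]]
      Lp_diff(1)[OF zero_le_one test_Lp(1)[OF \<phi>[of k] zero_less_one], of u] sobD(1)[OF s] by (simp add: Lp_1_iff)
  have 2: "(\<lambda>k. pint M (p hi) (\<lambda>x. \<phi> k x - u x) + C * pint M 1 (\<lambda>x. \<phi> k x - u x)) \<longlonglongrightarrow> 0 + C * 0"
    by (intro tendsto_intros approx_Lp(2)[OF a sobD(1)[OF s] sobD(2)[OF s]] approxD(2)[OF a])
  then have 3: "(\<lambda>k. pint M (p hi) (\<lambda>x. \<phi> k x - u x) + C * pint M 1 (\<lambda>x. \<phi> k x - u x)) \<longlonglongrightarrow> 0" by simp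
  show ?thesis
    by (rule tendsto_sandwich[OF _ _ tendsto_const 3]) (use 1 in \<open>simp_all add: pint_nonneg\<close>)
qed

lemma J_tendsto:
  assumes a: "approx \<phi> u g" and s: "sob u g" and c: "Lp M q c" "\<And>x. 0 \<le> c x"
  shows "(\<lambda>k. J lam c (\<phi> k) (\<lambda>i. partial_deriv i (\<phi> k))) \<longlonglongrightarrow> J lam c u g"
proof -
  note \<phi> = approxD(1)[OF a]
  have F: "(\<lambda>k. \<integral>x. primF q (c x) (\<phi> k x) \<partial>M) \<longlonglongrightarrow> (\<integral>x. primF q (c x) (u x) \<partial>M)"
  proof (rule growth_tendsto[of q M \<phi> u c "\<lambda>x. primF q (c x)" 1])
    show "AE x in M. \<forall>a b. \<bar>primF q (c x) a - primF q (c x) b\<bar> \<le> 1 * (\<bar>a\<bar> + \<bar>b\<bar> + \<bar>c x\<bar>) powr (q - 1) * \<bar>a - b\<bar>"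
      using primF_growth[OF q(1) c(2)] by blast
  qed (use q0 \<phi> c sob_Lq[OF s] test_Lp(1)[OF \<phi> q0(3)] approx_Lq[OF a s] integrable_primF in auto)
  have "(\<lambda>k. energy (\<lambda>i. partial_deriv i (\<phi> k))) \<longlonglongrightarrow> energy g"
    unfolding energy_def
    by (intro tendsto_sum tendsto_divide tendsto_const pint_tendsto[OF p test_partial_Lp[OF \<phi> p0(1)] sobD(2)[OF s] approxD(3)[OF a]])
      (use p0(1) in \<open>auto simp: less_imp_neq[THEN not_sym]\<close>)
  then show ?thesis unfolding J_def by (intro tendsto_diff tendsto_mult tendsto_const F)
qed

lemma J_coercive:
  assumes lam: "0 \<le> lam" and c: "Lp M q c" "\<And>x. 0 \<le> c x"
  obtains K where "\<And>\<phi>. \<phi> \<in> T \<Longrightarrow> energy (\<lambda>i. partial_deriv i \<phi>) / 2 - K \<le> J lam c \<phi> (\<lambda>i. partial_deriv i \<phi>)"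
proof -
  \<comment> \<open>After \<open>primF_bound\<close> and the Poincare inequality in direction
    \<open>hi\<close>, this choice lets the lower order term consume at most half of the energy. The
    summand 1 covers \<open>lam = 0\<close>.\<close>
  define e where "e = 1 / (2 * p hi * CP * (lam * 2 powr q + 1))"
  have X: "0 < 2 * p hi * CP * (lam * 2 powr q + 1)"
    using p0(1)[of hi] CP(1) lam by (simp add: add_nonneg_pos)
  have e: "0 < e" using X by (simp add: e_def)
  obtain K where K: "0 \<le> K" "\<And>t. 0 \<le> t \<Longrightarrow> t powr q \<le> e * t powr p hi + K"
    using powr_absorb[OF q0(2) q(2) e] by metis
  define K' where "K' = lam * ((1 + 2 powr q) * pint M q c + 2 powr q * (K * measure M (space M)))"
  have "energy (\<lambda>i. partial_deriv i \<phi>) / 2 - K' \<le> J lam c \<phi> (\<lambda>i. partial_deriv i \<phi>)" if \<phi>: "\<phi> \<in> T" for \<phi>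
  proof -
    have L: "Lp M q \<phi>" "Lp M (p hi) \<phi>" using test_Lp(1)[OF \<phi>] q0 p0(1) by auto
    have "pint M q \<phi> \<le> (\<integral>x. e * \<bar>\<phi> x\<bar> powr p hi + K \<partial>M)"
      by (rule Lp_I_bound(2)) (use L K(2) Lp_integrable[OF L(2)] Lp_measurable[OF L(1)] in auto)
    also have "\<dots> = e * pint M (p hi) \<phi> + K * measure M (space M)"
      using Lp_integrable[OF L(2)] by (simp add: pint_def mult.commute)
    also have "\<dots> \<le> e * (CP * (p hi * energy (\<lambda>i. partial_deriv i \<phi>))) + K * measure M (space M)"
      using order.trans[OF CP(2)[OF \<phi>] mult_left_mono[OF pint_le_energy[of hi "\<lambda>i. partial_deriv i \<phi>"]]] CP(1) e
      by (intro add_right_mono mult_left_mono) auto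
    finally have pq: "pint M q \<phi> \<le> e * (CP * (p hi * energy (\<lambda>i. partial_deriv i \<phi>))) + K * measure M (space M)" .
    have "(\<integral>x. primF q (c x) (\<phi> x) \<partial>M) \<le> (\<integral>x. (1 + 2 powr q) * \<bar>c x\<bar> powr q + 2 powr q * \<bar>\<phi> x\<bar> powr q \<partial>M)"
    proof (rule integral_mono[OF integrable_primF[OF L(1) c]])
      show "primF q (c x) (\<phi> x) \<le> (1 + 2 powr q) * \<bar>c x\<bar> powr q + 2 powr q * \<bar>\<phi> x\<bar> powr q" for x
        using primF_bound[OF q(1) c(2), of x "\<phi> x"] by linarith
    qed (use Lp_integrable[OF L(1)] Lp_integrable[OF c(1)] in auto)
    also have "\<dots> = (1 + 2 powr q) * pint M q c + 2 powr q * pint M q \<phi>"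
      using Lp_integrable[OF L(1)] Lp_integrable[OF c(1)] by (simp add: pint_def)
    also have "\<dots> \<le> (1 + 2 powr q) * pint M q c + 2 powr q * (e * (CP * (p hi * energy (\<lambda>i. partial_deriv i \<phi>))) + K * measure M (space M))"
      using pq by (intro add_left_mono mult_left_mono) auto
    finally have "lam * (\<integral>x. primF q (c x) (\<phi> x) \<partial>M) \<le> lam * ((1 + 2 powr q) * pint M q c + 2 powr q * (e * (CP * (p hi * energy (\<lambda>i. partial_deriv i \<phi>))) + K * measure M (space M)))"
      using lam by (rule mult_left_mono)
    also have "\<dots> = K' + (lam * 2 powr q) * (e * CP * p hi) * energy (\<lambda>i. partial_deriv i \<phi>)"
      by (simp add: K'_def algebra_simps)
    also have "\<dots> \<le> K' + 1 / 2 * energy (\<lambda>i. partial_deriv i \<phi>)"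
    proof (intro add_left_mono mult_right_mono energy_nonneg)
      have "e * CP * p hi = 1 / (2 * (lam * 2 powr q + 1))"
        using p0(1)[of hi] CP(1) by (simp add: e_def)
      then show "lam * 2 powr q * (e * CP * p hi) \<le> 1 / 2"
        using lam by (simp add: divide_le_eq add_nonneg_pos)
    qed
    finally show ?thesis by (simp add: J_def)
  qed
  with that show thesis by blast
qed

end

context aniso_problem
begin

section \<open>Compactness of minimizing sequences\<close>

lemma midpoint_test: "\<phi> \<in> T \<Longrightarrow> \<psi> \<in> T \<Longrightarrow> (\<lambda>x. 1 / 2 * (\<phi> x + \<psi> x)) \<in> T"
  by (rule test_functions_cmult[OF test_functions_add])

lemma partial_deriv_midpoint:
  "\<phi> \<in> T \<Longrightarrow> \<psi> \<in> T \<Longrightarrow>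
    partial_deriv i (\<lambda>x. 1 / 2 * (\<phi> x + \<psi> x)) = (\<lambda>x. 1 / 2 * (partial_deriv i \<phi> x + partial_deriv i \<psi> x))"
  using partial_deriv_test_cmult[OF test_functions_add, of \<phi> \<psi> i "1/2"] by (simp only: partial_deriv_test_add)

text \<open>Uniform convexity makes the gradients of a minimizing sequence converge strongly as
  soon as the functions themselves converge in \<open>L\<^sup>q\<close>.\<close>

lemma minimizing_gap:
  assumes lam: "0 \<le> lam" and c: "Lp M q c" "\<And>x. 0 \<le> c x"
    and m: "\<And>\<phi>. \<phi> \<in> T \<Longrightarrow> m \<le> J lam c \<phi> (\<lambda>i. partial_deriv i \<phi>)"
    and \<phi>: "\<phi> \<in> T" and \<psi>: "\<psi> \<in> T" and e: "0 < e"
  shows "(\<integral>x. midpoint_gap (p i) (partial_deriv i \<phi> x) (partial_deriv i \<psi> x) \<partial>M)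
    \<le> p i * ((J lam c \<phi> (\<lambda>i. partial_deriv i \<phi>) - m) + (J lam c \<psi> (\<lambda>i. partial_deriv i \<psi>) - m)
        + lam * (e * (4 powr q * (2 * (pint M q \<phi> + pint M q \<psi>) + pint M q c))
                 + e powr (1 - q) * pint M q (\<lambda>x. \<phi> x - \<psi> x)))"
proof -
  \<comment> \<open>The midpoint is again a test function, so its energy functional is at least
    \<open>m\<close> as well.\<close>
  define \<mu> where "\<mu> x = 1 / 2 * (\<phi> x + \<psi> x)" for x
  have \<mu>: "\<mu> \<in> T" unfolding \<mu>_def[abs_def] by (rule midpoint_test[OF \<phi> \<psi>])
  have d\<mu>: "partial_deriv i \<mu> = (\<lambda>x. 1 / 2 * (partial_deriv i \<phi> x + partial_deriv i \<psi> x))" for i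
    unfolding \<mu>_def[abs_def] by (rule partial_deriv_midpoint[OF \<phi> \<psi>])
  define G where "G i = (\<integral>x. midpoint_gap (p i) (partial_deriv i \<phi> x) (partial_deriv i \<psi> x) \<partial>M)" for i
  have G0: "0 \<le> G i" for i
    unfolding G_def by (intro Bochner_Integration.integral_nonneg midpoint_gap_nonneg p)
  have G: "G i = (pint M (p i) (partial_deriv i \<phi>) + pint M (p i) (partial_deriv i \<psi>)) / 2 - pint M (p i) (partial_deriv i \<mu>)" for i
    unfolding G_def d\<mu> by (rule pint_midpoint_gap(2)[OF p test_partial_Lp[OF \<phi> p0(1)] test_partial_Lp[OF \<psi> p0(1)]])
  define E where "E f = energy (\<lambda>i. partial_deriv i f)" for f
  define F where "F f = (\<integral>x. primF q (c x) (f x) \<partial>M)" for f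
  have J: "J lam c f (\<lambda>i. partial_deriv i f) = E f - lam * F f" for f by (simp add: J_def E_def F_def)
  have "G i / p i \<le> (\<Sum>i\<in>UNIV. G i / p i)"
    by (rule member_le_sum) (use G0 p0 in \<open>auto intro!: divide_nonneg_nonneg\<close>)
  also have "\<dots> = (\<Sum>i\<in>UNIV. (pint M (p i) (partial_deriv i \<phi>) / p i + pint M (p i) (partial_deriv i \<psi>) / p i) / 2 - pint M (p i) (partial_deriv i \<mu>) / p i)"
    by (intro sum.cong refl) (simp add: G diff_divide_distrib add_divide_distrib)
  also have "\<dots> = (E \<phi> + E \<psi>) / 2 - E \<mu>"
    by (simp add: E_def energy_def sum_subtractf sum.distrib flip: sum_divide_distrib)
  finally have 1: "G i / p i \<le> (E \<phi> + E \<psi>) / 2 - E \<mu>" .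
  have L: "Lp M q \<phi>" "Lp M q \<psi>" "Lp M q \<mu>" using test_Lp(1) \<phi> \<psi> \<mu> q0(3) by auto
  define R where "R = e * (4 powr q * (2 * (pint M q \<phi> + pint M q \<psi>) + pint M q c)) + e powr (1 - q) * pint M q (\<lambda>x. \<phi> x - \<psi> x)"
  have half: "(1/2::real) powr q * (2 powr q * x) = x" for x
    by (simp flip: powr_mult mult.assoc)
  have p\<mu>: "pint M q \<mu> \<le> pint M q \<phi> + pint M q \<psi>"
  proof -
    have "pint M q \<mu> = (1/2) powr q * pint M q (\<lambda>x. \<phi> x + \<psi> x)"
      unfolding \<mu>_def[abs_def] by (subst pint_cmult) simp
    also have "\<dots> \<le> (1/2) powr q * (2 powr q * (pint M q \<phi> + pint M q \<psi>))"
      by (intro mult_left_mono Lp_add(2) q0 L) simp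
    finally show ?thesis by (simp only: half)
  qed
  have FR: "\<bar>F f - F \<mu>\<bar> \<le> R" if f: "Lp M q f" "pint M q f \<le> pint M q \<phi> + pint M q \<psi>"
    and d: "pint M q (\<lambda>x. f x - \<mu> x) \<le> pint M q (\<lambda>x. \<phi> x - \<psi> x)" for f
  proof -
    have "\<bar>F f - F \<mu>\<bar> \<le> 1 * (e * (4 powr q * (pint M q f + pint M q \<mu> + pint M q c)) + e powr (1 - q) * pint M q (\<lambda>x. f x - \<mu> x))"
      unfolding F_def
    proof (rule growth_diff_bound[OF q0(2) f(1) L(3) c(1)])
      show "AE x in M. \<forall>a b. \<bar>primF q (c x) a - primF q (c x) b\<bar> \<le> 1 * (\<bar>a\<bar> + \<bar>b\<bar> + \<bar>c x\<bar>) powr (q - 1) * \<bar>a - b\<bar>"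
        using primF_growth[OF q(1) c(2)] by blast
    qed (use e f L c integrable_primF in auto)
    also have "\<dots> \<le> 1 * R"
      unfolding R_def using f p\<mu> d e by (intro mult_left_mono add_mono mult_left_mono) auto
    finally show ?thesis by simp
  qed
  have dle: "pint M q (\<lambda>x. 1 / 2 * (\<phi> x - \<psi> x)) \<le> pint M q (\<lambda>x. \<phi> x - \<psi> x)"
  proof -
    have "(1/2::real) powr q \<le> 1 powr q" using q0 by (intro powr_mono2) auto
    then show ?thesis unfolding pint_cmult using pint_nonneg[of M q "\<lambda>x. \<phi> x - \<psi> x"] by (simp add: mult_left_le_one_le)
  qed
  have F\<phi>: "\<bar>F \<phi> - F \<mu>\<bar> \<le> R"
  proof (rule FR[OF L(1)])
    have "(\<lambda>x. \<phi> x - \<mu> x) = (\<lambda>x. 1 / 2 * (\<phi> x - \<psi> x))" by (auto simp: \<mu>_def field_simps)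
    then show "pint M q (\<lambda>x. \<phi> x - \<mu> x) \<le> pint M q (\<lambda>x. \<phi> x - \<psi> x)" using dle by simp
  qed (simp add: pint_nonneg)
  have F\<psi>: "\<bar>F \<psi> - F \<mu>\<bar> \<le> R"
  proof (rule FR[OF L(2)])
    have "(\<lambda>x. \<mu> x - \<psi> x) = (\<lambda>x. 1 / 2 * (\<phi> x - \<psi> x))" by (auto simp: \<mu>_def field_simps)
    then show "pint M q (\<lambda>x. \<psi> x - \<mu> x) \<le> pint M q (\<lambda>x. \<phi> x - \<psi> x)"
      using dle pint_commute[of M q \<psi> \<mu>] by simp
  qed (simp add: pint_nonneg)
  have "lam * (F \<phi> - F \<mu>) \<le> lam * R" "lam * (F \<psi> - F \<mu>) \<le> lam * R"
    using F\<phi> F\<psi> lam by (auto intro!: mult_left_mono)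
  then have "lam * F \<phi> - lam * F \<mu> \<le> lam * R" "lam * F \<psi> - lam * F \<mu> \<le> lam * R"
    by (simp_all only: right_diff_distrib)
  \<comment> \<open>The lower bound at \<open>\<mu>\<close> eliminates \<open>E \<mu>\<close>; those
    at \<open>\<phi>\<close> and \<open>\<psi>\<close> make both excesses nonnegative, so the
    factors 1/2 in front of them may be dropped.\<close>
  moreover have "m \<le> E \<mu> - lam * F \<mu>" "m \<le> E \<phi> - lam * F \<phi>" "m \<le> E \<psi> - lam * F \<psi>"
    using m[OF \<mu>] m[OF \<phi>] m[OF \<psi>] by (simp_all add: J)
  ultimately have "(E \<phi> + E \<psi>) / 2 - E \<mu> \<le> ((E \<phi> - lam * F \<phi>) - m) + ((E \<psi> - lam * F \<psi>) - m) + lam * R"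
    unfolding add_divide_distrib by linarith
  then have "G i / p i \<le> ((E \<phi> - lam * F \<phi>) - m) + ((E \<psi> - lam * F \<psi>) - m) + lam * R"
    using 1 by linarith
  then have "G i \<le> p i * (((E \<phi> - lam * F \<phi>) - m) + ((E \<psi> - lam * F \<psi>) - m) + lam * R)"
    using p0(1)[of i] by (simp add: pos_divide_le_eq mult.commute)
  then show ?thesis by (simp only: G_def J R_def)
qed

text \<open>Uniform convexity on bounded sets: \<open>d\<close> depends only on \<open>e\<close>,
  \<open>B\<close> and the direction.\<close>

lemma gap_imp_close:
  assumes e: "0 < e" and B: "0 \<le> B"
  obtains d where "0 < d"
    "\<And>f g. Lp M (p i) f \<Longrightarrow> Lp M (p i) g \<Longrightarrow> pint M (p i) f \<le> B \<Longrightarrow> pint M (p i) g \<le> B \<Longrightarrow>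
      (\<integral>x. midpoint_gap (p i) (f x) (g x) \<partial>M) < d \<Longrightarrow> pint M (p i) (\<lambda>x. f x - g x) < e"
proof -
  \<comment> \<open>The first term of \<open>midpoint_gap_uniform\<close> then stays below e/2; the
    bound on the gap takes care of the other half.\<close>
  define e' where "e' = e / (4 * (B + 1))"
  have e': "0 < e'" using e B by (simp add: e'_def)
  obtain C where C: "0 \<le> C"
    "\<And>a b. \<bar>a - b\<bar> powr p i \<le> e' * (\<bar>a\<bar> powr p i + \<bar>b\<bar> powr p i) + C * midpoint_gap (p i) a b"
    using midpoint_gap_uniform[OF p e'] by metis
  have "pint M (p i) (\<lambda>x. f x - g x) < e"
    if f: "Lp M (p i) f" and g: "Lp M (p i) g" and b: "pint M (p i) f \<le> B" "pint M (p i) g \<le> B"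
      and gap: "(\<integral>x. midpoint_gap (p i) (f x) (g x) \<partial>M) < e / (2 * (C + 1))" for f g
  proof -
    note mg = pint_midpoint_gap(1)[OF p f g]
    note [measurable] = Lp_measurable[OF f] Lp_measurable[OF g]
    have "pint M (p i) (\<lambda>x. f x - g x) \<le> (\<integral>x. e' * (\<bar>f x\<bar> powr p i + \<bar>g x\<bar> powr p i) + C * midpoint_gap (p i) (f x) (g x) \<partial>M)"
      by (rule Lp_I_bound(2)) (use C(2) mg Lp_integrable[OF f] Lp_integrable[OF g] in auto)
    also have "\<dots> = e' * (pint M (p i) f + pint M (p i) g) + C * (\<integral>x. midpoint_gap (p i) (f x) (g x) \<partial>M)"
      using mg Lp_integrable[OF f] Lp_integrable[OF g] by (simp add: pint_def)
    also have "\<dots> \<le> e' * (B + B) + C * (e / (2 * (C + 1)))"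
      using e' b gap C(1) by (intro add_mono mult_left_mono) auto
    also have "\<dots> < e"
    proof -
      have "e' * (B + B) = e / 2 * (B / (B + 1))" using B by (simp add: e'_def field_simps)
      also have "\<dots> < e / 2 * 1" using e B by (intro mult_strict_left_mono) auto
      finally have 1: "e' * (B + B) < e / 2" by simp
      have "C * (e / (2 * (C + 1))) = e / 2 * (C / (C + 1))" using C(1) by (simp add: field_simps)
      also have "\<dots> \<le> e / 2 * 1" using e C(1) by (intro mult_left_mono) auto
      finally have "C * (e / (2 * (C + 1))) \<le> e / 2" by (simp only: mult_1_right)
      with 1 show ?thesis by linarith
    qed
    finally show ?thesis .
  qed
  moreover have "0 < e / (2 * (C + 1))" using e C(1) by simp
  ultimately show thesis using that by blast
qed

text \<open>The infimum is taken over test functions only, where derivatives are classical.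
  Continuity of \<open>J\<close> along approximating sequences extends minimality to the whole
  closure.\<close>

lemma minimizer_exists:
  assumes lam: "0 \<le> lam" and c: "Lp M q c" "\<And>x. 0 \<le> c x"
  obtains u g where "sob u g" "\<forall>v h. sob v h \<longrightarrow> J lam c u g \<le> J lam c v h"
proof -
  define JT where "JT \<phi> = J lam c \<phi> (\<lambda>i. partial_deriv i \<phi>)" for \<phi>
  obtain K where K: "\<And>\<phi>. \<phi> \<in> T \<Longrightarrow> energy (\<lambda>i. partial_deriv i \<phi>) / 2 - K \<le> JT \<phi>"
    unfolding JT_def using J_coercive[OF lam c] by metis
  have bb: "bdd_below (JT ` T)"
  proof (rule bdd_belowI2)
    show "- K \<le> JT \<phi>" if "\<phi> \<in> T" for \<phi> using K[OF that] energy_nonneg[of "\<lambda>i. partial_deriv i \<phi>"] by linarith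
  qed
  define m where "m = (INF \<phi>\<in>T. JT \<phi>)"
  have m: "m \<le> JT \<phi>" if "\<phi> \<in> T" for \<phi> unfolding m_def by (rule cINF_lower[OF bb that])
  have "\<exists>\<phi>\<in>T. JT \<phi> < m + 1 / real (Suc n)" for n
  proof -
    have "(INF \<phi>\<in>T. JT \<phi>) < m + 1 / real (Suc n)" by (simp add: m_def)
    then show ?thesis using test_functions_zero by (subst (asm) cINF_less_iff[OF _ bb]) auto
  qed
  then have "\<exists>\<phi>. \<forall>n. \<phi> n \<in> T \<and> JT (\<phi> n) < m + 1 / real (Suc n)" by (intro choice allI) blast
  then obtain \<phi>0 where \<phi>0: "\<And>n. \<phi>0 n \<in> T" "\<And>n. JT (\<phi>0 n) < m + 1 / real (Suc n)" by blast
  \<comment> \<open>The members of the sequence have \<open>JT\<close> below m + 1, and coercivity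
    turns this into a bound on the energy.\<close>
  define BE where "BE = 2 * (m + 1 + K)"
  have BE: "energy (\<lambda>i. partial_deriv i (\<phi>0 n)) \<le> BE" for n
  proof -
    have "JT (\<phi>0 n) < m + 1" by (rule less_le_trans[OF \<phi>0(2)]) simp
    then show ?thesis using K[OF \<phi>0(1)[of n]] unfolding BE_def distrib_left by linarith
  qed
  have BE0: "0 \<le> BE" using BE[of 0] energy_nonneg order.trans by blast
  define P where "P = (\<Sum>i\<in>UNIV. p i)"
  have P: "p i \<le> P" for i unfolding P_def by (rule member_le_sum) (auto intro: p0)
  have P0: "0 \<le> P" using P[of hi] p0(2)[of hi] by linarith
  define BD where "BD = P * BE"
  have BD0: "0 \<le> BD" using P0 BE0 by (simp add: BD_def)
  have BD: "pint M (p i) (partial_deriv i (\<phi>0 n)) \<le> BD" for i n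
  proof -
    have "pint M (p i) (partial_deriv i (\<phi>0 n)) \<le> p i * energy (\<lambda>i. partial_deriv i (\<phi>0 n))"
      by (rule pint_le_energy)
    also have "\<dots> \<le> P * BE" using P BE P0 p0(2)[of i] by (intro mult_mono energy_nonneg) auto
    finally show ?thesis by (simp add: BD_def)
  qed
  define BF where "BF = CP * BD"
  have BF: "pint M (p hi) (\<phi>0 n) \<le> BF" for n
    using order.trans[OF CP(2)[OF \<phi>0(1)] mult_left_mono[OF BD[of hi n]]] CP(1) by (simp add: BF_def)
  have BF0: "0 \<le> BF" using CP(1) BD0 by (simp add: BF_def)
  define \<mu> where "\<mu> = measure M (space M)"
  have \<mu>: "0 \<le> \<mu>" by (simp add: \<mu>_def)
  \<comment> \<open>The compactness theorem asks for one constant bounding functions and derivatives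
    alike, hence the common sum.\<close>
  have b1: "pint lborel 1 (\<phi>0 n) \<le> \<mu> + BF + BD" for n
    using Lp_mono_exponent(2)[OF finite_M test_Lp(1)[OF \<phi>0(1)[of n] p0(1)], of 1 hi] p0(3)[of hi] BF[of n] BD0
      test_Lp(2)[OF \<phi>0(1)[of n], of 1] by (simp add: \<mu>_def)
  have b2: "pint lborel 1 (partial_deriv i (\<phi>0 n)) \<le> \<mu> + BF + BD" for n i
    using Lp_mono_exponent(2)[OF finite_M test_partial_Lp[OF \<phi>0(1)[of n] p0(1)], of 1 i i] p0(3)[of i] BD[of i n] BF0
      test_Lp(2)[OF test_functions_partial[OF \<phi>0(1)[of n]], of 1 i] by (simp add: \<mu>_def)
  obtain s :: "nat \<Rightarrow> nat" where s: "strict_mono s"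
    "\<And>e. 0 < e \<Longrightarrow> \<exists>N. \<forall>m\<ge>N. \<forall>n\<ge>N. pint lborel 1 (\<lambda>x. \<phi>0 (s m) x - \<phi>0 (s n) x) < e"
  proof (rule test_rellich[of \<Omega> \<phi>0 "\<mu> + BF + BD", OF bdd \<phi>0(1) b1 b2])
    fix s :: "nat \<Rightarrow> nat"
    assume s: "strict_mono s" "\<And>e. 0 < e \<Longrightarrow> \<exists>N. \<forall>m\<ge>N. \<forall>n\<ge>N. pint lborel 1 (\<lambda>x. \<phi>0 (s m) x - \<phi>0 (s n) x) < e"
    show thesis by (rule that[of s, OF s])
  qed
  define \<phi> where "\<phi> n = \<phi>0 (s n)" for n
  have \<phi>: "\<phi> n \<in> T" for n by (simp add: \<phi>_def \<phi>0)
  have C1: "\<exists>N. \<forall>m\<ge>N. \<forall>n\<ge>N. pint M 1 (\<lambda>x. \<phi> m x - \<phi> n x) < e" if "0 < e" for e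
    using s(2)[OF that] test_Lp(2)[OF test_functions_diff[OF \<phi>0(1) \<phi>0(1)], of 1] by (simp add: \<phi>_def)
  have Jlim: "(\<lambda>n. JT (\<phi> n)) \<longlonglongrightarrow> m"
  proof (rule tendsto_sandwich[OF _ _ tendsto_const])
    have "(\<lambda>n. m + 1 / real (Suc n)) \<longlonglongrightarrow> m + 0"
      by (intro tendsto_intros LIMSEQ_Suc[OF lim_1_over_n])
    then show "(\<lambda>n. m + 1 / real (Suc n)) \<longlonglongrightarrow> m" by simp
    have "JT (\<phi> n) \<le> m + 1 / real (Suc n)" for n
    proof -
      have "1 / real (Suc (s n)) \<le> 1 / real (Suc n)" using seq_suble[OF s(1), of n] by (simp add: frac_le)
      then show ?thesis using \<phi>0(2)[of "s n"] unfolding \<phi>_def by linarith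
    qed
    then show "\<forall>\<^sub>F n in sequentially. JT (\<phi> n) \<le> m + 1 / real (Suc n)" by simp
  qed (use m \<phi> in simp)
  have Lphi: "Lp M (p hi) (\<phi> n)" "Lp M 1 (\<phi> n)" for n using test_Lp(1)[OF \<phi>] p0(1) by auto
  have Cq: "\<exists>N. \<forall>m\<ge>N. \<forall>n\<ge>N. pint M q (\<lambda>x. \<phi> m x - \<phi> n x) < e" if e: "0 < e" for e
  proof -
    define Y where "Y = 2 powr p hi * (BF + BF)"
    have Y: "0 \<le> Y" using BF0 by (simp add: Y_def)
    have d: "0 < e / (2 * (Y + 1))" using e Y by simp
    obtain C where C: "0 \<le> C" "\<And>f. Lp M (p hi) f \<Longrightarrow> Lp M 1 f \<Longrightarrow> Lp M q f \<and> pint M q f \<le> e / (2 * (Y + 1)) * pint M (p hi) f + C * pint M 1 f"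
      using pint_interpolate[OF q0(2) q(2) d] by metis
    have "0 < e / (2 * (C + 1))" using e C(1) by simp
    from C1[OF this] obtain N where N: "\<And>m n. m \<ge> N \<Longrightarrow> n \<ge> N \<Longrightarrow> pint M 1 (\<lambda>x. \<phi> m x - \<phi> n x) < e / (2 * (C + 1))" by blast
    have "pint M q (\<lambda>x. \<phi> m x - \<phi> n x) < e" if mn: "m \<ge> N" "n \<ge> N" for m n
    proof -
      have "pint M (p hi) (\<lambda>x. \<phi> m x - \<phi> n x) \<le> 2 powr p hi * (pint M (p hi) (\<phi> m) + pint M (p hi) (\<phi> n))"
        by (rule Lp_diff(2)[OF p0(2) Lphi(1) Lphi(1)])
      also have "\<dots> \<le> Y" unfolding Y_def using BF by (intro mult_left_mono add_mono) (auto simp: \<phi>_def)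
      finally have 1: "pint M (p hi) (\<lambda>x. \<phi> m x - \<phi> n x) \<le> Y" .
      have "pint M q (\<lambda>x. \<phi> m x - \<phi> n x) \<le> e / (2 * (Y + 1)) * pint M (p hi) (\<lambda>x. \<phi> m x - \<phi> n x) + C * pint M 1 (\<lambda>x. \<phi> m x - \<phi> n x)"
        using C(2)[OF Lp_diff(1)[OF p0(2) Lphi(1) Lphi(1)] Lp_diff(1)[OF zero_le_one Lphi(2) Lphi(2)]] by blast
      also have "\<dots> \<le> e / (2 * (Y + 1)) * Y + C * (e / (2 * (C + 1)))"
        using 1 N[OF mn] d C(1) by (intro add_mono mult_left_mono) auto
      also have "\<dots> < e"
      proof -
        have "e / (2 * (Y + 1)) * Y = e / 2 * (Y / (Y + 1))" using Y by (simp add: field_simps)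
        also have "\<dots> < e / 2 * 1" using e Y by (intro mult_strict_left_mono) auto
        finally have 1: "e / (2 * (Y + 1)) * Y < e / 2" by simp
        have "C * (e / (2 * (C + 1))) = e / 2 * (C / (C + 1))" using C(1) by (simp add: field_simps)
        also have "\<dots> \<le> e / 2 * 1" using e C(1) by (intro mult_left_mono) auto
        finally have "C * (e / (2 * (C + 1))) \<le> e / 2" by (simp only: mult_1_right)
        with 1 show ?thesis by linarith
      qed
      finally show ?thesis .
    qed
    then show ?thesis by blast
  qed
  have Cd: "\<exists>N. \<forall>k\<ge>N. \<forall>l\<ge>N. pint M (p i) (\<lambda>x. partial_deriv i (\<phi> k) x - partial_deriv i (\<phi> l) x) < e" if e: "0 < e" for i e
  proof -
    obtain d where d: "0 < d"
      "\<And>f g. Lp M (p i) f \<Longrightarrow> Lp M (p i) g \<Longrightarrow> pint M (p i) f \<le> BD \<Longrightarrow> pint M (p i) g \<le> BD \<Longrightarrow>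
      (\<integral>x. midpoint_gap (p i) (f x) (g x) \<partial>M) < d \<Longrightarrow> pint M (p i) (\<lambda>x. f x - g x) < e"
    proof (rule gap_imp_close[OF e BD0, of i])
      fix d :: real
      assume d: "0 < d" "\<And>f g. Lp M (p i) f \<Longrightarrow> Lp M (p i) g \<Longrightarrow> pint M (p i) f \<le> BD \<Longrightarrow> pint M (p i) g \<le> BD \<Longrightarrow>
      (\<integral>x. midpoint_gap (p i) (f x) (g x) \<partial>M) < d \<Longrightarrow> pint M (p i) (\<lambda>x. f x - g x) < e"
      show thesis by (rule that[of d, OF d])
    qed
    \<comment> \<open>Four contributions of size d' occur: the two excesses over the infimum and the
      two parts of the lower order term.\<close>
    define d' where "d' = d / p i / 4"
    have d': "0 < d'" using d(1) p0(1) by (simp add: d'_def)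
    define Z where "Z = 4 powr q * (2 * ((\<mu> + BF) + (\<mu> + BF)) + pint M q c)"
    have Z: "0 \<le> Z" using \<mu> BF0 by (auto simp: Z_def pint_nonneg)
    \<comment> \<open>The parameter \<open>e1\<close> makes the bounded part small; only then is
      \<open>e2\<close> chosen, since the coefficient of the distance blows up as \<open>e1\<close>
      decreases.\<close>
    define e1 where "e1 = d' / ((lam + 1) * (Z + 1))"
    have lZ: "0 < (lam + 1) * (Z + 1)" using lam Z by simp
    have e1: "0 < e1" using d' lZ by (simp add: e1_def)
    define e2 where "e2 = d' / ((lam + 1) * e1 powr (1 - q))"
    have e2: "0 < e2" using d' lam e1 by (simp add: e2_def)
    obtain N1 where N1: "\<And>k l. k \<ge> N1 \<Longrightarrow> l \<ge> N1 \<Longrightarrow> pint M q (\<lambda>x. \<phi> k x - \<phi> l x) < e2"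
      using Cq[OF e2] by blast
    have "\<forall>\<^sub>F n in sequentially. JT (\<phi> n) < m + d'" using Jlim d' by (intro order_tendstoD(2)) auto
    then obtain N2 where N2: "\<And>n. n \<ge> N2 \<Longrightarrow> JT (\<phi> n) < m + d'" by (auto simp: eventually_sequentially)
    have pq: "pint M q (\<phi> n) \<le> \<mu> + BF" for n
      using Lp_mono_exponent(2)[OF finite_M Lphi(1)[of n], of q] q q0 BF[of "s n"] by (simp add: \<mu>_def \<phi>_def)
    have "pint M (p i) (\<lambda>x. partial_deriv i (\<phi> k) x - partial_deriv i (\<phi> l) x) < e" if kl: "k \<ge> max N1 N2" "l \<ge> max N1 N2" for k l
    proof (rule d(2))
      show "Lp M (p i) (partial_deriv i (\<phi> k))" "Lp M (p i) (partial_deriv i (\<phi> l))"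
        by (intro test_partial_Lp \<phi> p0)+
      show "pint M (p i) (partial_deriv i (\<phi> k)) \<le> BD" "pint M (p i) (partial_deriv i (\<phi> l)) \<le> BD"
        by (simp_all add: \<phi>_def BD)
      have a: "e1 * (4 powr q * (2 * (pint M q (\<phi> k) + pint M q (\<phi> l)) + pint M q c)) \<le> e1 * Z"
        unfolding Z_def using pq e1 by (intro mult_left_mono add_right_mono add_mono) auto
      have b: "e1 powr (1 - q) * pint M q (\<lambda>x. \<phi> k x - \<phi> l x) \<le> e1 powr (1 - q) * e2"
        using N1[of k l] kl by (intro mult_left_mono) auto
      have "lam * (e1 * (4 powr q * (2 * (pint M q (\<phi> k) + pint M q (\<phi> l)) + pint M q c)) + e1 powr (1 - q) * pint M q (\<lambda>x. \<phi> k x - \<phi> l x))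
          \<le> lam * (e1 * Z + e1 powr (1 - q) * e2)"
        by (rule mult_left_mono[OF add_mono[OF a b] lam])
      also have "\<dots> \<le> d' + d'"
      proof -
        have "lam * (e1 * Z) \<le> d'"
        proof -
          have "lam * (e1 * Z) = e1 * (lam * Z)" by simp
          also have "\<dots> \<le> e1 * ((lam + 1) * (Z + 1))" using e1 lam Z by (intro mult_left_mono mult_mono) auto
          also have "\<dots> = d'"
            unfolding e1_def
            by (rule nonzero_eq_divide_eq[THEN iffD1, OF less_imp_neq[OF lZ, THEN not_sym] refl])
          finally show ?thesis .
        qed
        moreover have "lam * (e1 powr (1 - q) * e2) \<le> d'"
        proof -
          have "lam * (e1 powr (1 - q) * e2) \<le> (lam + 1) * (e1 powr (1 - q) * e2)"
            using e2 by (intro mult_right_mono) auto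
          also have "\<dots> = d'" using lam e1 by (simp add: e2_def)
          finally show ?thesis .
        qed
        ultimately show ?thesis by (simp add: distrib_left)
      qed
      finally have c1: "lam * (e1 * (4 powr q * (2 * (pint M q (\<phi> k) + pint M q (\<phi> l)) + pint M q c)) + e1 powr (1 - q) * pint M q (\<lambda>x. \<phi> k x - \<phi> l x)) \<le> d' + d'" .
      have "(\<integral>x. midpoint_gap (p i) (partial_deriv i (\<phi> k) x) (partial_deriv i (\<phi> l) x) \<partial>M)
        \<le> p i * ((JT (\<phi> k) - m) + (JT (\<phi> l) - m)
        + lam * (e1 * (4 powr q * (2 * (pint M q (\<phi> k) + pint M q (\<phi> l)) + pint M q c)) + e1 powr (1 - q) * pint M q (\<lambda>x. \<phi> k x - \<phi> l x)))"
        unfolding JT_def by (rule minimizing_gap[OF lam c _ \<phi> \<phi> e1]) (use m in \<open>simp add: JT_def\<close>)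
      also have "\<dots> < p i * (d' + d' + (d' + d'))"
      proof (rule mult_strict_left_mono[OF _ p0(1)])
        have "JT (\<phi> k) - m < d'" "JT (\<phi> l) - m < d'" using N2[of k] N2[of l] kl by auto
        with c1 show "(JT (\<phi> k) - m) + (JT (\<phi> l) - m)
        + lam * (e1 * (4 powr q * (2 * (pint M q (\<phi> k) + pint M q (\<phi> l)) + pint M q c)) + e1 powr (1 - q) * pint M q (\<lambda>x. \<phi> k x - \<phi> l x)) < d' + d' + (d' + d')"
          by linarith
      qed
      also have "\<dots> = d" using p0(1)[of i] by (simp add: d'_def field_simps)
      finally show "(\<integral>x. midpoint_gap (p i) (partial_deriv i (\<phi> k) x) (partial_deriv i (\<phi> l) x) \<partial>M) < d" .
    qed
    then show ?thesis by blast
  qed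
  obtain u g where ug: "sob u g" "approx \<phi> u g" by (rule test_Cauchy_sob[OF \<phi> Cd])
  have Jm: "J lam c u g = m"
    using LIMSEQ_unique[OF J_tendsto[OF ug(2,1) c] Jlim[unfolded JT_def]] .
  have "J lam c u g \<le> J lam c v h" if vh: "sob v h" for v h
  proof -
    obtain \<psi> where a: "approx \<psi> v h" using vh by (rule sobE)
    have "m \<le> J lam c (\<psi> k) (\<lambda>i. partial_deriv i (\<psi> k))" for k
      using m[OF approxD(1)[OF a]] by (simp add: JT_def)
    then show ?thesis unfolding Jm by (intro LIMSEQ_le_const[OF J_tendsto[OF a vh c]]) blast
  qed
  with ug(1) that show thesis by blast
qed

end

section \<open>Euler--Lagrange equation and comparison\<close>

context aniso_problem
begin

definition flux :: "('n \<Rightarrow> real^'n \<Rightarrow> real) \<Rightarrow> ('n \<Rightarrow> real^'n \<Rightarrow> real) \<Rightarrow> real" where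
  "flux g h = (\<Sum>i\<in>UNIV. \<integral>x. pflux (p i) (g i x) * h i x \<partial>M)"

text \<open>No differentiability of \<open>J\<close> is used. Convexity bounds the increase of the
  energy by the flux at the perturbed point u + t v and bounds the increase of the primitive from
  below by its slope at \<open>u\<close>. After division by t the limit concerns the flux
  alone.\<close>

lemma euler_lagrange_ineq:
  assumes lam: "0 \<le> lam" and c: "Lp M q c" "\<And>x. 0 \<le> c x"
    and u: "sob u g" and min: "\<And>v h. sob v h \<Longrightarrow> J lam c u g \<le> J lam c v h"
    and v: "sob v h"
  shows "lam * (\<integral>x. max (u x) (c x) powr (q - 1) * v x \<partial>M) \<le> flux g h"
proof -
  define t where "t n = 1 / real (Suc n)" for n
  have t: "0 < t n" "t n \<le> 1" for n by (auto simp: t_def)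
  define S where "S = (\<integral>x. max (u x) (c x) powr (q - 1) * v x \<partial>M)"
  have S_int: "integrable M (\<lambda>x. max (u x) (c x) powr (q - 1) * v x)"
    by (rule integrable_powr_mult[OF q(1) Lp_max[OF q0(1) sob_Lq[OF u] c(1)] sob_Lq[OF v]])
  have Lg: "Lp M (p i) (g i)" and Lh: "Lp M (p i) (h i)" for i by (rule sobD(2)[OF u] sobD(2)[OF v])+
  have w: "sob (\<lambda>x. u x + t n * v x) (\<lambda>i x. g i x + t n * h i x)" for n
    by (rule sob_add[OF u sob_cmult[OF v]])
  have step: "lam * S \<le> flux (\<lambda>i x. g i x + t n * h i x) h" for n
  proof -
    have Lw: "Lp M (p i) (\<lambda>x. g i x + t n * h i x)" for i by (rule sobD(2)[OF w])
    have pf: "integrable M (\<lambda>x. pflux (p i) (g i x + t n * h i x) * h i x)" for i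
      by (rule integrable_pflux_mult[OF p Lw Lh])
    have "pint M (p i) (\<lambda>x. g i x + t n * h i x) / p i - pint M (p i) (g i) / p i
        \<le> t n * (\<integral>x. pflux (p i) (g i x + t n * h i x) * h i x \<partial>M)" for i
    proof -
      have "pint M (p i) (\<lambda>x. g i x + t n * h i x) - pint M (p i) (g i)
          = (\<integral>x. \<bar>g i x + t n * h i x\<bar> powr p i - \<bar>g i x\<bar> powr p i \<partial>M)"
        using Lp_integrable[OF Lw, of i] Lp_integrable[OF Lg, of i] by (simp add: pint_def)
      also have "\<dots> \<le> (\<integral>x. (p i * t n) * (pflux (p i) (g i x + t n * h i x) * h i x) \<partial>M)"
      proof (rule integral_mono)
        fix x
        show "\<bar>g i x + t n * h i x\<bar> powr p i - \<bar>g i x\<bar> powr p i \<le> (p i * t n) * (pflux (p i) (g i x + t n * h i x) * h i x)"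
          using abs_powr_tangent[OF p, of "g i x + t n * h i x" i "g i x"] by (simp add: mult_ac)
      qed (use pf Lp_integrable[OF Lw, of i] Lp_integrable[OF Lg, of i] in auto)
      also have "\<dots> = (p i * t n) * (\<integral>x. pflux (p i) (g i x + t n * h i x) * h i x \<partial>M)" by simp
      finally have "pint M (p i) (\<lambda>x. g i x + t n * h i x) - pint M (p i) (g i) \<le> (t n * (\<integral>x. pflux (p i) (g i x + t n * h i x) * h i x \<partial>M)) * p i"
        by (simp only: mult_ac)
      then have "(pint M (p i) (\<lambda>x. g i x + t n * h i x) - pint M (p i) (g i)) / p i \<le> t n * (\<integral>x. pflux (p i) (g i x + t n * h i x) * h i x \<partial>M)"
        using p0(1)[of i] by (simp only: pos_divide_le_eq)
      then show ?thesis by (simp only: diff_divide_distrib)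
    qed
    then have "(\<Sum>i\<in>UNIV. pint M (p i) (\<lambda>x. g i x + t n * h i x) / p i - pint M (p i) (g i) / p i)
        \<le> (\<Sum>i\<in>UNIV. t n * (\<integral>x. pflux (p i) (g i x + t n * h i x) * h i x \<partial>M))"
      by (intro sum_mono)
    then have E: "energy (\<lambda>i x. g i x + t n * h i x) - energy g \<le> t n * flux (\<lambda>i x. g i x + t n * h i x) h"
      by (simp add: energy_def flux_def sum_subtractf sum_distrib_left)
    have "t n * S = (\<integral>x. t n * (max (u x) (c x) powr (q - 1) * v x) \<partial>M)" by (simp add: S_def)
    also have "\<dots> \<le> (\<integral>x. primF q (c x) (u x + t n * v x) - primF q (c x) (u x) \<partial>M)"
    proof (rule integral_mono)
      show "t n * (max (u x) (c x) powr (q - 1) * v x) \<le> primF q (c x) (u x + t n * v x) - primF q (c x) (u x)" for x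
        using primF_tangent[OF q(1) c(2), of x "u x" "u x + t n * v x"] by (simp add: mult_ac)
      show "integrable M (\<lambda>x. primF q (c x) (u x + t n * v x) - primF q (c x) (u x))"
        by (intro Bochner_Integration.integrable_diff integrable_primF c sob_Lq[OF u] sob_Lq[OF w])
    qed (use S_int in auto)
    also have "\<dots> = (\<integral>x. primF q (c x) (u x + t n * v x) \<partial>M) - (\<integral>x. primF q (c x) (u x) \<partial>M)"
      by (intro Bochner_Integration.integral_diff integrable_primF c sob_Lq[OF u] sob_Lq[OF w])
    finally have "lam * (t n * S) \<le> lam * ((\<integral>x. primF q (c x) (u x + t n * v x) \<partial>M) - (\<integral>x. primF q (c x) (u x) \<partial>M))"
      using lam by (rule mult_left_mono)
    also have "\<dots> \<le> energy (\<lambda>i x. g i x + t n * h i x) - energy g"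
      using min[OF w, of n] by (simp add: J_def right_diff_distrib)
    also note E
    finally have "t n * (lam * S) \<le> t n * flux (\<lambda>i x. g i x + t n * h i x) h" by (simp only: mult_ac)
    then show ?thesis using t(1)[of n] by (simp only: mult_le_cancel_left_pos)
  qed
  have "(\<lambda>n. flux (\<lambda>i x. g i x + t n * h i x) h) \<longlonglongrightarrow> flux g h"
    unfolding flux_def
  proof (rule tendsto_sum)
    fix i
    note [measurable] = Lp_measurable[OF Lg, of i] Lp_measurable[OF Lh, of i]
    show "(\<lambda>n. \<integral>x. pflux (p i) (g i x + t n * h i x) * h i x \<partial>M) \<longlonglongrightarrow> (\<integral>x. pflux (p i) (g i x) * h i x \<partial>M)"
    proof (rule integral_dominated_convergence[where w = "\<lambda>x. 2 powr p i * (\<bar>g i x\<bar> powr p i + \<bar>h i x\<bar> powr p i) + \<bar>h i x\<bar> powr p i"])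
      show "AE x in M. (\<lambda>n. pflux (p i) (g i x + t n * h i x) * h i x) \<longlonglongrightarrow> pflux (p i) (g i x) * h i x"
      proof (intro AE_I2 tendsto_mult tendsto_const isCont_tendsto_compose[OF isCont_pflux[OF p]])
        fix x
        have "(\<lambda>n. t n) \<longlonglongrightarrow> 0" unfolding t_def by (rule LIMSEQ_Suc[OF lim_1_over_n])
        then have "(\<lambda>n. g i x + t n * h i x) \<longlonglongrightarrow> g i x + 0 * h i x" by (intro tendsto_intros)
        then show "(\<lambda>n. g i x + t n * h i x) \<longlonglongrightarrow> g i x" by simp
      qed
      show "AE x in M. norm (pflux (p i) (g i x + t n * h i x) * h i x) \<le> 2 powr p i * (\<bar>g i x\<bar> powr p i + \<bar>h i x\<bar> powr p i) + \<bar>h i x\<bar> powr p i" for n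
      proof (rule AE_I2)
        fix x
        have "norm (pflux (p i) (g i x + t n * h i x) * h i x) \<le> \<bar>g i x + t n * h i x\<bar> powr p i + \<bar>h i x\<bar> powr p i"
          using young_eps[of "\<bar>g i x + t n * h i x\<bar>" "\<bar>h i x\<bar>" "p i" 1] p0(3)[of i] by (simp add: abs_mult abs_pflux)
        also have "\<bar>g i x + t n * h i x\<bar> powr p i \<le> 2 powr p i * (\<bar>g i x\<bar> powr p i + \<bar>t n * h i x\<bar> powr p i)"
          by (rule abs_add_powr_le[OF p0(2)])
        also have "\<bar>t n * h i x\<bar> powr p i \<le> \<bar>h i x\<bar> powr p i"
          using t[of n] p0(2)[of i] by (intro powr_mono2) (auto simp: abs_mult mult_left_le_one_le)
        finally show "norm (pflux (p i) (g i x + t n * h i x) * h i x) \<le> 2 powr p i * (\<bar>g i x\<bar> powr p i + \<bar>h i x\<bar> powr p i) + \<bar>h i x\<bar> powr p i"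
          by simp
      qed
    qed (use Lp_integrable[OF Lg, of i] Lp_integrable[OF Lh, of i] in auto)
  qed
  then have "lam * S \<le> flux g h" by (rule LIMSEQ_le_const) (use step in blast)
  then show ?thesis by (simp add: S_def)
qed

lemma euler_lagrange:
  assumes lam: "0 \<le> lam" and c: "Lp M q c" "\<And>x. 0 \<le> c x"
    and u: "sob u g" and min: "\<And>v h. sob v h \<Longrightarrow> J lam c u g \<le> J lam c v h"
    and v: "sob v h"
  shows "flux g h = lam * (\<integral>x. max (u x) (c x) powr (q - 1) * v x \<partial>M)"
proof -
  have "sob (\<lambda>x. -1 * v x) (\<lambda>i x. -1 * h i x)" by (rule sob_cmult[OF v])
  from euler_lagrange_ineq[OF lam c u min this]
  have "lam * (\<integral>x. max (u x) (c x) powr (q - 1) * (-1 * v x) \<partial>M) \<le> flux g (\<lambda>i x. -1 * h i x)" .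
  then have "flux g h \<le> lam * (\<integral>x. max (u x) (c x) powr (q - 1) * v x \<partial>M)"
    by (simp add: flux_def sum_negf)
  with euler_lagrange_ineq[OF lam c u min v] show ?thesis by simp
qed

text \<open>Weak solutions with an explicit gradient. Nontriviality is left out so that 0 counts as
  a solution for the parameter 0, from which the construction can start.\<close>

definition wsol :: "real \<Rightarrow> (real^'n \<Rightarrow> real) \<Rightarrow> ('n \<Rightarrow> real^'n \<Rightarrow> real) \<Rightarrow> bool" where
  "wsol lam u g \<longleftrightarrow> sob u g \<and> (AE x in M. 0 \<le> u x) \<and>
    (\<forall>v h. sob v h \<longrightarrow> flux g h = lam * (\<integral>x. u x powr (q - 1) * v x \<partial>M))"

lemma flux_diff:
  assumes "sob u g" "sob v h" "sob w k"
  shows "flux g k - flux h k = (\<Sum>i\<in>UNIV. \<integral>x. (pflux (p i) (g i x) - pflux (p i) (h i x)) * k i x \<partial>M)"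
  unfolding flux_def sum_subtractf[symmetric]
  using integrable_pflux_mult[OF p sobD(2)[OF assms(1)] sobD(2)[OF assms(3)]]
    integrable_pflux_mult[OF p sobD(2)[OF assms(2)] sobD(2)[OF assms(3)]]
  by (intro sum.cong refl) (simp add: left_diff_distrib)

text \<open>Testing the difference of the two equations with \<open>flat_seq 0 (u0 - u)\<close>, a smooth
  substitute for the positive part of \<open>u0 - u\<close>.\<close>

lemma comparison:
  assumes lam: "0 \<le> lam0" "lam0 \<le> lam" and c: "Lp M q c" "\<And>x. 0 \<le> c x"
    and u: "sob u g" and eq: "\<And>v h. sob v h \<Longrightarrow> flux g h = lam * (\<integral>x. max (u x) (c x) powr (q - 1) * v x \<partial>M)"
    and u0: "sob u0 g0" and eq0: "\<And>v h. sob v h \<Longrightarrow> flux g0 h = lam0 * (\<integral>x. c x powr (q - 1) * v x \<partial>M)"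
  shows "AE x in M. u0 x \<le> u x"
proof -
  have "sob (\<lambda>x. u0 x + -1 * u x) (\<lambda>i x. g0 i x + -1 * g i x)" by (rule sob_add[OF u0 sob_cmult[OF u]])
  then have w: "sob (\<lambda>x. u0 x - u x) (\<lambda>i x. g0 i x - g i x)" by simp
  define v where "v x = flat_seq 0 (u0 x - u x)" for x
  define h where "h i x = flat_seq (Suc 0) (u0 x - u x) * (g0 i x - g i x)" for i x
  have v: "sob v h" unfolding v_def[abs_def] h_def[abs_def] by (rule sob_flat[OF w])
  have v0: "0 \<le> v x" for x by (simp add: v_def flat_seq_0)
  have int1: "integrable M (\<lambda>x. max (u x) (c x) powr (q - 1) * v x)"
    by (rule integrable_powr_mult[OF q(1) Lp_max[OF q0(1) sob_Lq[OF u] c(1)] sob_Lq[OF v]])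
  have int0: "integrable M (\<lambda>x. c x powr (q - 1) * v x)"
    by (rule integrable_powr_mult[OF q(1) c(1) sob_Lq[OF v]])
  \<comment> \<open>Here the truncation acts: its right-hand side dominates c^(q-1) whatever the
    position of \<open>u\<close>.\<close>
  have le: "(\<integral>x. c x powr (q - 1) * v x \<partial>M) \<le> (\<integral>x. max (u x) (c x) powr (q - 1) * v x \<partial>M)"
    by (rule integral_mono[OF int0 int1]) (use c(2) v0 q in \<open>auto intro!: mult_right_mono powr_mono2\<close>)
  have "lam0 * (\<integral>x. c x powr (q - 1) * v x \<partial>M) \<le> lam * (\<integral>x. max (u x) (c x) powr (q - 1) * v x \<partial>M)"
    using lam le v0 by (intro mult_mono) (auto intro!: Bochner_Integration.integral_nonneg)
  then have "flux g0 h - flux g h \<le> 0" using eq[OF v] eq0[OF v] by simp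
  moreover define D where "D i x = (pflux (p i) (g0 i x) - pflux (p i) (g i x)) * h i x" for i x
  have D0: "0 \<le> D i x" for i x
    using pflux_monotone[OF p, of i "g0 i x" "g i x"] flat_seq_1_bounds(1)[of "u0 x - u x"]
      mult_nonneg_nonneg[of "(pflux (p i) (g0 i x) - pflux (p i) (g i x)) * (g0 i x - g i x)" "flat_seq (Suc 0) (u0 x - u x)"]
    by (simp add: D_def h_def mult_ac)
  ultimately have "(\<Sum>i\<in>UNIV. \<integral>x. D i x \<partial>M) \<le> 0"
    using flux_diff[OF u0 u v] by (simp add: D_def)
  then have D1: "(\<integral>x. D i x \<partial>M) = 0" for i
    using sum_nonneg_eq_0_iff[of UNIV "\<lambda>i. \<integral>x. D i x \<partial>M"] sum_nonneg[of UNIV "\<lambda>i. \<integral>x. D i x \<partial>M"] D0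
    by (auto intro!: Bochner_Integration.integral_nonneg simp: order_antisym_conv)
  have Dint: "integrable M (D i)" for i
    unfolding D_def[abs_def] left_diff_distrib
    by (intro Bochner_Integration.integrable_diff integrable_pflux_mult p sobD(2)[OF u] sobD(2)[OF u0] sobD(2)[OF v])
  have "AE x in M. D hi x = 0"
    using integral_nonneg_eq_0_iff_AE[OF Dint[of hi]] D0 D1 by simp
  \<comment> \<open>Where the weight does not vanish, strict monotonicity of the flux makes the two
    partial derivatives equal; in either case the derivative of the test function vanishes.\<close>
  then have "AE x in M. h hi x = 0"
  proof eventually_elim
    case (elim x)
    show ?case
    proof (cases "flat_seq (Suc 0) (u0 x - u x) = 0")
      case False
      then have "(pflux (p hi) (g0 hi x) - pflux (p hi) (g hi x)) * (g0 hi x - g hi x) = 0"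
        using elim by (auto simp: D_def h_def)
      then have "g0 hi x = g hi x" by (rule pflux_monotone_eq_0[OF p])
      then show ?thesis by (simp add: h_def)
    qed (simp add: h_def)
  qed
  then have "pint M (p hi) (h hi) = pint M (p hi) (\<lambda>x. 0)"
    by (intro Lp_cong_AE(2)[OF Lp_zero]) (auto elim!: eventually_mono)
  then have "pint M (p hi) (h hi) = 0" by (simp add: pint_def)
  \<comment> \<open>A vanishing derivative in one direction suffices: by the Poincare inequality
    \<open>v\<close> is 0, that is, u0 - u has no positive values.\<close>
  then have "pint M (p hi) v \<le> 0" using sob_poincare[OF v, of hi] by simp
  then have "AE x in M. v x = 0" by (rule pint_zero_AE[OF sob_Lp[OF v]])
  then show ?thesis
  proof eventually_elim
    case (elim x)
    then show ?case by (auto simp: v_def flat_seq_0 split: if_splits)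
  qed
qed

text \<open>A truncation level must be nonnegative everywhere, whereas a solution is so only almost
  everywhere.\<close>

lemma pos_part_AE:
  assumes "AE x in M. 0 \<le> u x" "Lp M q u"
  shows "Lp M q (\<lambda>x. max 0 (u x))" "AE x in M. u x = max 0 (u x)"
proof -
  show ae: "AE x in M. u x = max 0 (u x)" using assms(1) by eventually_elim simp
  show "Lp M q (\<lambda>x. max 0 (u x))" by (rule Lp_cong_AE(1)[OF assms(2) ae])
qed

lemma integral_powr_cong_AE:
  assumes "AE x in M. f x = g x" "Lp M q f" "Lp M q v"
  shows "(\<integral>x. f x powr (q - 1) * v x \<partial>M) = (\<integral>x. g x powr (q - 1) * v x \<partial>M)"
proof (rule integral_cong_AE)
  note [measurable] = Lp_measurable[OF assms(2)] Lp_measurable[OF assms(3)]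
    Lp_measurable[OF Lp_cong_AE(1)[OF assms(2,1)]]
  show "(\<lambda>x. f x powr (q - 1) * v x) \<in> borel_measurable M" "(\<lambda>x. g x powr (q - 1) * v x) \<in> borel_measurable M"
    by measurable
  show "AE x in M. f x powr (q - 1) * v x = g x powr (q - 1) * v x"
    using assms(1) by eventually_elim simp
qed

text \<open>A solution for \<open>lam0\<close> is a subsolution for every larger parameter. Once the
  minimizer lies above it the truncation is inactive. The minimality in the conclusion serves to
  exclude the trivial solution when \<open>u0\<close> is 0.\<close>

lemma solve_above:
  assumes lam: "0 \<le> lam0" "lam0 \<le> lam" and s: "wsol lam0 u0 g0"
  obtains u g where "wsol lam u g" "AE x in M. u0 x \<le> u x"
    "\<forall>v h. sob v h \<longrightarrow> J lam (\<lambda>x. max 0 (u0 x)) u g \<le> J lam (\<lambda>x. max 0 (u0 x)) v h"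
proof -
  define c where "c x = max 0 (u0 x)" for x
  have u0: "sob u0 g0" "AE x in M. 0 \<le> u0 x"
    "\<And>v h. sob v h \<Longrightarrow> flux g0 h = lam0 * (\<integral>x. u0 x powr (q - 1) * v x \<partial>M)"
    using s by (auto simp: wsol_def)
  have c: "Lp M q c" "\<And>x. 0 \<le> c x" and ae: "AE x in M. u0 x = c x"
    using pos_part_AE[OF u0(2) sob_Lq[OF u0(1)]] by (auto simp: c_def[abs_def])
  have eq0: "flux g0 h = lam0 * (\<integral>x. c x powr (q - 1) * v x \<partial>M)" if v: "sob v h" for v h
    using u0(3)[OF v] integral_powr_cong_AE[OF ae sob_Lq[OF u0(1)] sob_Lq[OF v]] by simp
  have lam1: "0 \<le> lam" using lam by simp
  obtain u g where u: "sob u g" and min': "\<forall>v h. sob v h \<longrightarrow> J lam c u g \<le> J lam c v h"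
    by (rule minimizer_exists[OF lam1 c])
  then have min: "J lam c u g \<le> J lam c v h" if "sob v h" for v h using that by blast
  have eq: "flux g h = lam * (\<integral>x. max (u x) (c x) powr (q - 1) * v x \<partial>M)" if "sob v h" for v h
    by (rule euler_lagrange[OF lam1 c u min that])
  have le: "AE x in M. u0 x \<le> u x" by (rule comparison[OF lam c u eq u0(1) eq0])
  have nn: "AE x in M. 0 \<le> u x" using le u0(2) by eventually_elim simp
  have mx: "AE x in M. u x = max (u x) (c x)" using le ae by eventually_elim simp
  have "flux g h = lam * (\<integral>x. u x powr (q - 1) * v x \<partial>M)" if v: "sob v h" for v h
    using eq[OF v] integral_powr_cong_AE[OF mx sob_Lq[OF u] sob_Lq[OF v]] by simp
  then have "wsol lam u g" using u nn by (auto simp: wsol_def)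
  then show thesis using le min' unfolding c_def[abs_def] by (rule that)
qed

lemma wsol_zero: "wsol 0 (\<lambda>x. 0) (\<lambda>i x. 0)"
  using sob_test[OF test_functions_zero] by (simp add: wsol_def flux_def pflux_def)

section \<open>The energy identity and necessary conditions on the parameter\<close>

lemma wsol_energy:
  assumes s: "wsol lam u g"
  shows "(\<Sum>i\<in>UNIV. pint M (p i) (g i)) = lam * pint M q u"
proof -
  have u: "sob u g" and nn: "AE x in M. 0 \<le> u x" using s by (auto simp: wsol_def)
  have "flux g g = lam * (\<integral>x. u x powr (q - 1) * u x \<partial>M)" using s u by (simp add: wsol_def)
  moreover have "flux g g = (\<Sum>i\<in>UNIV. pint M (p i) (g i))" by (simp add: flux_def pflux_self pint_def)
  moreover have "(\<integral>x. u x powr (q - 1) * u x \<partial>M) = pint M q u"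
    unfolding pint_def
  proof (rule integral_cong_AE)
    note [measurable] = Lp_measurable[OF sob_Lq[OF u]]
    show "(\<lambda>x. u x powr (q - 1) * u x) \<in> borel_measurable M" "(\<lambda>x. \<bar>u x\<bar> powr q) \<in> borel_measurable M"
      by measurable
    show "AE x in M. u x powr (q - 1) * u x = \<bar>u x\<bar> powr q"
      using nn by eventually_elim (simp add: powr_minus_1_mult)
  qed
  ultimately show ?thesis by simp
qed

lemma wsol_trivial:
  assumes s: "wsol lam u g" and lam: "lam \<le> 0"
  shows "AE x in M. u x = 0"
proof -
  have u: "sob u g" using s by (auto simp: wsol_def)
  have "pint M (p hi) (g hi) \<le> (\<Sum>i\<in>UNIV. pint M (p i) (g i))"
    by (rule member_le_sum) (auto simp: pint_nonneg)
  also have "\<dots> = lam * pint M q u" by (rule wsol_energy[OF s])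
  also have "\<dots> \<le> 0" using lam by (simp add: mult_nonpos_nonneg pint_nonneg)
  finally have "pint M (p hi) u \<le> 0"
    using sob_poincare[OF u, of hi] CP(1) by (meson mult_nonneg_nonpos order_trans less_imp_le)
  then show ?thesis by (rule pint_zero_AE[OF sob_Lp[OF u]])
qed

lemma wsol_lower_bound:
  assumes s: "wsol lam u g" and nt: "\<not> (AE x in M. u x = 0)" and lo: "p lo \<le> q"
  shows "1 / (2 * CP) \<le> lam"
proof -
  have u: "sob u g" using s by (auto simp: wsol_def)
  define Z where "Z = (\<Sum>i\<in>UNIV. pint M (p i) (g i))"
  have gZ: "pint M (p i) (g i) \<le> Z" for i
    unfolding Z_def by (rule member_le_sum) (auto simp: pint_nonneg)
  have uZ: "pint M (p i) u \<le> CP * Z" for i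
    using sob_poincare[OF u, of i] mult_left_mono[OF gZ[of i], of CP] CP(1) by linarith
  have pw: "\<bar>y\<bar> powr q \<le> \<bar>y\<bar> powr p lo + \<bar>y\<bar> powr p hi" for y :: real
  proof (cases "\<bar>y\<bar> \<le> 1")
    case True
    have "\<bar>y\<bar> powr q \<le> \<bar>y\<bar> powr p lo" using True lo q by (cases "y = 0") (auto intro!: powr_mono')
    then show ?thesis by (simp add: add_increasing2)
  next
    case False
    then have "\<bar>y\<bar> powr q \<le> \<bar>y\<bar> powr p hi" using q by (intro powr_mono) auto
    then show ?thesis by (simp add: add_increasing)
  qed
  have "pint M q u \<le> (\<integral>x. \<bar>u x\<bar> powr p lo + \<bar>u x\<bar> powr p hi \<partial>M)"
    by (rule Lp_I_bound(2))
      (use pw Lp_integrable[OF sob_Lp[OF u]] Lp_measurable[OF sob_Lq[OF u]] in auto)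
  also have "\<dots> = pint M (p lo) u + pint M (p hi) u"
    using Lp_integrable[OF sob_Lp[OF u]] by (simp add: pint_def)
  \<comment> \<open>One application of the Poincare inequality for each of the two exponents; this
    is the origin of the bound \<open>1 / (2 * CP)\<close>.\<close>
  also have "\<dots> \<le> 2 * CP * Z" using uZ[of lo] uZ[of hi] by simp
  finally have qu: "pint M q u \<le> 2 * CP * Z" .
  have qpos: "0 < pint M q u"
    using pint_zero_AE[OF sob_Lq[OF u]] nt pint_nonneg[of M q u] by force
  have lam: "0 < lam" using wsol_trivial[OF s] nt by force
  have "pint M q u \<le> 2 * CP * (lam * pint M q u)"
    using qu wsol_energy[OF s] by (simp add: Z_def)
  then have "1 * pint M q u \<le> (2 * CP * lam) * pint M q u" by (simp only: mult_1 mult_ac)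
  then have "1 \<le> 2 * CP * lam" using qpos by (simp only: mult_le_cancel_right_pos)
  then show ?thesis using CP(1) by (simp add: divide_le_eq mult_ac)
qed

text \<open>The construction starts from the zero solution, so the truncation level is 0. A function
  vanishing almost everywhere has \<open>J\<close> equal to its energy, hence nonnegative, and
  cannot be a minimizer if some test function has negative \<open>J\<close>.\<close>

lemma wsol_nontrivial:
  assumes lam: "0 \<le> lam" and neg: "\<phi> \<in> T" "J lam (\<lambda>x. 0) \<phi> (\<lambda>i. partial_deriv i \<phi>) < 0"
  obtains u g where "wsol lam u g" "\<not> (AE x in M. u x = 0)"
proof -
  obtain u g where u: "wsol lam u g"
    "\<forall>v h. sob v h \<longrightarrow> J lam (\<lambda>x. max 0 0) u g \<le> J lam (\<lambda>x. max 0 0) v h"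
    by (rule solve_above[OF order.refl lam wsol_zero])
  have "J lam (\<lambda>x. 0) u g < 0" using u(2)[rule_format, OF sob_test[OF neg(1)]] neg(2) by simp
  moreover have "0 \<le> J lam (\<lambda>x. 0) u g" if ae: "AE x in M. u x = 0"
  proof -
    have su: "sob u g" using u(1) by (simp add: wsol_def)
    note [measurable] = Lp_measurable[OF sob_Lq[OF su]]
    have "(\<integral>x. primF q 0 (u x) \<partial>M) = (\<integral>x. 0 \<partial>M)"
    proof (rule integral_cong_AE)
      show "AE x in M. primF q 0 (u x) = 0" using ae by eventually_elim (simp add: primF_def)
    qed auto
    then show ?thesis by (simp add: J_def energy_nonneg)
  qed
  ultimately show thesis using that[OF u(1)] by force
qed

lemma positive_test_function:
  obtains \<phi> where "\<phi> \<in> T" "\<forall>x. 0 \<le> \<phi> x" "0 < pint M q \<phi>"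
proof -
  obtain x where x: "x \<in> \<Omega>" using ne by blast
  obtain a b where ab: "cbox a b \<subseteq> \<Omega>" "x \<in> box a b" by (rule open_contains_cbox[OF op x])
  let ?\<phi> = "box_bump a b"
  have \<phi>: "?\<phi> \<in> T" by (rule box_bump_test[OF ab(1)])
  have "pint M q ?\<phi> \<noteq> 0"
  proof
    assume "pint M q ?\<phi> = 0"
    then have "AE x in M. ?\<phi> x = 0" by (intro pint_zero_AE[of M q ?\<phi>] test_Lp(1)[OF \<phi> q0(3)]) simp_all
    then have "AE x in M. x \<notin> box a b"
      by eventually_elim (simp add: box_bump_pos_iff[symmetric])
    then have "AE x in lebesgue. x \<notin> box a b"
      using ab(1) box_subset_cbox[of a b] by (auto simp: AE_restrict_space_iff elim!: eventually_mono)
    then have "negligible (box a b)" by (simp add: negligible_iff_null_sets AE_iff_null_sets borel_open)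
    then show False using ab(2) open_not_negligible[of "box a b"] by auto
  qed
  then have "0 < pint M q ?\<phi>" using pint_nonneg[of M q ?\<phi>] by simp
  moreover have "\<forall>x. 0 \<le> ?\<phi> x" by (simp add: box_bump_nonneg)
  ultimately show thesis using that[OF \<phi>] by blast
qed

lemma J_scaled_test:
  assumes \<phi>: "\<phi> \<in> T" "\<forall>x. 0 \<le> \<phi> x" and t: "0 < t"
  shows "J lam (\<lambda>x. 0) (\<lambda>x. t * \<phi> x) (\<lambda>i. partial_deriv i (\<lambda>x. t * \<phi> x))
    = (\<Sum>i\<in>UNIV. t powr p i * (pint M (p i) (partial_deriv i \<phi>) / p i)) - lam * (t powr q * (pint M q \<phi> / q))"
proof -
  have "primF q 0 (t * \<phi> x) = t powr q * (\<bar>\<phi> x\<bar> powr q / q)" for x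
    using \<phi>(2)[rule_format, of x] t by (auto simp: primF_def powr_mult mult_le_0_iff)
  then show ?thesis
    using t by (simp add: J_def energy_def partial_deriv_test_cmult[OF \<phi>(1)] pint_cmult) (simp add: pint_def)
qed

text \<open>Integrability in the weak formulation is automatic, and the flux is insensitive to the
  representative of the gradient, so \<open>weak_partial\<close> may be exchanged for any gradient
  from \<open>sob\<close>.\<close>

lemma positive_solution_iff:
  "positive_solution \<Omega> p q lam u \<longleftrightarrow> (\<exists>g. wsol lam u g) \<and> \<not> (AE x in M. u x = 0)"
proof -
  have key: "has_bochner_integral M
        (\<lambda>x. (\<Sum>i\<in>UNIV. \<bar>weak_partial \<Omega> i u x\<bar> powr (p i - 2) * weak_partial \<Omega> i u x * weak_partial \<Omega> i v x)
             - lam * u x powr (q - 1) * v x) 0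
      \<longleftrightarrow> flux (\<lambda>i. weak_partial \<Omega> i u) (\<lambda>i. weak_partial \<Omega> i v) = lam * (\<integral>x. u x powr (q - 1) * v x \<partial>M)"
    if u: "sob u (\<lambda>i. weak_partial \<Omega> i u)" and v: "sob v (\<lambda>i. weak_partial \<Omega> i v)" for v
  proof -
    have i1: "integrable M (\<lambda>x. pflux (p i) (weak_partial \<Omega> i u x) * weak_partial \<Omega> i v x)" for i
      by (rule integrable_pflux_mult[OF p sobD(2)[OF u] sobD(2)[OF v]])
    have i2: "integrable M (\<lambda>x. lam * (u x powr (q - 1) * v x))"
      using integrable_powr_mult[OF q(1) sob_Lq[OF u] sob_Lq[OF v]] by simp
    have "(\<lambda>x. (\<Sum>i\<in>UNIV. \<bar>weak_partial \<Omega> i u x\<bar> powr (p i - 2) * weak_partial \<Omega> i u x * weak_partial \<Omega> i v x)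
             - lam * u x powr (q - 1) * v x)
       = (\<lambda>x. (\<Sum>i\<in>UNIV. pflux (p i) (weak_partial \<Omega> i u x) * weak_partial \<Omega> i v x) - lam * (u x powr (q - 1) * v x))"
      by (simp add: pflux_def mult.assoc)
    moreover have "integrable M (\<lambda>x. (\<Sum>i\<in>UNIV. pflux (p i) (weak_partial \<Omega> i u x) * weak_partial \<Omega> i v x) - lam * (u x powr (q - 1) * v x))"
      by (intro Bochner_Integration.integrable_diff Bochner_Integration.integrable_sum i1 i2)
    moreover have "(\<integral>x. (\<Sum>i\<in>UNIV. pflux (p i) (weak_partial \<Omega> i u x) * weak_partial \<Omega> i v x) - lam * (u x powr (q - 1) * v x) \<partial>M)
        = flux (\<lambda>i. weak_partial \<Omega> i u) (\<lambda>i. weak_partial \<Omega> i v) - lam * (\<integral>x. u x powr (q - 1) * v x \<partial>M)"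
      using i1 i2 by (simp add: flux_def Bochner_Integration.integral_diff Bochner_Integration.integral_sum Bochner_Integration.integrable_sum)
    ultimately show ?thesis by (simp add: has_bochner_integral_iff)
  qed
  have flux_cong: "flux g h = flux g' h'"
    if "sob u g" "sob v h" "\<And>i. AE x in M. g' i x = g i x" "\<And>i. AE x in M. h' i x = h i x" for u v g h g' h'
    unfolding flux_def
  proof (intro sum.cong refl integral_cong_AE)
    fix i
    have ae: "AE x in M. g i x = g' i x" using that(3)[of i] by eventually_elim simp
    have ae': "AE x in M. h i x = h' i x" using that(4)[of i] by eventually_elim simp
    note [measurable] = Lp_measurable[OF sobD(2)[OF that(1), of i]] Lp_measurable[OF sobD(2)[OF that(2), of i]]
      measurable_AE_M[OF Lp_measurable[OF sobD(2)[OF that(1), of i]] ae]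
      measurable_AE_M[OF Lp_measurable[OF sobD(2)[OF that(2), of i]] ae']
    show "(\<lambda>x. pflux (p i) (g i x) * h i x) \<in> borel_measurable M" "(\<lambda>x. pflux (p i) (g' i x) * h' i x) \<in> borel_measurable M"
      by measurable
    show "AE x in M. pflux (p i) (g i x) * h i x = pflux (p i) (g' i x) * h' i x"
      using that(3)[of i] that(4)[of i] by eventually_elim simp
  qed
  show ?thesis
  proof
    assume pos: "positive_solution \<Omega> p q lam u"
    then have w: "weak_solution \<Omega> p q lam u" and nn: "AE x in M. 0 \<le> u x" and nt: "\<not> (AE x in M. u x = 0)"
      by (auto simp: positive_solution_def)
    have u: "sob u (\<lambda>i. weak_partial \<Omega> i u)" using w by (auto simp: weak_solution_def intro: W10_imp_sob)
    have "flux (\<lambda>i. weak_partial \<Omega> i u) h = lam * (\<integral>x. u x powr (q - 1) * v x \<partial>M)" if v: "sob v h" for v h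
    proof -
      have v10: "v \<in> aniso_W10 \<Omega> p" by (rule sob_imp_W10[OF v])
      then have "flux (\<lambda>i. weak_partial \<Omega> i u) (\<lambda>i. weak_partial \<Omega> i v) = lam * (\<integral>x. u x powr (q - 1) * v x \<partial>M)"
        using w key[OF u W10_imp_sob[OF v10]] by (simp add: weak_solution_def)
      moreover have "flux (\<lambda>i. weak_partial \<Omega> i u) h = flux (\<lambda>i. weak_partial \<Omega> i u) (\<lambda>i. weak_partial \<Omega> i v)"
        by (rule flux_cong[OF u v]) (use sob_weak_partial[OF v] in auto)
      ultimately show ?thesis by simp
    qed
    then have "wsol lam u (\<lambda>i. weak_partial \<Omega> i u)" using u nn by (simp add: wsol_def)
    then show "(\<exists>g. wsol lam u g) \<and> \<not> (AE x in M. u x = 0)" using nt by blast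
  next
    assume "(\<exists>g. wsol lam u g) \<and> \<not> (AE x in M. u x = 0)"
    then obtain g where s: "wsol lam u g" and nt: "\<not> (AE x in M. u x = 0)" by blast
    then have u: "sob u g" and nn: "AE x in M. 0 \<le> u x"
      and eq: "\<And>v h. sob v h \<Longrightarrow> flux g h = lam * (\<integral>x. u x powr (q - 1) * v x \<partial>M)" by (auto simp: wsol_def)
    have u10: "u \<in> aniso_W10 \<Omega> p" by (rule sob_imp_W10[OF u])
    have "weak_solution \<Omega> p q lam u"
      unfolding weak_solution_def
    proof (intro conjI u10 ballI)
      fix v assume "v \<in> aniso_W10 \<Omega> p"
      then have v: "sob v (\<lambda>i. weak_partial \<Omega> i v)" by (rule W10_imp_sob)
      have "flux g (\<lambda>i. weak_partial \<Omega> i v) = flux (\<lambda>i. weak_partial \<Omega> i u) (\<lambda>i. weak_partial \<Omega> i v)"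
        by (rule flux_cong[OF u v]) (use sob_weak_partial[OF u] in auto)
      with eq[OF v] show "has_bochner_integral M
        (\<lambda>x. (\<Sum>i\<in>UNIV. \<bar>weak_partial \<Omega> i u x\<bar> powr (p i - 2) * weak_partial \<Omega> i u x * weak_partial \<Omega> i v x)
             - lam * u x powr (q - 1) * v x) 0"
        unfolding key[OF W10_imp_sob[OF u10] v] by simp
    qed
    then show "positive_solution \<Omega> p q lam u" using nn nt by (simp add: positive_solution_def)
  qed
qed

section \<open>The set of admissible parameters\<close>

lemma sublinear_existence:
  assumes sub: "\<And>i. q < p i" and lam: "0 < lam"
  shows "\<exists>u. positive_solution \<Omega> p q lam u"
proof -
  obtain \<phi> where \<phi>: "\<phi> \<in> T" "\<forall>x. 0 \<le> \<phi> x" "0 < pint M q \<phi>" by (rule positive_test_function)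
  define a where "a i = pint M (p i) (partial_deriv i \<phi>) / p i" for i
  define b where "b = lam * (pint M q \<phi> / q)"
  have b: "0 < b" using lam \<phi>(3) q0 by (simp add: b_def)
  \<comment> \<open>After t^q is factored out of \<open>J\<close> at t phi, the energy retains only
    positive powers of t, so a small multiple of phi has negative \<open>J\<close> whatever the size
    of \<open>lam\<close>.\<close>
  have "((\<lambda>t. \<Sum>i\<in>UNIV. t powr (p i - q) * a i) \<longlongrightarrow> (\<Sum>i\<in>(UNIV::'n set). 0 powr (p i - q) * a i)) (at_right 0)"
    using sub by (intro tendsto_sum tendsto_mult tendsto_const tendsto_powr' tendsto_ident_at)
      (auto simp: eventually_at_filter)
  then have "((\<lambda>t. \<Sum>i\<in>UNIV. t powr (p i - q) * a i) \<longlongrightarrow> 0) (at_right 0)" by simp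
  then have "\<forall>\<^sub>F t in at_right 0. (\<Sum>i\<in>UNIV. t powr (p i - q) * a i) < b" using b by (rule order_tendstoD)
  then have "\<forall>\<^sub>F t in at_right 0. (\<Sum>i\<in>UNIV. t powr (p i - q) * a i) < b \<and> 0 < t"
    by (intro eventually_conj eventually_at_right_less)
  then obtain t where t: "(\<Sum>i\<in>UNIV. t powr (p i - q) * a i) < b" "0 < t"
    using eventually_happens'[OF trivial_limit_at_right_real[of 0]] by blast
  have "t powr q * (\<Sum>i\<in>UNIV. t powr (p i - q) * a i) < t powr q * b"
    using t by (intro mult_strict_left_mono) auto
  also have "t powr q * (\<Sum>i\<in>UNIV. t powr (p i - q) * a i) = (\<Sum>i\<in>UNIV. t powr p i * a i)"
    using t(2) unfolding sum_distrib_left by (intro sum.cong refl) (simp flip: powr_add mult.assoc)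
  finally have "J lam (\<lambda>x. 0) (\<lambda>x. t * \<phi> x) (\<lambda>i. partial_deriv i (\<lambda>x. t * \<phi> x)) < 0"
    unfolding J_scaled_test[OF \<phi>(1,2) t(2)] by (simp add: a_def b_def mult_ac)
  from wsol_nontrivial[OF less_imp_le[OF lam] test_functions_cmult[OF \<phi>(1)] this] show ?thesis
    using positive_solution_iff by metis
qed

lemma large_parameter_existence: "\<exists>lam u. positive_solution \<Omega> p q lam u"
proof -
  obtain \<phi> where \<phi>: "\<phi> \<in> T" "\<forall>x. 0 \<le> \<phi> x" "0 < pint M q \<phi>" by (rule positive_test_function)
  define A where "A = (\<Sum>i\<in>UNIV. 1 powr p i * (pint M (p i) (partial_deriv i \<phi>) / p i))"
  have A: "0 \<le> A" unfolding A_def by (intro sum_nonneg mult_nonneg_nonneg divide_nonneg_nonneg pint_nonneg p0) auto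
  \<comment> \<open>The parameter for which \<open>J\<close> at the test function itself equals
    -1.\<close>
  define lam where "lam = (A + 1) / (pint M q \<phi> / q)"
  have lam: "0 \<le> lam" using A \<phi>(3) q0 by (simp add: lam_def)
  have "lam * (1 powr q * (pint M q \<phi> / q)) = A + 1" using \<phi>(3) q0 by (simp add: lam_def)
  then have "J lam (\<lambda>x. 0) (\<lambda>x. 1 * \<phi> x) (\<lambda>i. partial_deriv i (\<lambda>x. 1 * \<phi> x)) < 0"
    unfolding J_scaled_test[OF \<phi>(1,2) zero_less_one] by (simp only: A_def)
  from wsol_nontrivial[OF lam test_functions_cmult[OF \<phi>(1)] this] show ?thesis
    using positive_solution_iff by metis
qed

lemma nonpositive_parameter: "lam \<le> 0 \<Longrightarrow> \<not> positive_solution \<Omega> p q lam u"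
  using wsol_trivial positive_solution_iff by metis

lemma larger_parameter_existence:
  assumes pos: "positive_solution \<Omega> p q lam0 u0" and lam: "lam0 \<le> lam"
  shows "\<exists>u. positive_solution \<Omega> p q lam u"
proof -
  obtain g0 where s: "wsol lam0 u0 g0" and nt: "\<not> (AE x in M. u0 x = 0)"
    using pos positive_solution_iff by blast
  have "0 \<le> lam0" using nonpositive_parameter[of lam0 u0] pos by force
  then obtain u g where u: "wsol lam u g" "AE x in M. u0 x \<le> u x"
    using solve_above[OF _ lam s] by metis
  have "\<not> (AE x in M. u x = 0)"
  proof
    assume "AE x in M. u x = 0"
    moreover have "AE x in M. 0 \<le> u0 x" using s by (simp add: wsol_def)
    ultimately have "AE x in M. u0 x = 0" using u(2) by eventually_elim simp
    then show False using nt by blast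
  qed
  then show ?thesis using u(1) positive_solution_iff by blast
qed

lemma parameter_lower_bound:
  assumes "p lo \<le> q" "positive_solution \<Omega> p q lam u"
  shows "1 / (2 * CP) \<le> lam"
  using wsol_lower_bound assms positive_solution_iff by blast

lemma threshold:
  assumes lo: "p lo \<le> q"
  shows "\<exists>\<Lambda>>0. (\<forall>lam<\<Lambda>. \<not> (\<exists>u. positive_solution \<Omega> p q lam u)) \<and>
    (\<forall>lam>\<Lambda>. \<exists>u. positive_solution \<Omega> p q lam u)"
proof -
  define S where "S = {lam. \<exists>u. positive_solution \<Omega> p q lam u}"
  have ne: "S \<noteq> {}" using large_parameter_existence by (auto simp: S_def)
  have lb: "1 / (2 * CP) \<le> lam" if "lam \<in> S" for lam
    using that parameter_lower_bound[OF lo] by (auto simp: S_def)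
  then have bdd: "bdd_below S" by (intro bdd_belowI)
  have "1 / (2 * CP) \<le> Inf S" using ne lb by (rule cInf_greatest)
  moreover have "0 < 1 / (2 * CP)" using CP(1) by simp
  ultimately have 0: "0 < Inf S" by linarith
  have 1: "lam \<notin> S" if "lam < Inf S" for lam
    using cInf_lower[OF _ bdd, of lam] that by auto
  have 2: "lam \<in> S" if "lam > Inf S" for lam
  proof -
    obtain lam0 where "lam0 \<in> S" "lam0 < lam" using cInf_lessD[OF ne \<open>Inf S < lam\<close>] by blast
    then show ?thesis using larger_parameter_existence[of lam0 _ lam] by (auto simp: S_def)
  qed
  show ?thesis
  proof (rule exI[of _ "Inf S"], intro conjI allI impI)
    show "0 < Inf S" by (rule 0)
    show "\<not> (\<exists>u. positive_solution \<Omega> p q lam u)" if "lam < Inf S" for lam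
      using 1[OF that] unfolding S_def mem_Collect_eq .
    show "\<exists>u. positive_solution \<Omega> p q lam u" if "lam > Inf S" for lam
      using 2[OF that] unfolding S_def mem_Collect_eq .
  qed
qed

end

theorem theorem1p1:
  fixes \<Omega> :: "(real ^ 'n::{finite,linorder}) set"
    and p :: "'n \<Rightarrow> real"
    and q :: real
  assumes "bounded \<Omega>" and "regular_domain \<Omega>"
    and "\<And>i. 1 < p i" and "strict_mono p"
    and "1 < q"
  shows "(q < p (Min UNIV) \<longrightarrow>
            (\<forall>lam::real. (\<exists>u. positive_solution \<Omega> p q lam u) \<longleftrightarrow> lam > 0))
       \<and> (p (Min UNIV) \<le> q \<and> q < p (Max UNIV) \<longrightarrow>
            (\<exists>\<Lambda>::real. \<Lambda> > 0 \<and>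
               (\<forall>lam<\<Lambda>. \<not> (\<exists>u. positive_solution \<Omega> p q lam u)) \<and>
               (\<forall>lam>\<Lambda>. \<exists>u. positive_solution \<Omega> p q lam u)))"
proof (intro conjI impI allI)
  have dom: "aniso_domain \<Omega> p"
    using assms(1-3) by unfold_locales (auto simp: regular_domain_def)
  {
    fix lam :: real
    assume hq: "q < p (Min UNIV)"
    have mono: "p (Min UNIV) \<le> p i" for i
      by (rule monoD[OF strict_mono_mono[OF assms(4)]]) (rule Min_le, simp_all)
    \<comment> \<open>The smallest exponent already exceeds \<open>q\<close>, so its direction can
      play the role of \<open>hi\<close>.\<close>
    interpret aniso_problem \<Omega> p q "Min UNIV"
      using dom assms(5) hq by (simp add: aniso_problem_def aniso_problem_axioms_def)
    have "q < p i" for i using hq mono by (rule less_le_trans)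
    from sublinear_existence[OF this] show "(\<exists>u. positive_solution \<Omega> p q lam u) \<longleftrightarrow> lam > 0"
      using nonpositive_parameter[of lam] not_le[of lam 0] by blast
  }
  assume hq: "p (Min UNIV) \<le> q \<and> q < p (Max UNIV)"
  \<comment> \<open>The largest exponent now plays the role of \<open>hi\<close>, the smallest that
    of \<open>lo\<close> in the lower bound for the parameter.\<close>
  interpret aniso_problem \<Omega> p q "Max UNIV"
    using dom assms(5) hq by (simp add: aniso_problem_def aniso_problem_axioms_def)
  show "\<exists>\<Lambda>::real. \<Lambda> > 0 \<and>
               (\<forall>lam<\<Lambda>. \<not> (\<exists>u. positive_solution \<Omega> p q lam u)) \<and>
               (\<forall>lam>\<Lambda>. \<exists>u. positive_solution \<Omega> p q lam u)"
    using threshold[of "Min UNIV"] hq by blast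
qed

end
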